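(* Assume the setting described in the context. Fix a time partition $\{\tau_n\}_{n=1}^N$ of $[0,T]$ with $\tau=\max_n\tau_n\in(0,\frac12]$. For $r>1$ let $\{w_r^n,q_r^n\}_{n=1}^N$ be a solution of the regularized semi-discrete problem $(\mathrm Q_r^\tau)$. Then there exists a subsequence of $\{\{w_r^n,q_r^n\}_{n=1}^N\}_{r>1}$ (not relabelled) such that, as $r\to1$, \begin{align*} w_r^n&\to w^n&&\text{strongly in }C(\overline\Omega),&&n=0,\dots,N,\\ M_\varepsilon(w_r^n)&\to M_\varepsilon(w^n)&&\text{strongly in }C(\overline\Omega),&&n=0,\dots,N,\\ q_r^n&\to q^n&&\text{vaguely in }[\mathcal M(\overline\Omega)]^d,&&n=1,\dots,N,\\ \nabla\cdot q_r^n&\to\nabla\cdot q^n&&\text{weakly in }L^2(\Omega),&&n=1,\dots,N, \end{align*} where $\{w^n,q^n\}_{n=1}^N$ is a solution of the semi-discrete problem $(\mathrm Q^\tau)$.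
   Context: Data. $d\in\{1,2\}$; $\Omega\subset\mathbb R^d$ is a bounded convex polygonal domain (an open interval if $d=1$) with Lipschitz boundary and outward unit normal $\nu$; $T>0$; $k_0>0$ and $\varepsilon>0$ are fixed constants; $f\in L^2(0,T;L^2(\Omega))$ is nonnegative; $w_0^\varepsilon\in W^{1,\infty}_0(\Omega)\cap C^1(\overline\Omega)$ satisfies $\nabla w_0^\varepsilon\cdot\nu<k_0$ on $\partial\Omega$. Here $W^{1,s}_0(\Omega)=\{\eta\in W^{1,s}(\Omega):\eta=0\text{ on }\partial\Omega\}$. The operator $M_\varepsilon:C(\overline\Omega)\to C(\overline\Omega)$ is defined, with $k_1^\varepsilon(x):=\max(k_0,|\nabla w_0^\varepsilon(x)|)$, by $M_\varepsilon(\eta)(x)=k_0$ if $\eta(x)\ge w_0^\varepsilon(x)+\varepsilon$; $M_\varepsilon(\eta)(x)=k_1^\varepsilon(x)+(k_0-k_1^\varepsilon(x))\frac{\eta(x)-w_0^\varepsilon(x)}{\varepsilon}$ if $\eta(x)\in[w_0^\varepsilon(x),w_0^\varepsilon(x)+\varepsilon]$; $M_\varepsilon(\eta)(x)=k_1^\varepsilon(x)$ if $\eta(x)\le w_0^\varepsilon(x)$. Notation. $(\cdot,\cdot)$ is the $L^2(\Omega)$ duality/inner product (also for vector functions). $p$ is given by $\frac1r+\frac1p=1$. $|a|^{r-2}a:=0$ for $a=0$. $\mathcal M(\overline\Omega)=[C(\overline\Omega)]^\star$ is the space of bounded Radon measures on $\overline\Omega$, with duality pairing $\langle\cdot,\cdot\rangle_{C(\overline\Omega)}$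 (also used componentwise for vector measures); $L^1(\Omega)\subset\mathcal M(\overline\Omega)$. For $v\in[\mathcal M(\overline\Omega)]^d$, $|v|$ is its total variation measure. $\mu_j\to\mu$ vaguely means $\langle\mu_j-\mu,\eta\rangle_{C(\overline\Omega)}\to0$ for all continuous $\eta$ on $\overline\Omega$. $V^r(\Omega):=\{v\in[L^r(\Omega)]^d:\nabla\cdot v\in L^2(\Omega)\}$ and $V^{\mathcal M}(\Omega):=\{v\in[\mathcal M(\overline\Omega)]^d:\nabla\cdot v\in L^2(\Omega)\}$, where $\nabla\cdot v\in L^2(\Omega)$ means that there is $u\in L^2(\Omega)$ (denoted $\nabla\cdot v$) with $\langle v,\nabla\phi\rangle_{C(\overline\Omega)}=-(u,\phi)$ for all $C^1$ functions $\phi$ with compact support in $\Omega$. Time discretization. $0=t_0<t_1<\dots<t_N=T$, $\tau_n=t_n-t_{n-1}$, $f^n:=\frac1{\tau_n}\int_{t_{n-1}}^{t_n}f(\cdot,t)\,dt$. Problem $(\mathrm Q_r^\tau)$: with $w_r^0=w_0^\varepsilon$, for $n=1,\dots,N$ find $w_r^n\in W_0^{1,p}(\Omega)$ and $q_r^n\in V^r(\Omega)$ such that $\left(\frac{w_r^n-w_r^{n-1}}{\tau_n},\eta\right)+(\nabla\cdot q_r^n,\eta)=(f^n,\eta)$ for all $\eta\in L^2(\Omega)$, and $(M_\varepsilon(w_r^n)|q_r^n|^{r-2}q_r^n,v)-(w_r^n,\nabla\cdot v)=0$ for all $v\in V^r(\Omega)$. Problem $(\mathrm Q^\tau)$: with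 $w^0=w_0^\varepsilon$, for $n=1,\dots,N$ find $w^n\in W^{1,\infty}_0(\Omega)$ and $q^n\in V^{\mathcal M}(\Omega)$ such that $\left(\frac{w^n-w^{n-1}}{\tau_n},\eta\right)+(\nabla\cdot q^n,\eta)=(f^n,\eta)$ for all $\eta\in L^2(\Omega)$, and $\langle|v|-|q^n|,M_\varepsilon(w^n)\rangle_{C(\overline\Omega)}-(\nabla\cdot(v-q^n),w^n)\ge0$ for all $v\in V^{\mathcal M}(\Omega)$. *)

theory Defs
  imports "HOL-Analysis.Analysis"
begin

text \<open>Functions on \<open>\<Omega>\<close> or on its closure are total functions on the ambient space; values outside
  the relevant set never matter. Elements of Lebesgue and Sobolev spaces are represented by
  measurable functions, with all conditions invariant under changes on null sets, except for
  \<open>W10\<close>, whose elements are given by their continuous representatives.\<close>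

subsection \<open>Domain\<close>

text \<open>The boundary of a bounded open convex set is automatically Lipschitz. In dimension 1 these are
  exactly the bounded nonempty open intervals.\<close>

definition convex_polygonal_domain :: "'a::euclidean_space set \<Rightarrow> bool" where
  "convex_polygonal_domain \<Omega> \<longleftrightarrow>
     open \<Omega> \<and> \<Omega> \<noteq> {} \<and> bounded \<Omega> \<and> convex \<Omega> \<and> polytope (closure \<Omega>)"

text \<open>For convex \<open>\<Omega>\<close>: the outward normal exists at a boundary point iff the cone of outward normal
  directions is a single ray. At the corners of a polygon there is no normal.\<close>

definition outward_unit_normal :: "'a::euclidean_space set \<Rightarrow> 'a \<Rightarrow> 'a \<Rightarrow> bool" where
  "outward_unit_normal \<Omega> x \<nu> \<longleftrightarrow>
     x \<in> frontier \<Omega> \<and> {u. norm u = 1 \<and> (\<forall>y\<in>\<Omega>. (y - x) \<bullet> u \<le> 0)} = {\<nu>}"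

subsection \<open>Lebesgue and Sobolev spaces\<close>

definition Lspace :: "'a::euclidean_space set \<Rightarrow> ennreal \<Rightarrow> ('a \<Rightarrow> 'b::euclidean_space) set" where
  "Lspace \<Omega> s = {f. f \<in> borel_measurable (lebesgue_on \<Omega>) \<and>
     (if s = \<infinity> then (\<exists>C. AE x in lebesgue_on \<Omega>. norm (f x) \<le> C)
      else integrable (lebesgue_on \<Omega>) (\<lambda>x. norm (f x) powr enn2real s))}"

definition L2_inner :: "'a::euclidean_space set \<Rightarrow> ('a \<Rightarrow> 'b::euclidean_space) \<Rightarrow> ('a \<Rightarrow> 'b) \<Rightarrow> real" where
  "L2_inner \<Omega> f g = integral\<^sup>L (lebesgue_on \<Omega>) (\<lambda>x. f x \<bullet> g x)"

text \<open>\<open>C1_test \<Omega> \<phi> D\<close>: \<open>\<phi>\<close> is a \<open>C\<^sup>1\<close> function with compact support in \<open>\<Omega>\<close> and gradient \<open>D\<close>.\<close>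

definition C1_test :: "'a::euclidean_space set \<Rightarrow> ('a \<Rightarrow> real) \<Rightarrow> ('a \<Rightarrow> 'a) \<Rightarrow> bool" where
  "C1_test \<Omega> \<phi> D \<longleftrightarrow>
     (\<forall>x. GDERIV \<phi> x :> D x) \<and> continuous_on UNIV D \<and>
     (\<exists>K. compact K \<and> K \<subseteq> \<Omega> \<and> (\<forall>x. x \<notin> K \<longrightarrow> \<phi> x = 0))"

definition weak_gradient :: "'a::euclidean_space set \<Rightarrow> ('a \<Rightarrow> real) \<Rightarrow> ('a \<Rightarrow> 'a) \<Rightarrow> bool" where
  "weak_gradient \<Omega> w g \<longleftrightarrow>
     (\<forall>\<phi> D. C1_test \<Omega> \<phi> D \<longrightarrow>
        integral\<^sup>L (lebesgue_on \<Omega>) (\<lambda>x. w x *\<^sub>R D x) = - integral\<^sup>L (lebesgue_on \<Omega>) (\<lambda>x. \<phi> x *\<^sub>R g x))"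

definition W1 :: "'a::euclidean_space set \<Rightarrow> ennreal \<Rightarrow> ('a \<Rightarrow> real) set" where
  "W1 \<Omega> s = {w. w \<in> Lspace \<Omega> s \<and> (\<exists>g. g \<in> Lspace \<Omega> s \<and> weak_gradient \<Omega> w g)}"

text \<open>For \<open>s\<close> greater than the dimension every element of \<open>W\<^sup>1\<^sup>,\<^sup>s(\<Omega>)\<close> has a unique representative
  continuous on the closure, and the boundary condition is pointwise for it. For smaller \<open>s\<close> the set
  below consists of the continuous elements of the zero trace space, the only ones to which the
  operator \<open>M_op\<close>, acting on continuous functions, applies.\<close>

definition W10 :: "'a::euclidean_space set \<Rightarrow> ennreal \<Rightarrow> ('a \<Rightarrow> real) set" where
  "W10 \<Omega> s = {w. w \<in> W1 \<Omega> s \<and> continuous_on (closure \<Omega>) w \<and> (\<forall>x\<in>frontier \<Omega>. w x = 0)}"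

text \<open>\<open>closure_gradient \<Omega> w g\<close>: \<open>g\<close> is the continuous extension to the closure of the classical
  gradient of \<open>w\<close> (unique there).\<close>

definition closure_gradient :: "'a::euclidean_space set \<Rightarrow> ('a \<Rightarrow> real) \<Rightarrow> ('a \<Rightarrow> 'a) \<Rightarrow> bool" where
  "closure_gradient \<Omega> w g \<longleftrightarrow> (\<forall>x\<in>\<Omega>. GDERIV w x :> g x) \<and> continuous_on (closure \<Omega>) g"

definition C1_closure :: "'a::euclidean_space set \<Rightarrow> ('a \<Rightarrow> real) set" where
  "C1_closure \<Omega> = {w. continuous_on (closure \<Omega>) w \<and> (\<exists>g. closure_gradient \<Omega> w g)}"

definition grad :: "'a::euclidean_space set \<Rightarrow> ('a \<Rightarrow> real) \<Rightarrow> 'a \<Rightarrow> 'a" where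
  "grad \<Omega> w = (SOME g. closure_gradient \<Omega> w g)"

subsection \<open>Measures as the dual of the continuous functions\<close>

text \<open>A bounded Radon measure on the compact set \<open>K\<close> is a bounded linear functional on \<open>C(K)\<close>. The
  bound also makes the value depend on the restriction of the argument to \<open>K\<close> only.\<close>

definition radon :: "'a::euclidean_space set \<Rightarrow> (('a \<Rightarrow> real) \<Rightarrow> real) set" where
  "radon K = {\<mu>.
     (\<forall>f g. continuous_on K f \<longrightarrow> continuous_on K g \<longrightarrow> \<mu> (\<lambda>x. f x + g x) = \<mu> f + \<mu> g) \<and>
     (\<forall>c f. continuous_on K f \<longrightarrow> \<mu> (\<lambda>x. c * f x) = c * \<mu> f) \<and>
     (\<exists>C. \<forall>f B. continuous_on K f \<longrightarrow> (\<forall>x\<in>K. \<bar>f x\<bar> \<le> B) \<longrightarrow> \<bar>\<mu> f\<bar> \<le> C * B)}"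

text \<open>A vector measure is given by its components \<open>v b\<close>, indexed by \<open>b \<in> Basis\<close>.\<close>

type_synonym 'a vmeas = "'a \<Rightarrow> ('a \<Rightarrow> real) \<Rightarrow> real"

definition vradon :: "'a::euclidean_space set \<Rightarrow> 'a vmeas set" where
  "vradon K = {v. \<forall>b\<in>Basis. v b \<in> radon K}"

definition vpair :: "'a::euclidean_space vmeas \<Rightarrow> ('a \<Rightarrow> 'a) \<Rightarrow> real" where
  "vpair v \<psi> = (\<Sum>b\<in>Basis. v b (\<lambda>x. \<psi> x \<bullet> b))"

text \<open>The total variation measure of \<open>v\<close>, again as a functional: on \<open>\<eta> \<ge> 0\<close> it is the supremum of
  \<open>\<langle>v, \<psi>\<rangle>\<close> over continuous vector fields \<open>\<psi>\<close> with \<open>|\<psi>| \<le> \<eta>\<close> (Bourbaki's definition of the absolute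
  value of a measure), and it is extended linearly through positive and negative parts.\<close>

definition total_variation :: "'a::euclidean_space set \<Rightarrow> 'a vmeas \<Rightarrow> ('a \<Rightarrow> real) \<Rightarrow> real" where
  "total_variation K v \<eta> =
     (let tv = (\<lambda>\<zeta>. Sup {vpair v \<psi> |\<psi>. continuous_on K \<psi> \<and> (\<forall>x\<in>K. norm (\<psi> x) \<le> \<zeta> x)})
      in tv (\<lambda>x. max 0 (\<eta> x)) - tv (\<lambda>x. max 0 (- \<eta> x)))"

definition vaguely_tendsto :: "'a::euclidean_space set \<Rightarrow> (nat \<Rightarrow> 'a vmeas) \<Rightarrow> 'a vmeas \<Rightarrow> bool" where
  "vaguely_tendsto K v u \<longleftrightarrow>
     (\<forall>b\<in>Basis. \<forall>\<eta>. continuous_on K \<eta> \<longrightarrow> (\<lambda>j. v j b \<eta>) \<longlonglongrightarrow> u b \<eta>)"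

text \<open>The embedding of \<open>L\<^sup>1\<close> vector fields into the vector measures.\<close>

definition vdens :: "'a::euclidean_space set \<Rightarrow> ('a \<Rightarrow> 'a) \<Rightarrow> 'a vmeas" where
  "vdens \<Omega> v = (\<lambda>b \<eta>. integral\<^sup>L (lebesgue_on \<Omega>) (\<lambda>x. \<eta> x * (v x \<bullet> b)))"

subsection \<open>Divergence\<close>

definition is_divergence :: "'a::euclidean_space set \<Rightarrow> 'a vmeas \<Rightarrow> ('a \<Rightarrow> real) \<Rightarrow> bool" where
  "is_divergence \<Omega> v u \<longleftrightarrow>
     u \<in> Lspace \<Omega> 2 \<and> (\<forall>\<phi> D. C1_test \<Omega> \<phi> D \<longrightarrow> vpair v D = - L2_inner \<Omega> u \<phi>)"

text \<open>The divergence is unique up to null sets, whenever it exists.\<close>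

definition divergence :: "'a::euclidean_space set \<Rightarrow> 'a vmeas \<Rightarrow> 'a \<Rightarrow> real" where
  "divergence \<Omega> v = (SOME u. is_divergence \<Omega> v u)"

definition VM :: "'a::euclidean_space set \<Rightarrow> 'a vmeas set" where
  "VM \<Omega> = {v. v \<in> vradon (closure \<Omega>) \<and> (\<exists>u. is_divergence \<Omega> v u)}"

definition Vr :: "'a::euclidean_space set \<Rightarrow> real \<Rightarrow> ('a \<Rightarrow> 'a) set" where
  "Vr \<Omega> r = {v. v \<in> Lspace \<Omega> (ennreal r) \<and> (\<exists>u. is_divergence \<Omega> (vdens \<Omega> v) u)}"

subsection \<open>The discretized problems\<close>

definition M_op ::
  "'a::euclidean_space set \<Rightarrow> real \<Rightarrow> real \<Rightarrow> ('a \<Rightarrow> real) \<Rightarrow> ('a \<Rightarrow> real) \<Rightarrow> 'a \<Rightarrow> real" where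
  "M_op \<Omega> k0 \<epsilon> w0 \<eta> x =
     (let k1 = max k0 (norm (grad \<Omega> w0 x)) in
      if \<eta> x \<ge> w0 x + \<epsilon> then k0
      else if \<eta> x \<ge> w0 x then k1 + (k0 - k1) * ((\<eta> x - w0 x) / \<epsilon>)
      else k1)"

text \<open>The mean of \<open>f\<close> over the \<open>n\<close>-th time interval; \<open>f s x\<close> is the value at time \<open>s\<close> and point \<open>x\<close>.\<close>

definition time_mean :: "(nat \<Rightarrow> real) \<Rightarrow> (real \<Rightarrow> 'a \<Rightarrow> real) \<Rightarrow> nat \<Rightarrow> 'a \<Rightarrow> real" where
  "time_mean t f n x =
     1 / (t n - t (n - 1)) * integral\<^sup>L (lebesgue_on {t (n - 1)..t n}) (\<lambda>s. f s x)"

text \<open>The evolution equation at step \<open>n\<close>, with the flux given as a vector measure.\<close>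

definition balance ::
  "'a::euclidean_space set \<Rightarrow> (nat \<Rightarrow> real) \<Rightarrow> (real \<Rightarrow> 'a \<Rightarrow> real) \<Rightarrow>
   (nat \<Rightarrow> 'a \<Rightarrow> real) \<Rightarrow> 'a vmeas \<Rightarrow> nat \<Rightarrow> bool" where
  "balance \<Omega> t f w q n \<longleftrightarrow>
     (\<forall>\<eta>. \<eta> \<in> Lspace \<Omega> 2 \<longrightarrow>
        L2_inner \<Omega> (\<lambda>x. (w n x - w (n - 1) x) / (t n - t (n - 1))) \<eta>
          + L2_inner \<Omega> (divergence \<Omega> q) \<eta>
        = L2_inner \<Omega> (time_mean t f n) \<eta>)"

text \<open>\<open>r / (r - 1)\<close> is the conjugate exponent of \<open>r\<close>. In HOL, \<open>0 powr a = 0\<close>, and in any case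
  \<open>|a|\<^sup>r\<^sup>-\<^sup>2 a = 0\<close> for \<open>a = 0\<close>.\<close>

definition solves_Qr ::
  "'a::euclidean_space set \<Rightarrow> real \<Rightarrow> real \<Rightarrow> ('a \<Rightarrow> real) \<Rightarrow> (real \<Rightarrow> 'a \<Rightarrow> real) \<Rightarrow>
   (nat \<Rightarrow> real) \<Rightarrow> nat \<Rightarrow> real \<Rightarrow> (nat \<Rightarrow> 'a \<Rightarrow> real) \<Rightarrow> (nat \<Rightarrow> 'a \<Rightarrow> 'a) \<Rightarrow> bool" where
  "solves_Qr \<Omega> k0 \<epsilon> w0 f t N r w q \<longleftrightarrow>
     (\<forall>x\<in>closure \<Omega>. w 0 x = w0 x) \<and>
     (\<forall>n\<in>{1..N}.
        w n \<in> W10 \<Omega> (ennreal (r / (r - 1))) \<and>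
        q n \<in> Vr \<Omega> r \<and>
        balance \<Omega> t f w (vdens \<Omega> (q n)) n \<and>
        (\<forall>v\<in>Vr \<Omega> r.
           L2_inner \<Omega> (\<lambda>x. (M_op \<Omega> k0 \<epsilon> w0 (w n) x * norm (q n x) powr (r - 2)) *\<^sub>R q n x) v
             - L2_inner \<Omega> (w n) (divergence \<Omega> (vdens \<Omega> v)) = 0))"

definition solves_Q ::
  "'a::euclidean_space set \<Rightarrow> real \<Rightarrow> real \<Rightarrow> ('a \<Rightarrow> real) \<Rightarrow> (real \<Rightarrow> 'a \<Rightarrow> real) \<Rightarrow>
   (nat \<Rightarrow> real) \<Rightarrow> nat \<Rightarrow> (nat \<Rightarrow> 'a \<Rightarrow> real) \<Rightarrow> (nat \<Rightarrow> 'a vmeas) \<Rightarrow> bool" where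
  "solves_Q \<Omega> k0 \<epsilon> w0 f t N w q \<longleftrightarrow>
     (\<forall>x\<in>closure \<Omega>. w 0 x = w0 x) \<and>
     (\<forall>n\<in>{1..N}.
        w n \<in> W10 \<Omega> \<infinity> \<and>
        q n \<in> VM \<Omega> \<and>
        balance \<Omega> t f w (q n) n \<and>
        (\<forall>v\<in>VM \<Omega>.
           total_variation (closure \<Omega>) v (M_op \<Omega> k0 \<epsilon> w0 (w n))
             - total_variation (closure \<Omega>) (q n) (M_op \<Omega> k0 \<epsilon> w0 (w n))
             - L2_inner \<Omega> (divergence \<Omega> (v - q n)) (w n) \<ge> 0))"

end

theory Submission
  imports Defs "HOL-Complex_Analysis.Great_Picard"
begin

text \<open>Testing the second equation of \<open>(Q\<^sub>r)\<close> with \<open>v = \<phi> b\<close>, where \<open>\<phi>\<close> need not vanish on the boundary,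
  shows that \<open>w\<^sub>r\<close> extended by zero has the weak gradient \<open>- M |q\<^sub>r|\<^sup>r\<^sup>-\<^sup>2 q\<^sub>r\<close>, of modulus \<open>M |q\<^sub>r|\<^sup>r\<^sup>-\<^sup>1\<close>. The energy
  identity bounds the integral of \<open>|q\<^sub>r|\<^sup>r\<close>, so averages of \<open>|q\<^sub>r|\<^sup>r\<^sup>-\<^sup>1\<close> over balls of radius \<open>h\<close> are at most of
  order \<open>h\<close> to the power \<open>-1/2\<close> for \<open>r\<close> near 1 (Morrey's argument then gives equi-Hoelder continuity of \<open>w\<^sub>r\<close>,
  and Arzela-Ascoli a uniform limit \<open>w\<close>), and for fixed \<open>h\<close> their upper limit is at most 1 (so \<open>w\<close> is Lipschitz
  with local constant \<open>M(w)\<close>). The sum of the difference quotient and the divergence does not depend on \<open>r\<close>, so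
  the divergences converge strongly. The variational inequality for \<open>q\<close> splits into
  \<open>\<langle>|q|, M(w)\<rangle> \<le> (\<nabla>\<cdot>q, w)\<close>, by lower semicontinuity in the energy identity, and \<open>(\<nabla>\<cdot>v, w) \<le> \<langle>|v|, M(w)\<rangle>\<close> for all
  \<open>v\<close>, by approximating \<open>w\<close> by truncated and mollified functions \<open>\<phi>\<close> with \<open>|\<nabla>\<phi>| \<le> M(w) + \<epsilon>\<close>.\<close>

text \<open>The obstacle is that every bound must survive r -> 1, where the fluxes are controlled
  only as measures and the conjugate exponent blows up. For |q|^(r-1) this becomes an advantage: it
  is the power \<theta> = (r - 1) / r of |q|^r, whose integral is bounded, so its average over a
  ball of radius h in dimension d is of order h to the power - d \<theta>. As soon as d \<theta>
  \<le> 1/2 this is no worse than the power -1/2, and for fixed h the bound tends to 1 as \<theta>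
  -> 0. The regularity of w comes from one kernel of width h. Its derivative in the centre and its
  derivative in the width both turn into averages of the gradient at that width, so the smoothness
  of an average of w and its distance from w are governed by the same quantity. The weight M(w)
  depends on the unknown, so vague convergence of the fluxes has to be paired with uniform
  convergence of w; in the energy the divergence is traded for w by the balance equation. The
  constants of a step depend on a sup bound for the previous step, hence the induction over the
  steps.\<close>

subsection \<open>Integrals of compactly supported functions\<close>

text \<open>Links the Bochner integral of the problems to the gauge integral over a box, the form in
  which the Leibniz rules below differentiate under the integral sign.\<close>

lemma integrable_lborel_continuous_support:
  fixes f :: "'a::euclidean_space \<Rightarrow> 'b::euclidean_space"
  assumes "continuous_on UNIV f" and "\<And>x. x \<notin> cbox a b \<Longrightarrow> f x = 0"
  shows "integrable lborel f" and "integral\<^sup>L lborel f = integral (cbox a b) f"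
proof -
  have "set_integrable lborel (cbox a b) f"
    unfolding set_integrable_def
    by (rule borel_integrable_compact) (use assms(1) in \<open>auto intro: continuous_on_subset\<close>)
  moreover have eq: "(\<lambda>x. indicator (cbox a b) x *\<^sub>R f x) = f"
    using assms(2) by (auto simp: fun_eq_iff indicator_def)
  ultimately show int: "integrable lborel f"
    by (simp add: set_integrable_def)
  have "(f has_integral integral\<^sup>L lborel f) UNIV"
    by (rule has_integral_integral_lborel[OF int])
  then have "(f has_integral integral\<^sup>L lborel f) (cbox a b)"
    using has_integral_restrict_UNIV[of "cbox a b" f] assms(2)
    by (smt (verit, best) has_integral_cong)
  then show "integral\<^sup>L lborel f = integral (cbox a b) f"
    by (simp add: integral_unique)
qed

lemma lebesgue_on_integral_support:
  fixes f :: "'a::euclidean_space \<Rightarrow> 'b::euclidean_space"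
  assumes S: "S \<in> sets lebesgue" and f: "f \<in> borel_measurable borel" and "\<And>x. x \<notin> S \<Longrightarrow> f x = 0"
  shows "integral\<^sup>L (lebesgue_on S) f = integral\<^sup>L lborel f"
proof -
  have "integral\<^sup>L (lebesgue_on S) f = integral\<^sup>L lebesgue (\<lambda>x. indicator S x *\<^sub>R f x)"
    using S by (subst integral_restrict_space) auto
  also have "(\<lambda>x. indicator S x *\<^sub>R f x) = f"
    using assms(3) by (auto simp: fun_eq_iff indicator_def)
  also have "integral\<^sup>L lebesgue f = integral\<^sup>L lborel f"
    using f by (intro integral_completion) auto
  finally show ?thesis .
qed

lemma lborel_integral_affine:
  fixes f :: "'a::euclidean_space \<Rightarrow> 'b::euclidean_space"
  assumes "f \<in> borel_measurable borel" "c \<noteq> 0"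
  shows "integral\<^sup>L lborel f = \<bar>c\<bar> ^ DIM('a) *\<^sub>R integral\<^sup>L lborel (\<lambda>x. f (t + c *\<^sub>R x))"
proof -
  have "integral\<^sup>L lborel f
      = integral\<^sup>L (density (distr lborel borel (\<lambda>x. t + c *\<^sub>R x)) (\<lambda>_. ennreal (\<bar>c\<bar> ^ DIM('a)))) f"
    using lborel_affine[OF assms(2), of t] by (simp add: ennreal_power)
  also have "\<dots> = \<bar>c\<bar> ^ DIM('a) *\<^sub>R integral\<^sup>L lborel (\<lambda>x. f (t + c *\<^sub>R x))"
    using assms by (subst integral_density) (auto simp: integral_distr)
  finally show ?thesis .
qed

subsection \<open>Continuously differentiable functions\<close>

text \<open>Unlike \<open>C1_test\<close> there is no condition on the support: these are the \<phi>
  for which the flux \<phi> b need not vanish on the boundary of \<Omega>.\<close>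

definition C1_fun :: "('a::euclidean_space \<Rightarrow> real) \<Rightarrow> ('a \<Rightarrow> 'a) \<Rightarrow> bool" where
  "C1_fun \<phi> D \<longleftrightarrow> (\<forall>x. GDERIV \<phi> x :> D x) \<and> continuous_on UNIV D"

lemma C1_fun_continuous: "C1_fun \<phi> D \<Longrightarrow> continuous_on UNIV \<phi>"
  unfolding C1_fun_def gderiv_def
  by (meson continuous_at_imp_continuous_on has_derivative_continuous)

lemma GDERIV_zero_open:
  assumes "open S" "x \<in> S" "\<And>y. y \<in> S \<Longrightarrow> \<phi> y = 0" "GDERIV \<phi> x :> D"
  shows "D = 0"
proof -
  have "(\<phi> has_derivative (\<lambda>h. h \<bullet> 0)) (at x)"
    by (rule has_derivative_transform_within_open[OF _ assms(1,2), of "\<lambda>_. 0"]) (use assms(3) in auto)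
  then have "(\<lambda>h. h \<bullet> D) = (\<lambda>h. h \<bullet> 0)"
    using assms(4) has_derivative_unique unfolding gderiv_def by blast
  then have "D \<bullet> D = 0" by (metis inner_zero_right)
  then show ?thesis by simp
qed

lemma GDERIV_imp_directional:
  assumes "GDERIV \<phi> (x + s *\<^sub>R b) :> D"
  shows "((\<lambda>s. \<phi> (x + s *\<^sub>R b)) has_field_derivative (D \<bullet> b)) (at s within S)"
proof -
  have "((\<lambda>s. \<phi> (x + s *\<^sub>R b)) has_derivative (\<lambda>h. (h *\<^sub>R b) \<bullet> D)) (at s within S)"
    by (rule has_derivative_compose[where f="\<lambda>s. x + s *\<^sub>R b"])
      (use assms in \<open>auto simp: gderiv_def intro!: derivative_eq_intros\<close>)
  then show ?thesis
    unfolding has_field_derivative_def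
    by (rule has_derivative_eq_rhs) (auto simp: inner_commute mult.commute)
qed

text \<open>By translation invariance the integral of F(x + s b) does not depend on s, and its
  derivative at s = 0 is the integral in question. Applied to products in
  \<open>C1_fun_is_divergence\<close>, this is integration by parts.\<close>

lemma integral_partial_derivative_eq_0:
  fixes F :: "'a::euclidean_space \<Rightarrow> real"
  assumes F: "C1_fun F D" and K: "compact K" "\<And>x. x \<notin> K \<Longrightarrow> F x = 0"
  shows "integral\<^sup>L lborel (\<lambda>x. D x \<bullet> b) = 0"
proof -
  obtain B where B: "\<And>x. x \<in> K \<Longrightarrow> norm x \<le> B"
    using compact_imp_bounded[OF K(1)] unfolding bounded_iff by auto
  \<comment> \<open>Shifts by s b with |s| < 1 keep the support in the ball of radius R, so one box
    serves all of them.\<close>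
  define R where "R = B + norm b"
  obtain a c :: 'a where ac: "cball 0 R \<subseteq> cbox a c"
    using bounded_subset_cbox_symmetric[OF bounded_cball] by metis
  have D0: "D x = 0" if "x \<notin> K" for x
  proof (rule GDERIV_zero_open[of "- K"])
    show "GDERIV F x :> D x" using F by (simp add: C1_fun_def)
  qed (use K that in \<open>auto simp: compact_imp_closed\<close>)
  have contF: "continuous_on UNIV F" by (rule C1_fun_continuous[OF F])
  have contD: "continuous_on UNIV D" using F by (simp add: C1_fun_def)
  have sh: "integral (cbox a c) (\<lambda>x. F (x + s *\<^sub>R b)) = integral\<^sup>L lborel F" if s: "s \<in> {-1<..<1}" for s
  proof -
    have "integral\<^sup>L lborel (\<lambda>x. F (x + s *\<^sub>R b)) = integral (cbox a c) (\<lambda>x. F (x + s *\<^sub>R b))"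
    proof (rule integrable_lborel_continuous_support(2))
      show "continuous_on UNIV (\<lambda>x. F (x + s *\<^sub>R b))"
        by (intro continuous_on_compose2[OF contF] continuous_intros) auto
      fix x assume "x \<notin> cbox a c"
      then have "norm x > R" using ac by (auto simp: subset_iff not_le[symmetric])
      moreover have "norm (s *\<^sub>R b) \<le> norm b" using s by (auto simp: mult_left_le_one_le)
      moreover have "norm x \<le> norm (x + s *\<^sub>R b) + norm (s *\<^sub>R b)"
        by (metis add_diff_cancel norm_triangle_ineq4)
      ultimately have "x + s *\<^sub>R b \<notin> K" using B[of "x + s *\<^sub>R b"] unfolding R_def by linarith
      then show "F (x + s *\<^sub>R b) = 0" by (rule K(2))
    qed
    moreover have "integral\<^sup>L lborel (\<lambda>x. F (x + s *\<^sub>R b)) = integral\<^sup>L lborel F"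
      using lborel_integral_affine[of F 1 "s *\<^sub>R b"] contF
      by (simp add: borel_measurable_continuous_onI add.commute)
    ultimately show ?thesis by simp
  qed
  have "((\<lambda>s. integral (cbox a c) (\<lambda>x. F (x + s *\<^sub>R b))) has_field_derivative
      integral (cbox a c) (\<lambda>x. D (x + 0 *\<^sub>R b) \<bullet> b)) (at 0 within {-1<..<1})"
  proof (rule leibniz_rule_field_derivative)
    show "((\<lambda>s. F (x + s *\<^sub>R b)) has_field_derivative D (x + s *\<^sub>R b) \<bullet> b) (at s within {-1<..<1})" for s x
      by (rule GDERIV_imp_directional) (use F in \<open>auto simp: C1_fun_def\<close>)
    show "(\<lambda>x. F (x + s *\<^sub>R b)) integrable_on cbox a c" for s
      by (intro integrable_continuous continuous_on_compose2[OF contF] continuous_intros) auto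
    show "continuous_on ({- 1<..<1} \<times> cbox a c) (\<lambda>(s, x). D (x + s *\<^sub>R b) \<bullet> b)"
      unfolding case_prod_beta
      by (intro continuous_on_inner continuous_on_const continuous_on_compose2[OF contD] continuous_intros) auto
  qed auto
  moreover have "((\<lambda>s. integral (cbox a c) (\<lambda>x. F (x + s *\<^sub>R b))) has_field_derivative 0) (at 0 within {-1<..<1})"
    by (rule has_field_derivative_transform_within[of "\<lambda>_. integral\<^sup>L lborel F" _ _ _ 1])
      (simp_all add: sh)
  moreover have "at 0 within {-1<..<1} = at (0::real)"
    by (rule at_within_open) auto
  ultimately have "integral (cbox a c) (\<lambda>x. D x \<bullet> b) = 0"
    using DERIV_unique by (metis (mono_tags, lifting) add.right_neutral scale_zero_left integral_cong)
  moreover have "integral\<^sup>L lborel (\<lambda>x. D x \<bullet> b) = integral (cbox a c) (\<lambda>x. D x \<bullet> b)"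
  proof (rule integrable_lborel_continuous_support(2))
    show "continuous_on UNIV (\<lambda>x. D x \<bullet> b)"
      using F by (auto simp: C1_fun_def intro!: continuous_intros)
    fix x assume "x \<notin> cbox a c"
    then have "x \<notin> K" using ac B[of x] by (auto simp: R_def subset_iff) (smt (verit) norm_ge_zero)
    then show "D x \<bullet> b = 0" using D0 by simp
  qed
  ultimately show ?thesis by simp
qed

subsection \<open>Mollifiers\<close>

lemma DERIV_max0_square: "((\<lambda>t::real. (max 0 t)\<^sup>2) has_real_derivative 2 * max 0 t) (at t)"
proof -
  consider "t > 0" | "t < 0" | "t = 0" by linarith
  then show ?thesis
  proof cases
    case 1
    have "((\<lambda>t::real. (max 0 t)\<^sup>2) has_real_derivative 2 * t) (at t)"
      by (rule has_field_derivative_transform_within_open[of "\<lambda>t. t\<^sup>2" _ _ "{0<..}"])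
        (use 1 in \<open>auto intro!: derivative_eq_intros\<close>)
    then show ?thesis using 1 by simp
  next
    case 2
    have "((\<lambda>t::real. (max 0 t)\<^sup>2) has_real_derivative 0) (at t)"
      by (rule has_field_derivative_transform_within_open[of "\<lambda>t. 0" _ _ "{..<0}"])
        (use 2 in \<open>auto intro!: derivative_eq_intros\<close>)
    then show ?thesis using 2 by simp
  next
    case 3
    have "((\<lambda>h::real. (max 0 h)\<^sup>2 / h) \<longlongrightarrow> 0) (at 0)"
    proof (rule Lim_null_comparison)
      show "\<forall>\<^sub>F h::real in at 0. norm ((max 0 h)\<^sup>2 / h) \<le> \<bar>h\<bar>"
        by (rule always_eventually) (auto simp: max_def power2_eq_square)
      show "((\<lambda>h::real. \<bar>h\<bar>) \<longlongrightarrow> 0) (at 0)"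
        by (intro tendsto_rabs_zero tendsto_ident_at)
    qed
    then show ?thesis using 3 by (simp add: DERIV_def)
  qed
qed

text \<open>A polynomial kernel: squaring the positive part makes it exactly as smooth as
  \<open>C1_test\<close> asks, and its gradient is a closed formula.\<close>

definition bump :: "'a::euclidean_space \<Rightarrow> real" where
  "bump z = (max 0 (1 - z \<bullet> z))\<^sup>2"

definition bump_grad :: "'a::euclidean_space \<Rightarrow> 'a" where
  "bump_grad z = (- 4 * max 0 (1 - z \<bullet> z)) *\<^sub>R z"

lemma GDERIV_bump: "GDERIV bump z :> bump_grad z"
proof -
  have "GDERIV (\<lambda>z. 1 - z \<bullet> z) z :> - 2 *\<^sub>R z"
    unfolding gderiv_def by (auto intro!: derivative_eq_intros simp: inner_commute)
  from GDERIV_DERIV_compose[OF this DERIV_max0_square]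
  show ?thesis by (simp add: bump_def[abs_def] bump_grad_def)
qed

lemma continuous_bump: "continuous_on UNIV bump" "continuous_on UNIV bump_grad"
  unfolding bump_def[abs_def] bump_grad_def[abs_def] by (intro continuous_intros)+

lemma bump_bounds: "0 \<le> bump z" "bump z \<le> 1"
  unfolding bump_def by (auto simp: power_le_one)

lemma bump_support:
  assumes "1 \<le> norm z"
  shows "bump z = 0" "bump_grad z = 0"
proof -
  have "1 \<le> z \<bullet> z"
    using assms by (simp add: dot_square_norm one_le_power)
  then show "bump z = 0" "bump_grad z = 0" by (simp_all add: bump_def bump_grad_def)
qed

definition bump_mass :: "'a::euclidean_space itself \<Rightarrow> real" where
  "bump_mass _ = integral\<^sup>L lborel (bump :: 'a \<Rightarrow> real)"

lemma integrable_bump: "integrable lborel (bump :: 'a::euclidean_space \<Rightarrow> real)"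
proof -
  obtain a c :: 'a where ac: "cball 0 1 \<subseteq> cbox a c"
    using bounded_subset_cbox_symmetric[OF bounded_cball] by metis
  show ?thesis
  proof (rule integrable_lborel_continuous_support(1)[OF continuous_bump(1)])
    fix x :: 'a assume "x \<notin> cbox a c"
    then show "bump x = 0" using ac by (intro bump_support) (auto simp: subset_iff intro: less_imp_le not_le_imp_less)
  qed
qed

lemma bump_mass_pos: "bump_mass TYPE('a::euclidean_space) > 0"
proof -
  \<comment> \<open>For norm x < 1/2 the positive part of 1 - x \<bullet> x is at least 1/2, so its
    square is at least 1/4.\<close>
  have "0 < 1/4 * measure lborel (ball (0::'a) (1/2))"
    using content_ball_pos[of "1/2" "0::'a"] by simp
  also have "\<dots> = integral\<^sup>L lborel (\<lambda>x. 1/4 * indicator (ball (0::'a) (1/2)) x)"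
    by simp
  also have "\<dots> \<le> integral\<^sup>L lborel (bump :: 'a \<Rightarrow> real)"
  proof (rule integral_mono[OF _ integrable_bump])
    show "integrable lborel (\<lambda>x. 1/4 * indicator (ball (0::'a) (1/2)) x :: real)"
      by (intro integrable_mult_right integrable_real_indicator) (use emeasure_lborel_ball_finite[of "0::'a" "1/2"] in \<open>auto simp: less_top\<close>)
    fix x :: 'a
    show "1/4 * indicator (ball 0 (1/2)) x \<le> bump x"
    proof (cases "norm x < 1/2")
      case True
      then have "x \<bullet> x \<le> (1/2)\<^sup>2" unfolding dot_square_norm by (intro power_mono) auto
      then have m: "1/2 \<le> max 0 (1 - x \<bullet> x)" by (simp add: power2_eq_square max_def)
      have "1/4 = (1/2::real)\<^sup>2" by (simp add: power2_eq_square)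
      also have "\<dots> \<le> bump x" unfolding bump_def by (rule power_mono[OF m]) simp
      finally show ?thesis using True by simp
    qed (auto simp: bump_bounds)
  qed
  finally show ?thesis by (simp add: bump_mass_def)
qed

definition moll :: "real \<Rightarrow> 'a::euclidean_space \<Rightarrow> real" where
  "moll h z = bump (z /\<^sub>R h) / (h ^ DIM('a) * bump_mass TYPE('a))"

definition moll_grad :: "real \<Rightarrow> 'a::euclidean_space \<Rightarrow> 'a" where
  "moll_grad h z = (1 / (h ^ DIM('a) * bump_mass TYPE('a) * h)) *\<^sub>R bump_grad (z /\<^sub>R h)"

lemma moll_nonneg: "h > 0 \<Longrightarrow> 0 \<le> moll h (z::'a::euclidean_space)"
  unfolding moll_def using bump_mass_pos[where 'a='a] by (intro divide_nonneg_nonneg bump_bounds) simp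

lemma moll_le: "h > 0 \<Longrightarrow> moll h (z::'a) \<le> 1 / (h ^ DIM('a::euclidean_space) * bump_mass TYPE('a))"
  unfolding moll_def using bump_bounds[of "z /\<^sub>R h"] bump_mass_pos[where 'a='a]
  by (intro divide_right_mono) (auto simp: less_imp_le)

lemma moll_support:
  assumes "h > 0" "h \<le> norm z"
  shows "moll h z = 0" "moll_grad h z = 0"
proof -
  have "1 \<le> norm (z /\<^sub>R h)" using assms by (simp add: field_simps)
  then show "moll h z = 0" "moll_grad h z = 0"
    by (simp_all add: moll_def moll_grad_def bump_support)
qed

lemma GDERIV_moll:
  assumes "h > 0"
  shows "GDERIV (moll h) z :> moll_grad h (z::'a::euclidean_space)"
proof -
  let ?c = "h ^ DIM('a) * bump_mass TYPE('a)"
  have "((\<lambda>z. bump (z /\<^sub>R h)) has_derivative (\<lambda>y. (y /\<^sub>R h) \<bullet> bump_grad (z /\<^sub>R h))) (at z)"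
    by (rule has_derivative_compose[where f="\<lambda>z. z /\<^sub>R h"])
      (use GDERIV_bump in \<open>auto simp: gderiv_def intro!: derivative_eq_intros\<close>)
  then have "((\<lambda>z. (1 / ?c) * bump (z /\<^sub>R h)) has_derivative
      (\<lambda>y. (1 / ?c) * ((y /\<^sub>R h) \<bullet> bump_grad (z /\<^sub>R h)))) (at z)"
    by (rule has_derivative_mult_right)
  then show ?thesis
    unfolding gderiv_def moll_def[abs_def] moll_grad_def by (simp add: field_simps)
qed

lemma continuous_moll: "continuous_on UNIV (moll h)" "continuous_on UNIV (moll_grad h)"
  unfolding moll_def[abs_def] moll_grad_def[abs_def]
  using bump_mass_pos
  by (cases "h = 0"; auto intro!: continuous_intros continuous_on_compose2[OF continuous_bump(1)]
      continuous_on_compose2[OF continuous_bump(2)] simp: divide_inverse)+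

lemma C1_fun_moll_shift: 
  assumes "h > 0"
  shows "C1_fun (\<lambda>u. moll h (u - x)) (\<lambda>u. moll_grad h (u - x))"
proof -
  have "((\<lambda>u. moll h (u - x)) has_derivative (\<lambda>y. y \<bullet> moll_grad h (u - x))) (at u)" for u
    by (rule has_derivative_compose[where f="\<lambda>u. u - x"])
      (use GDERIV_moll[OF assms] in \<open>auto simp: gderiv_def intro!: derivative_eq_intros\<close>)
  then show ?thesis
    unfolding C1_fun_def gderiv_def
    by (auto intro!: continuous_intros continuous_on_compose2[OF continuous_moll(2)])
qed

lemma integral_moll:
  assumes "h > 0"
  shows "integrable lborel (moll h :: 'a::euclidean_space \<Rightarrow> real)" "integral\<^sup>L lborel (moll h :: 'a \<Rightarrow> real) = 1"
proof -
  obtain a c :: 'a where ac: "cball 0 h \<subseteq> cbox a c"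
    using bounded_subset_cbox_symmetric[OF bounded_cball] by metis
  show "integrable lborel (moll h :: 'a \<Rightarrow> real)"
  proof (rule integrable_lborel_continuous_support(1)[OF continuous_moll(1)])
    fix x :: 'a assume "x \<notin> cbox a c"
    then show "moll h x = 0" using ac assms by (intro moll_support) (auto simp: subset_iff intro: less_imp_le not_le_imp_less)
  qed
  have "integral\<^sup>L lborel (moll h :: 'a \<Rightarrow> real) = h ^ DIM('a) * integral\<^sup>L lborel (\<lambda>x::'a. moll h (h *\<^sub>R x))"
    using lborel_integral_affine[of "moll h" h "0::'a"] assms
      borel_measurable_continuous_onI[OF continuous_moll(1)[of h, where 'a='a]] by simp
  also have "\<dots> = 1"
    using assms bump_mass_pos[where 'a='a]
    by (simp add: moll_def bump_mass_def less_imp_neq[THEN not_sym])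
  finally show "integral\<^sup>L lborel (moll h :: 'a \<Rightarrow> real) = 1" .
qed

text \<open>Differentiating in the width, not in the centre, is what compares w with its averages:
  \<open>conv_close\<close> follows the average while the width shrinks to 0.\<close>

lemma DERIV_moll_scale:
  assumes "h > 0"
  shows "((\<lambda>h. moll h (z::'a::euclidean_space)) has_field_derivative
     - (1 / h) * (DIM('a) * moll h z + z \<bullet> moll_grad h z)) (at h)"
proof -
  let ?m = "bump_mass TYPE('a)"
  have "(bump has_derivative (\<lambda>y. y \<bullet> bump_grad (z /\<^sub>R h))) (at (z /\<^sub>R h))"
    using GDERIV_bump by (simp add: gderiv_def)
  moreover have "((\<lambda>h. z /\<^sub>R h) has_derivative (\<lambda>s. s *\<^sub>R (- (1 / h\<^sup>2) *\<^sub>R z))) (at h)"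
    using assms by (auto intro!: derivative_eq_intros simp: power2_eq_square field_simps)
  ultimately have "((\<lambda>h. bump (z /\<^sub>R h)) has_derivative
      (\<lambda>s. (s *\<^sub>R (- (1 / h\<^sup>2) *\<^sub>R z)) \<bullet> bump_grad (z /\<^sub>R h))) (at h)"
    by (rule has_derivative_compose[rotated])
  then have 1: "((\<lambda>h. bump (z /\<^sub>R h)) has_field_derivative - (1 / h\<^sup>2) * (z \<bullet> bump_grad (z /\<^sub>R h))) (at h)"
    unfolding has_field_derivative_def by (rule has_derivative_eq_rhs) (auto simp: algebra_simps)
  have nz: "h ^ DIM('a) * ?m \<noteq> 0" using assms bump_mass_pos[where 'a='a] by simp
  have 2: "((\<lambda>h. h ^ DIM('a) * ?m) has_field_derivative (DIM('a) * h ^ (DIM('a) - 1)) * ?m) (at h)"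
    by (auto intro!: derivative_eq_intros)
  have 3: "h ^ DIM('a) = h * h ^ (DIM('a) - 1)"
    using DIM_positive[where 'a='a] by (metis Suc_diff_1 power_Suc)
  show ?thesis
    unfolding moll_def[abs_def]
    apply (rule DERIV_cong[OF DERIV_divide[OF 1 2 nz]])
    using assms bump_mass_pos[where 'a='a] unfolding moll_grad_def 3
    by (simp add: field_simps power2_eq_square)
qed

section \<open>Averages against the mollifier, as functions of the centre and of the width\<close>

definition conv :: "real \<Rightarrow> ('a::euclidean_space \<Rightarrow> real) \<Rightarrow> 'a \<Rightarrow> real" where
  "conv h w x = integral\<^sup>L lborel (\<lambda>u. w u * moll h (u - x))"

lemma continuous_on_moll_compose [continuous_intros]:
  "continuous_on S f \<Longrightarrow> continuous_on S (\<lambda>x. moll h (f x))"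
  "continuous_on S f \<Longrightarrow> continuous_on S (\<lambda>x. moll_grad h (f x))"
  by (auto intro: continuous_on_compose2[OF continuous_moll(1)] continuous_on_compose2[OF continuous_moll(2)])

lemma integrable_mult_moll:
  fixes w :: "'a::euclidean_space \<Rightarrow> real"
  assumes w: "continuous_on UNIV w" and h: "h > 0"
  shows "integrable lborel (\<lambda>u. w u * moll h (u - x))"
proof -
  obtain a c :: 'a where ac: "cball x h \<subseteq> cbox a c"
    using bounded_subset_cbox_symmetric[OF bounded_cball] by metis
  show ?thesis
  proof (rule integrable_lborel_continuous_support(1))
    show "continuous_on UNIV (\<lambda>u. w u * moll h (u - x))"
      by (intro continuous_intros w)
    fix u assume "u \<notin> cbox a c"
    then have "u \<notin> cball x h" using ac by auto
    then show "w u * moll h (u - x) = 0"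
      using h by (simp add: moll_support dist_norm norm_minus_commute)
  qed
qed

lemma integrable_moll_shift:
  assumes "h > 0"
  shows "integrable lborel (\<lambda>u::'a::euclidean_space. moll h (u - x))"
    "integral\<^sup>L lborel (\<lambda>u::'a. moll h (u - x)) = 1"
proof -
  show "integrable lborel (\<lambda>u. moll h (u - x))"
    using integrable_mult_moll[of "\<lambda>_. 1" h x] assms by simp
  have "integral\<^sup>L lborel (\<lambda>u::'a. moll h (u - x)) = integral\<^sup>L lborel (\<lambda>u::'a. moll h (x + 1 *\<^sub>R u - x))"
    using lborel_integral_affine[of "\<lambda>u. moll h (u - x)" 1 x]
    by (simp add: borel_measurable_continuous_onI continuous_intros)
  then show "integral\<^sup>L lborel (\<lambda>u::'a. moll h (u - x)) = 1"
    using integral_moll(2)[OF assms, where 'a='a] by simp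
qed

lemma conv_shift:
  fixes w :: "'a::euclidean_space \<Rightarrow> real"
  assumes "continuous_on UNIV w"
  shows "conv h w x = integral\<^sup>L lborel (\<lambda>y. w (x + y) * moll h y)"
  using lborel_integral_affine[of "\<lambda>u. w u * moll h (u - x)" 1 x] assms
  by (simp add: conv_def borel_measurable_continuous_onI continuous_intros)

text \<open>After a shift both averages have the same kernel, of mass 1 and supported in the ball of
  radius h. Two functions and two points are allowed at once: w = v gives moduli of continuity, x =
  x' gives stability under uniform perturbation, and a constant v gives the approximation
  error.\<close>

lemma conv_diff_bound:
  fixes w v :: "'a::euclidean_space \<Rightarrow> real"
  assumes w: "continuous_on UNIV w" and v: "continuous_on UNIV v" and h: "h > 0"
    and le: "\<And>y. norm y < h \<Longrightarrow> \<bar>w (x + y) - v (x' + y)\<bar> \<le> e"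
  shows "\<bar>conv h w x - conv h v x'\<bar> \<le> e"
proof -
  have cont: "continuous_on UNIV (\<lambda>y. f (z + y))" if "continuous_on UNIV f" for f :: "'a \<Rightarrow> real" and z
    by (intro continuous_on_compose2[OF that] continuous_intros) auto
  have i1: "integrable lborel (\<lambda>y. f (z + y) * moll h y)" if "continuous_on UNIV f" for f :: "'a \<Rightarrow> real" and z
    using integrable_mult_moll[OF cont[OF that] h, of z 0] by simp
  have "conv h w x - conv h v x' = integral\<^sup>L lborel (\<lambda>y. (w (x + y) - v (x' + y)) * moll h y)"
    unfolding conv_shift[OF w] conv_shift[OF v] left_diff_distrib
    by (rule Bochner_Integration.integral_diff[symmetric]) (intro i1 w v)+
  also have "\<bar>\<dots>\<bar> \<le> integral\<^sup>L lborel (\<lambda>y::'a. e * moll h y)"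
    unfolding real_norm_def[symmetric]
  proof (rule Bochner_Integration.integral_norm_bound_integral)
    show "integrable lborel (\<lambda>y. (w (x + y) - v (x' + y)) * moll h y)"
      unfolding left_diff_distrib by (intro Bochner_Integration.integrable_diff i1 w v)
    show "integrable lborel (\<lambda>y::'a. e * moll h y)"
      using integral_moll(1)[OF h, where 'a='a] by simp
    show "norm ((w (x + y) - v (x' + y)) * moll h y) \<le> e * moll h y" for y
      using le[of y] moll_nonneg[OF h, of y] moll_support(1)[OF h, of y]
      by (cases "norm y < h") (auto simp: abs_mult intro: mult_right_mono)
  qed
  also have "\<dots> = e" using integral_moll(2)[OF h, where 'a='a] by simp
  finally show ?thesis .
qed

lemma conv_const: "h > 0 \<Longrightarrow> conv h (\<lambda>_. c) x = c"
  using integrable_moll_shift(2)[of h x] by (simp add: conv_def)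

lemma conv_approx:
  assumes "continuous_on UNIV w" "h > 0" "\<And>y. norm y < h \<Longrightarrow> \<bar>w (x + y) - c\<bar> \<le> e"
  shows "\<bar>conv h w x - c\<bar> \<le> e"
  using conv_diff_bound[of w "\<lambda>_. c" h x x e] assms by (simp add: conv_const)

lemma conv_tendsto:
  assumes w: "continuous_on UNIV w"
  shows "((\<lambda>h. conv h w x) \<longlongrightarrow> w x) (at_right 0)"
proof (rule tendstoI)
  fix e :: real assume "e > 0"
  have "isCont w x" using w continuous_on_eq_continuous_at by blast
  then obtain d where d: "d > 0" "\<And>y. dist y x < d \<Longrightarrow> dist (w y) (w x) < e / 2"
    using half_gt_zero[OF \<open>e > 0\<close>] unfolding continuous_at_eps_delta by blast
  have "dist (conv h w x) (w x) < e" if "0 < h" "h < d" for h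
  proof -
    have "\<bar>conv h w x - w x\<bar> \<le> e / 2"
    proof (rule conv_approx[OF w \<open>0 < h\<close>])
      fix y :: 'a assume "norm y < h"
      then show "\<bar>w (x + y) - w x\<bar> \<le> e / 2"
        using d(2)[of "x + y"] that by (simp add: dist_norm)
    qed
    then show ?thesis using \<open>e > 0\<close> by (simp add: dist_real_def)
  qed
  then show "\<forall>\<^sub>F h in at_right 0. dist (conv h w x) (w x) < e"
    unfolding eventually_at_right_field using d(1) by auto
qed

lemma C1_fun_conv:
  fixes w :: "'a::euclidean_space \<Rightarrow> real"
  assumes w: "continuous_on UNIV w" and h: "h > 0" and supp: "\<And>x. x \<notin> cbox a c \<Longrightarrow> w x = 0"
  shows "C1_fun (conv h w) (\<lambda>x. - integral\<^sup>L lborel (\<lambda>u. w u *\<^sub>R moll_grad h (u - x)))"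
proof -
  have eq: "conv h w = (\<lambda>x. integral (cbox a c) (\<lambda>u. w u * moll h (u - x)))"
    unfolding conv_def by (intro ext integrable_lborel_continuous_support(2))
      (auto intro!: continuous_intros w simp: supp)
  have eq2: "integral\<^sup>L lborel (\<lambda>u. w u *\<^sub>R moll_grad h (u - x)) 
      = integral (cbox a c) (\<lambda>u. w u *\<^sub>R moll_grad h (u - x))" for x
    by (intro integrable_lborel_continuous_support(2)) (auto intro!: continuous_intros w simp: supp)
  have w': "continuous_on S w" for S using w continuous_on_subset by blast
  have cw: "continuous_on S (\<lambda>p. w (g p))" if "continuous_on S g" for S and g :: "'b::topological_space \<Rightarrow> 'a"
    by (rule continuous_on_compose2[OF w that]) auto
  have der: "GDERIV (conv h w) x :> - integral\<^sup>L lborel (\<lambda>u. w u *\<^sub>R moll_grad h (u - x))" for x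
  proof -
    \<comment> \<open>The Leibniz rule for a vector parameter speaks of bounded linear maps;
      \<open>blinfun_inner_right\<close> turns the gradient into one, and the integral is pulled
      through it afterwards.\<close>
    have "((\<lambda>x. integral (cbox a c) (\<lambda>u. w u * moll h (u - x))) has_derivative
        blinfun_apply (integral (cbox a c) (\<lambda>u. blinfun_inner_right (- w u *\<^sub>R moll_grad h (u - x))))) (at x within UNIV)"
    proof (rule leibniz_rule)
      show "((\<lambda>x. w u * moll h (u - x)) has_derivative 
          blinfun_apply (blinfun_inner_right (- w u *\<^sub>R moll_grad h (u - x)))) (at x within UNIV)" for x u
      proof -
        have "((\<lambda>x. moll h (u - x)) has_derivative (\<lambda>y. (- y) \<bullet> moll_grad h (u - x))) (at x)"
          by (rule has_derivative_compose[where f="\<lambda>x. u - x"])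
            (use GDERIV_moll[OF h] in \<open>auto simp: gderiv_def intro!: derivative_eq_intros\<close>)
        then have "((\<lambda>x. w u * moll h (u - x)) has_derivative (\<lambda>y. w u * ((- y) \<bullet> moll_grad h (u - x)))) (at x)"
          by (rule has_derivative_mult_right)
        then show ?thesis by (rule has_derivative_eq_rhs) (auto simp: inner_commute)
      qed
      show "(\<lambda>u. w u * moll h (u - x)) integrable_on cbox a c" for x
        by (intro integrable_continuous continuous_intros w')
      show "continuous_on (UNIV \<times> cbox a c) (\<lambda>(x, u). blinfun_inner_right (- w u *\<^sub>R moll_grad h (u - x)))"
        unfolding case_prod_beta
        by (intro bounded_linear.continuous_on[OF bounded_linear_blinfun_inner_right] continuous_intros cw)
    qed auto
    moreover have "blinfun_apply (integral (cbox a c) (\<lambda>u. blinfun_inner_right (- w u *\<^sub>R moll_grad h (u - x))))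
      = (\<lambda>y. y \<bullet> - integral (cbox a c) (\<lambda>u. w u *\<^sub>R moll_grad h (u - x)))"
    proof -
      have "(\<lambda>u. w u *\<^sub>R moll_grad h (u - x)) integrable_on cbox a c"
        by (intro integrable_continuous continuous_intros w')
      then have "integral (cbox a c) (\<lambda>u. blinfun_inner_right (- (w u *\<^sub>R moll_grad h (u - x))))
        = blinfun_inner_right (- integral (cbox a c) (\<lambda>u. (w u *\<^sub>R moll_grad h (u - x))))"
        using integral_linear[OF integrable_neg bounded_linear_blinfun_inner_right]
        unfolding o_def by fastforce
      then show ?thesis by (auto simp: fun_eq_iff inner_commute)
    qed
    ultimately show ?thesis unfolding gderiv_def eq eq2 by simp
  qed
  have "continuous_on UNIV (\<lambda>x. integral (cbox a c) (\<lambda>u. w u *\<^sub>R moll_grad h (u - x)))"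
    by (rule integral_continuous_on_param) (auto simp: case_prod_beta intro!: continuous_intros cw)
  then show ?thesis
    unfolding C1_fun_def using der by (simp add: eq2 continuous_on_minus)
qed

lemma DERIV_conv_scale:
  fixes w :: "'a::euclidean_space \<Rightarrow> real"
  assumes w: "continuous_on UNIV w" and h: "h > 0" and supp: "\<And>x. x \<notin> cbox a c \<Longrightarrow> w x = 0"
  shows "((\<lambda>h. conv h w x) has_field_derivative
    integral\<^sup>L lborel (\<lambda>u. w u * (- (1 / h) * (DIM('a) * moll h (u - x) + (u - x) \<bullet> moll_grad h (u - x))))) (at h)"
proof -
  let ?d = "\<lambda>h u. w u * (- (1 / h) * (DIM('a) * moll h (u - x) + (u - x) \<bullet> moll_grad h (u - x)))"
  have eq: "(\<lambda>h. conv h w x) = (\<lambda>h. integral (cbox a c) (\<lambda>u. w u * moll h (u - x)))"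
    unfolding conv_def by (intro ext integrable_lborel_continuous_support(2))
      (auto intro!: continuous_intros w simp: supp)
  have eq2: "integral\<^sup>L lborel (?d h) = integral (cbox a c) (?d h)"
    using h by (intro integrable_lborel_continuous_support(2)) (auto intro!: continuous_intros w simp: supp)
  have w': "continuous_on S w" for S using w continuous_on_subset by blast
  have cw: "continuous_on S (\<lambda>p. w (g p))" if "continuous_on S g" for S and g :: "'b::topological_space \<Rightarrow> 'a"
    by (rule continuous_on_compose2[OF w that]) auto
  \<comment> \<open>The widths range over the open half line, where the kernel is differentiable in
    h; openness turns the derivative within this set into the full one.\<close>
  have "((\<lambda>h. integral (cbox a c) (\<lambda>u. w u * moll h (u - x))) has_field_derivative
      integral (cbox a c) (?d h)) (at h within {0<..})"
  proof (rule leibniz_rule_field_derivative)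
    show "((\<lambda>h. w u * moll h (u - x)) has_field_derivative ?d h u) (at h within {0<..})" if "h \<in> {0<..}" for h u
      by (rule DERIV_cmult[OF has_field_derivative_at_within[OF DERIV_moll_scale]]) (use that in auto)
    show "(\<lambda>u. w u * moll h (u - x)) integrable_on cbox a c" for h
      by (intro integrable_continuous continuous_intros w')
    show "continuous_on ({0<..} \<times> cbox a c) (\<lambda>(h, u). ?d h u)"
      using bump_mass_pos[where 'a='a]
      unfolding case_prod_beta moll_def moll_grad_def
      by (intro continuous_intros cw continuous_on_compose2[OF continuous_bump(1)]
         continuous_on_compose2[OF continuous_bump(2)]) auto
  qed (use h in auto)
  then show ?thesis unfolding eq eq2 using h by (simp add: at_within_open[of _ "{0<..}"])
qed

text \<open>Move from x in the direction D itself: the directional derivative there is D \<bullet>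
  D, while the difference quotients are at most m times norm D.\<close>

lemma GDERIV_bound:
  fixes f :: "'a::euclidean_space \<Rightarrow> real"
  assumes D: "GDERIV f x :> D" and e: "e > 0" and m: "m \<ge> 0"
    and le: "\<And>y. dist y x < e \<Longrightarrow> \<bar>f y - f x\<bar> \<le> m * dist y x"
  shows "norm D \<le> m"
proof (cases "D = 0")
  case False
  have "((\<lambda>s. f (x + s *\<^sub>R D)) has_field_derivative D \<bullet> D) (at 0)"
    by (rule GDERIV_imp_directional) (use D in simp)
  then have lim: "((\<lambda>s. (f (x + s *\<^sub>R D) - f x) / s) \<longlongrightarrow> D \<bullet> D) (at_right 0)"
    by (auto simp: DERIV_def intro: tendsto_within_subset)
  have "\<forall>\<^sub>F s in at_right 0. (f (x + s *\<^sub>R D) - f x) / s \<le> m * norm D"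
    unfolding eventually_at_right_field
  proof (intro exI[of _ "e / norm D"] conjI allI impI)
    show "0 < e / norm D" using e False by simp
    fix s assume s: "0 < s" "s < e / norm D"
    then have "dist (x + s *\<^sub>R D) x < e" using False by (simp add: dist_norm field_simps)
    from le[OF this] have "f (x + s *\<^sub>R D) - f x \<le> m * (s * norm D)" using s by (simp add: dist_norm)
    then show "(f (x + s *\<^sub>R D) - f x) / s \<le> m * norm D" using s by (simp add: field_simps)
  qed
  then have "D \<bullet> D \<le> m * norm D"
    by (intro tendsto_upperbound[OF lim]) auto
  then show ?thesis using False by (simp add: dot_square_norm power2_eq_square)
qed (use m in simp)

subsection \<open>Weak gradients of functions vanishing outside the domain\<close>

text \<open>The test functions need not vanish on the boundary of \<open>\<Omega>\<close>: \<open>w\<close> extended by zero has the gradient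
  \<open>G\<close> extended by zero on the whole space.\<close>

definition zero_ext_gradient :: "'a::euclidean_space set \<Rightarrow> ('a \<Rightarrow> real) \<Rightarrow> ('a \<Rightarrow> 'a) \<Rightarrow> bool" where
  "zero_ext_gradient \<Omega> w G \<longleftrightarrow>
     integrable (lebesgue_on \<Omega>) G \<and> continuous_on UNIV w \<and> (\<forall>x. x \<notin> \<Omega> \<longrightarrow> w x = 0) \<and>
     (\<forall>\<phi> D. \<forall>b\<in>Basis. C1_fun \<phi> D \<longrightarrow>
        integral\<^sup>L (lebesgue_on \<Omega>) (\<lambda>x. w x * (D x \<bullet> b))
        = - integral\<^sup>L (lebesgue_on \<Omega>) (\<lambda>x. \<phi> x * (G x \<bullet> b)))"

lemma continuous_on_UNIV_measurable_lebesgue_on: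
  fixes f :: "'a::euclidean_space \<Rightarrow> 'b::euclidean_space"
  assumes "continuous_on UNIV f" 
  shows "f \<in> borel_measurable (lebesgue_on S)"
proof -
  have "f \<in> borel_measurable lebesgue"
    using borel_measurable_continuous_onI[OF assms] by (simp add: measurable_completion)
  then show ?thesis by (simp add: measurable_restrict_space1)
qed

lemma integrable_bounded_mult:
  fixes g :: "'a \<Rightarrow> 'b::euclidean_space" and f :: "'a \<Rightarrow> real"
  assumes g: "integrable M g" and f: "f \<in> borel_measurable M" and B: "\<And>x. x \<in> space M \<Longrightarrow> \<bar>f x\<bar> \<le> B"
  shows "integrable M (\<lambda>x. f x *\<^sub>R g x)"
proof (rule Bochner_Integration.integrable_bound[of M "\<lambda>x. B *\<^sub>R norm (g x)"])
  show "integrable M (\<lambda>x. B *\<^sub>R norm (g x))" using g by auto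
  show "(\<lambda>x. f x *\<^sub>R g x) \<in> borel_measurable M" using f g by measurable
  show "AE x in M. norm (f x *\<^sub>R g x) \<le> norm (B *\<^sub>R norm (g x))"
  proof (intro AE_I2)
    fix x assume "x \<in> space M"
    then have "\<bar>f x\<bar> * norm (g x) \<le> B * norm (g x)" by (intro mult_right_mono B) auto
    then show "norm (f x *\<^sub>R g x) \<le> norm (B *\<^sub>R norm (g x))" by simp
  qed
qed

lemma moll_abs_le:
  assumes "h > 0"
  shows "\<bar>moll h (z::'a::euclidean_space)\<bar> \<le> 1 / (h ^ DIM('a) * bump_mass TYPE('a))"
  using moll_le[OF assms, of z] moll_nonneg[OF assms, of z] by simp

lemma measurable_moll [measurable]:
  "(\<lambda>u. moll h (u - x)) \<in> borel_measurable (lebesgue_on S)"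
  by (intro continuous_on_UNIV_measurable_lebesgue_on continuous_intros)

lemma integrable_moll_mult:
  assumes "integrable (lebesgue_on \<Omega>) g" "h > 0"
  shows "integrable (lebesgue_on \<Omega>) (\<lambda>u. moll h (u - x) * (g u :: real))"
  using integrable_bounded_mult[OF assms(1) measurable_moll moll_abs_le[OF assms(2)]] by simp

lemma zero_ext_gradientD:
  assumes "zero_ext_gradient \<Omega> w G" "\<Omega> \<in> sets lebesgue"
  shows "integrable (lebesgue_on \<Omega>) G" "continuous_on UNIV w" "\<And>x. x \<notin> \<Omega> \<Longrightarrow> w x = 0"
    and "\<And>\<phi> D b. C1_fun \<phi> D \<Longrightarrow> b \<in> Basis \<Longrightarrow>
      integral\<^sup>L lborel (\<lambda>x. w x * (D x \<bullet> b)) = - integral\<^sup>L (lebesgue_on \<Omega>) (\<lambda>x. \<phi> x * (G x \<bullet> b))"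
proof -
  show *: "integrable (lebesgue_on \<Omega>) G" "continuous_on UNIV w" "\<And>x. x \<notin> \<Omega> \<Longrightarrow> w x = 0"
    using assms(1) by (auto simp: zero_ext_gradient_def)
  fix \<phi> :: "'a \<Rightarrow> real" and D and b :: 'a assume C: "C1_fun \<phi> D" "b \<in> Basis"
  then have "integral\<^sup>L (lebesgue_on \<Omega>) (\<lambda>x. w x * (D x \<bullet> b))
        = - integral\<^sup>L (lebesgue_on \<Omega>) (\<lambda>x. \<phi> x * (G x \<bullet> b))"
    using assms(1) by (simp add: zero_ext_gradient_def)
  moreover have "integral\<^sup>L (lebesgue_on \<Omega>) (\<lambda>x. w x * (D x \<bullet> b)) = integral\<^sup>L lborel (\<lambda>x. w x * (D x \<bullet> b))"
    using C *(2,3) by (intro lebesgue_on_integral_support assms(2) borel_measurable_continuous_onI)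
      (auto simp: C1_fun_def intro!: continuous_intros)
  ultimately show "integral\<^sup>L lborel (\<lambda>x. w x * (D x \<bullet> b)) = - integral\<^sup>L (lebesgue_on \<Omega>) (\<lambda>x. \<phi> x * (G x \<bullet> b))"
    by simp
qed

lemma cbox_superset:
  fixes \<Omega> :: "'a::euclidean_space set"
  assumes "bounded \<Omega>"
  obtains a c where "\<Omega> \<subseteq> cbox a c"
  using bounded_subset_cbox_symmetric[OF assms] by metis

text \<open>The test function is the kernel centred at x, whose support may cross the boundary of
  \<Omega>. This is why \<open>zero_ext_gradient\<close> admits all of
  \<open>C1_fun\<close>.\<close>

lemma conv_gradient_bound:
  fixes w :: "'a::euclidean_space \<Rightarrow> real"
  assumes z: "zero_ext_gradient \<Omega> w G" and \<Omega>: "\<Omega> \<in> sets lebesgue" "bounded \<Omega>" and h: "h > 0"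
  shows "\<exists>E. GDERIV (conv h w) x :> E \<and> norm E \<le> integral\<^sup>L (lebesgue_on \<Omega>) (\<lambda>u. moll h (u - x) * norm (G u))"
proof -
  note w = zero_ext_gradientD[OF z \<Omega>(1)]
  obtain a c where ac: "\<Omega> \<subseteq> cbox a c" using cbox_superset[OF \<Omega>(2)] .
  let ?E = "- integral\<^sup>L lborel (\<lambda>u. w u *\<^sub>R moll_grad h (u - x))"
  let ?E' = "integral\<^sup>L (lebesgue_on \<Omega>) (\<lambda>u. moll h (u - x) *\<^sub>R G u)"
  have supp: "w u = 0" if "u \<notin> cbox a c" for u using w(3)[of u] that ac by auto
  have intw: "integrable lborel (\<lambda>u. w u *\<^sub>R moll_grad h (u - x))"
    by (rule integrable_lborel_continuous_support(1)[of _ a c])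
      (auto simp: supp intro!: continuous_intros w(2))
  have intG: "integrable (lebesgue_on \<Omega>) (\<lambda>u. moll h (u - x) *\<^sub>R G u)"
    by (rule integrable_bounded_mult[OF w(1) measurable_moll moll_abs_le[OF h]])
  have "?E \<bullet> b = ?E' \<bullet> b" if b: "b \<in> Basis" for b
  proof -
    have "?E \<bullet> b = - integral\<^sup>L lborel (\<lambda>u. w u * (moll_grad h (u - x) \<bullet> b))"
      using integral_inner_left[OF intw, of b] by simp
    also have "\<dots> = integral\<^sup>L (lebesgue_on \<Omega>) (\<lambda>u. moll h (u - x) * (G u \<bullet> b))"
      using w(4)[OF C1_fun_moll_shift[OF h] b] by simp
    also have "\<dots> = ?E' \<bullet> b"
      using integral_inner_left[OF intG, of b] by simp
    finally show ?thesis .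
  qed
  then have E: "?E = ?E'" by (rule euclidean_eqI)
  have "norm ?E' \<le> integral\<^sup>L (lebesgue_on \<Omega>) (\<lambda>u. norm (moll h (u - x) *\<^sub>R G u))"
    by (rule integral_norm_bound)
  also have "\<dots> = integral\<^sup>L (lebesgue_on \<Omega>) (\<lambda>u. moll h (u - x) * norm (G u))"
    using moll_nonneg[OF h, where 'a='a] by simp
  finally have "norm ?E \<le> integral\<^sup>L (lebesgue_on \<Omega>) (\<lambda>u. moll h (u - x) * norm (G u))"
    unfolding E .
  moreover have "GDERIV (conv h w) x :> ?E"
    using C1_fun_conv[OF w(2) h supp] by (simp add: C1_fun_def)
  ultimately show ?thesis by blast
qed

text \<open>The derivative of \<open>\<rho>\<^sub>h(z)\<close> in \<open>h\<close> is the divergence of \<open>- (1/h) \<rho>\<^sub>h(z) z\<close>.\<close>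

lemma conv_scale_derivative_bound:
  fixes w :: "'a::euclidean_space \<Rightarrow> real"
  assumes z: "zero_ext_gradient \<Omega> w G" and \<Omega>: "\<Omega> \<in> sets lebesgue" "bounded \<Omega>" and h: "h > 0"
  shows "\<exists>E. ((\<lambda>h. conv h w x) has_field_derivative E) (at h) \<and>
     \<bar>E\<bar> \<le> integral\<^sup>L (lebesgue_on \<Omega>) (\<lambda>u. moll h (u - x) * norm (G u))"
proof -
  note w = zero_ext_gradientD[OF z \<Omega>(1)]
  obtain a c where ac: "\<Omega> \<subseteq> cbox a c" using cbox_superset[OF \<Omega>(2)] .
  have supp: "w u = 0" if "u \<notin> cbox a c" for u using w(3)[of u] that ac by auto
  let ?\<phi> = "\<lambda>b u. ((u - x) \<bullet> b) * moll h (u - x)"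
  let ?D = "\<lambda>b u. ((u - x) \<bullet> b) *\<^sub>R moll_grad h (u - x) + moll h (u - x) *\<^sub>R b"
  let ?E = "integral\<^sup>L lborel (\<lambda>u. w u * (- (1 / h) * (DIM('a) * moll h (u - x) + (u - x) \<bullet> moll_grad h (u - x))))"
  have C: "C1_fun (?\<phi> b) (?D b)" for b
  proof -
    have "GDERIV (\<lambda>u. (u - x) \<bullet> b) u :> b" for u
      unfolding gderiv_def by (auto intro!: derivative_eq_intros)
    moreover have "GDERIV (\<lambda>u. moll h (u - x)) u :> moll_grad h (u - x)" for u
      using C1_fun_moll_shift[OF h, of x] by (simp add: C1_fun_def)
    ultimately have "GDERIV (?\<phi> b) u :> ?D b u" for u by (rule GDERIV_mult)
    moreover have "continuous_on UNIV (?D b)" by (intro continuous_intros)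
    ultimately show ?thesis by (simp add: C1_fun_def)
  qed
  have Db: "(\<Sum>b\<in>Basis. ?D b u \<bullet> b) = DIM('a) * moll h (u - x) + (u - x) \<bullet> moll_grad h (u - x)" for u
  proof -
    have "(\<Sum>b\<in>Basis. ?D b u \<bullet> b) = (\<Sum>b\<in>Basis. ((u - x) \<bullet> b) * (moll_grad h (u - x) \<bullet> b)) 
        + (\<Sum>b\<in>(Basis::'a set). moll h (u - x))"
      unfolding sum.distrib[symmetric] by (intro sum.cong) (auto simp: inner_add_left)
    then show ?thesis unfolding euclidean_inner[of "u - x" "moll_grad h (u - x)"] by simp
  qed
  have intw: "integrable lborel (\<lambda>u. w u * (?D b u \<bullet> b))" for b
  proof (rule integrable_lborel_continuous_support(1))
    show "continuous_on UNIV (\<lambda>u. w u * (?D b u \<bullet> b))" by (intro continuous_intros w(2))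
    show "w u * (?D b u \<bullet> b) = 0" if "u \<notin> cbox a c" for u using supp[OF that] by simp
  qed
  have \<phi>le: "\<bar>?\<phi> b u\<bar> \<le> norm b * h * (1 / (h ^ DIM('a) * bump_mass TYPE('a)))" for b u
  proof (cases "norm (u - x) < h")
    case True
    have "\<bar>(u - x) \<bullet> b\<bar> \<le> norm b * h"
      using Cauchy_Schwarz_ineq2[of "u - x" b] True
      by (smt (verit) mult.commute mult_left_mono norm_ge_zero)
    then show ?thesis unfolding abs_mult using moll_abs_le[OF h, of "u - x"] h
      by (intro mult_mono) auto
  next
    case False
    then show ?thesis using moll_support(1)[OF h, of "u - x"] h bump_mass_pos[where 'a='a] by simp
  qed
  have intG: "integrable (lebesgue_on \<Omega>) (\<lambda>u. ?\<phi> b u * (G u \<bullet> b))" for b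
  proof -
    have m: "?\<phi> b \<in> borel_measurable (lebesgue_on \<Omega>)"
      by (intro continuous_on_UNIV_measurable_lebesgue_on continuous_intros)
    from integrable_inner_left[OF integrable_bounded_mult[OF w(1) m \<phi>le], of b] show ?thesis by simp
  qed
  have intG2: "integrable (lebesgue_on \<Omega>) (\<lambda>u. moll h (u - x) * norm (G u))"
    using w(1) h by (intro integrable_moll_mult) auto
  have "?E = - (1 / h) * integral\<^sup>L lborel (\<lambda>u. \<Sum>b\<in>Basis. w u * (?D b u \<bullet> b))"
    unfolding sum_distrib_left[symmetric] Db integral_mult_right_zero[symmetric]
    by (simp add: algebra_simps)
  also have "\<dots> = - (1 / h) * (\<Sum>b\<in>Basis. integral\<^sup>L lborel (\<lambda>u. w u * (?D b u \<bullet> b)))"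
    by (subst Bochner_Integration.integral_sum) (use intw in auto)
  also have "\<dots> = (1 / h) * (\<Sum>b\<in>Basis. integral\<^sup>L (lebesgue_on \<Omega>) (\<lambda>u. ?\<phi> b u * (G u \<bullet> b)))"
    using w(4)[OF C] by (simp add: sum_negf)
  also have "\<dots> = (1 / h) * integral\<^sup>L (lebesgue_on \<Omega>) (\<lambda>u. \<Sum>b\<in>Basis. ?\<phi> b u * (G u \<bullet> b))"
    by (subst Bochner_Integration.integral_sum) (use intG in auto)
  also have "(\<lambda>u. \<Sum>b\<in>Basis. ?\<phi> b u * (G u \<bullet> b)) = (\<lambda>u. moll h (u - x) * ((u - x) \<bullet> G u))"
    by (auto simp: euclidean_inner[of _ "G _"] sum_distrib_left mult_ac intro!: ext)
  finally have Eeq: "?E = (1 / h) * integral\<^sup>L (lebesgue_on \<Omega>) (\<lambda>u. moll h (u - x) * ((u - x) \<bullet> G u))" .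
  \<comment> \<open>On the support of the kernel norm (u - x) < h, which absorbs the factor 1/h: the
    scale derivative obeys the same bound as the gradient.\<close>
  have "norm (integral\<^sup>L (lebesgue_on \<Omega>) (\<lambda>u. moll h (u - x) * ((u - x) \<bullet> G u)))
     \<le> integral\<^sup>L (lebesgue_on \<Omega>) (\<lambda>u. h * (moll h (u - x) * norm (G u)))"
  proof (rule Bochner_Integration.integral_norm_bound_integral)
    have "integrable (lebesgue_on \<Omega>) (\<lambda>u. \<Sum>b\<in>Basis. ?\<phi> b u * (G u \<bullet> b))"
      using intG by auto
    then show "integrable (lebesgue_on \<Omega>) (\<lambda>u. moll h (u - x) * ((u - x) \<bullet> G u))"
      by (simp add: euclidean_inner[of _ "G _"] sum_distrib_left mult_ac)
    show "integrable (lebesgue_on \<Omega>) (\<lambda>u. h * (moll h (u - x) * norm (G u)))" using intG2 by simp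
    show "norm (moll h (u - x) * ((u - x) \<bullet> G u)) \<le> h * (moll h (u - x) * norm (G u))" for u
    proof (cases "norm (u - x) < h")
      case True
      have "\<bar>(u - x) \<bullet> G u\<bar> \<le> h * norm (G u)"
        using Cauchy_Schwarz_ineq2[of "u - x" "G u"] True
        by (smt (verit) mult_right_mono norm_ge_zero)
      then have "moll h (u - x) * \<bar>(u - x) \<bullet> G u\<bar> \<le> moll h (u - x) * (h * norm (G u))"
        by (rule mult_left_mono) (rule moll_nonneg[OF h])
      then show ?thesis using moll_nonneg[OF h, of "u - x"] by (simp add: abs_mult mult_ac)
    qed (use moll_support(1)[OF h, of "u - x"] in simp)
  qed
  then have "\<bar>?E\<bar> \<le> integral\<^sup>L (lebesgue_on \<Omega>) (\<lambda>u. moll h (u - x) * norm (G u))"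
    unfolding Eeq using h by (simp add: abs_mult field_simps)
  with DERIV_conv_scale[OF w(2) h supp] show ?thesis by blast
qed

text \<open>As the width s runs from h down to 0 the average at x moves to w x with speed at most C
  / sqrt s. This is integrable at 0, with integral 2 C sqrt h.\<close>

lemma conv_close:
  fixes w :: "'a::euclidean_space \<Rightarrow> real"
  assumes z: "zero_ext_gradient \<Omega> w G" and \<Omega>: "\<Omega> \<in> sets lebesgue" "bounded \<Omega>"
    and C: "\<And>h x. 0 < h \<Longrightarrow> h \<le> 1 \<Longrightarrow>
      integral\<^sup>L (lebesgue_on \<Omega>) (\<lambda>u. moll h (u - x) * norm (G u)) \<le> C / sqrt h"
    and h: "0 < h" "h \<le> 1"
  shows "\<bar>w x - conv h w x\<bar> \<le> 2 * C * sqrt h"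
proof -
  note w = zero_ext_gradientD[OF z \<Omega>(1)]
  have main: "\<bar>conv h w x - conv \<delta> w x\<bar> \<le> 2 * C * sqrt h - 2 * C * sqrt \<delta>" if \<delta>: "0 < \<delta>" "\<delta> < h" for \<delta>
  proof -
    have ds: "((\<lambda>s. 2 * C * sqrt s) has_real_derivative C / sqrt s) (at s)" if "s > 0" for s
      using that by (auto intro!: derivative_eq_intros simp: field_simps)
    \<comment> \<open>Monotonicity in s takes the place of integrating the derivative; the sign
      \<sigma> yields the two halves of the absolute value.\<close>
    have *: "\<exists>y. ((\<lambda>s. 2 * C * sqrt s - \<sigma> * conv s w x) has_real_derivative y) (at s) \<and> 0 \<le> y"
      if "\<delta> \<le> s" "s \<le> h" "\<sigma> = 1 \<or> \<sigma> = -1" for s \<sigma>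
    proof -
      have s: "0 < s" "s \<le> 1" using that \<delta> h by auto
      obtain E where E: "((\<lambda>h. conv h w x) has_field_derivative E) (at s)"
        "\<bar>E\<bar> \<le> integral\<^sup>L (lebesgue_on \<Omega>) (\<lambda>u. moll s (u - x) * norm (G u))"
        using conv_scale_derivative_bound[OF z \<Omega> s(1)] by blast
      have "\<sigma> * E \<le> C / sqrt s" using E(2) C[OF s, of x] that(3) by auto
      moreover have "((\<lambda>s. 2 * C * sqrt s - \<sigma> * conv s w x) has_real_derivative C / sqrt s - \<sigma> * E) (at s)"
        by (intro DERIV_diff ds s DERIV_cmult E)
      ultimately show ?thesis by (intro exI[of _ "C / sqrt s - \<sigma> * E"]) simp
    qed
    have "2 * C * sqrt \<delta> - \<sigma> * conv \<delta> w x \<le> 2 * C * sqrt h - \<sigma> * conv h w x" if "\<sigma> = 1 \<or> \<sigma> = -1" for \<sigma>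
      by (rule DERIV_nonneg_imp_nondecreasing) (use \<delta> *[OF _ _ that] in auto)
    from this[of 1] this[of "-1"] show ?thesis by auto
  qed
  have 1: "((\<lambda>\<delta>. \<bar>conv h w x - conv \<delta> w x\<bar>) \<longlongrightarrow> \<bar>conv h w x - w x\<bar>) (at_right 0)"
    by (intro tendsto_intros conv_tendsto w)
  have "((\<lambda>\<delta>. 2 * C * sqrt h - 2 * C * sqrt \<delta>) \<longlongrightarrow> 2 * C * sqrt h - 2 * C * sqrt 0) (at_right 0)"
    by (intro tendsto_intros)
  moreover have "\<forall>\<^sub>F \<delta> in at_right 0. \<bar>conv h w x - conv \<delta> w x\<bar> \<le> 2 * C * sqrt h - 2 * C * sqrt \<delta>"
    unfolding eventually_at_right_field using main h by auto
  ultimately have "\<bar>conv h w x - w x\<bar> \<le> 2 * C * sqrt h - 2 * C * sqrt 0"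
    by (intro tendsto_le[OF _ _ 1]) auto
  then show ?thesis by simp
qed

text \<open>The hypothesis concerns averages centred on the segment only. This locality lets
  \<open>Z_local_lipschitz\<close> use the size of the weight near the segment instead of its global
  bound.\<close>

lemma conv_lipschitz:
  fixes w :: "'a::euclidean_space \<Rightarrow> real"
  assumes z: "zero_ext_gradient \<Omega> w G" and \<Omega>: "\<Omega> \<in> sets lebesgue" "bounded \<Omega>" and h: "h > 0"
    and m: "\<And>z. z \<in> closed_segment x y \<Longrightarrow>
       integral\<^sup>L (lebesgue_on \<Omega>) (\<lambda>u. moll h (u - z) * norm (G u)) \<le> m"
  shows "\<bar>conv h w x - conv h w y\<bar> \<le> m * norm (x - y)"
proof -
  have "\<exists>E. \<forall>z. GDERIV (conv h w) z :> E z \<and> norm (E z) \<le> integral\<^sup>L (lebesgue_on \<Omega>) (\<lambda>u. moll h (u - z) * norm (G u))"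
    by (rule choice) (use conv_gradient_bound[OF z \<Omega> h] in blast)
  then obtain E where E: "\<And>z. GDERIV (conv h w) z :> E z"
    "\<And>z. norm (E z) \<le> integral\<^sup>L (lebesgue_on \<Omega>) (\<lambda>u. moll h (u - z) * norm (G u))" by blast
  have "norm (conv h w x - conv h w y) \<le> m * norm (x - y)"
  proof (rule differentiable_bound[of "closed_segment x y" "conv h w" "\<lambda>z v. v \<bullet> E z"])
    show "(conv h w has_derivative (\<lambda>v. v \<bullet> E z)) (at z within closed_segment x y)" for z
      using E(1) has_derivative_at_withinI unfolding gderiv_def by blast
    show "onorm (\<lambda>v. v \<bullet> E z) \<le> m" if "z \<in> closed_segment x y" for z
    proof (rule onorm_le)
      fix v
      show "norm (v \<bullet> E z) \<le> m * norm v"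
        using Cauchy_Schwarz_ineq2[of v "E z"] order_trans[OF E(2) m[OF that]]
        by (smt (verit) mult.commute mult_left_mono norm_ge_zero real_norm_def)
    qed
  qed auto
  then show ?thesis by simp
qed

text \<open>The width is chosen as h = norm (x - y). Replacing w by its average costs 2 C sqrt h at
  each end, and the averages differ by at most (C / sqrt h) h, which adds up to 5 C sqrt h.\<close>

lemma hoelder_bound:
  fixes w :: "'a::euclidean_space \<Rightarrow> real"
  assumes z: "zero_ext_gradient \<Omega> w G" and \<Omega>: "\<Omega> \<in> sets lebesgue" "bounded \<Omega>"
    and C: "\<And>h x. 0 < h \<Longrightarrow> h \<le> 1 \<Longrightarrow>
      integral\<^sup>L (lebesgue_on \<Omega>) (\<lambda>u. moll h (u - x) * norm (G u)) \<le> C / sqrt h"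
    and "norm (x - y) \<le> 1"
  shows "\<bar>w x - w y\<bar> \<le> 5 * C * sqrt (norm (x - y))"
proof (cases "x = y")
  case False
  define h where "h = norm (x - y)"
  have h: "0 < h" "h \<le> 1" using False assms(5) by (auto simp: h_def)
  have "\<bar>conv h w x - conv h w y\<bar> \<le> C / sqrt h * norm (x - y)"
    by (rule conv_lipschitz[OF z \<Omega> h(1)]) (rule C[OF h])
  also have "\<dots> = C * sqrt h"
    using h unfolding h_def[symmetric] by (simp add: field_simps flip: real_sqrt_mult)
  finally show ?thesis
    using conv_close[OF z \<Omega> C h, of x] conv_close[OF z \<Omega> C h, of y] unfolding h_def[symmetric]
    by linarith
qed simp

subsection \<open>Approximation by test functions\<close>

definition zext :: "'a set \<Rightarrow> ('a \<Rightarrow> real) \<Rightarrow> 'a \<Rightarrow> real" where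
  "zext \<Omega> w x = (if x \<in> \<Omega> then w x else 0)"

lemma zext_closure:
  fixes \<Omega> :: "'a::euclidean_space set"
  assumes "open \<Omega>" "\<And>x. x \<in> frontier \<Omega> \<Longrightarrow> w x = 0" "x \<in> closure \<Omega>"
  shows "zext \<Omega> w x = w x"
  using assms by (auto simp: zext_def frontier_def interior_open)

lemma continuous_on_zext:
  fixes \<Omega> :: "'a::euclidean_space set"
  assumes "open \<Omega>" "continuous_on (closure \<Omega>) w" "\<And>x. x \<in> frontier \<Omega> \<Longrightarrow> w x = 0"
  shows "continuous_on UNIV (zext \<Omega> w)"
proof -
  have "continuous_on (closure \<Omega>) (zext \<Omega> w)"
    by (rule continuous_on_eq[OF assms(2)]) (rule zext_closure[OF assms(1,3), symmetric])
  moreover have "continuous_on (- \<Omega>) (zext \<Omega> w)"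
    by (rule continuous_on_eq[of _ "\<lambda>_. 0"]) (auto simp: zext_def)
  ultimately have "continuous_on (closure \<Omega> \<union> - \<Omega>) (zext \<Omega> w)"
    using assms(1) by (intro continuous_on_closed_Un) (auto simp: closed_Compl)
  moreover have "closure \<Omega> \<union> - \<Omega> = UNIV" using closure_subset by auto
  ultimately show ?thesis by simp
qed

lemma uniformly_continuous_bounded_support:
  fixes w :: "'a::euclidean_space \<Rightarrow> real"
  assumes w: "continuous_on UNIV w" and b: "bounded \<Omega>" and z: "\<And>x. x \<notin> \<Omega> \<Longrightarrow> w x = 0"
  shows "uniformly_continuous_on UNIV w"
proof -
  obtain R where R: "\<And>x. x \<in> \<Omega> \<Longrightarrow> norm x \<le> R" using b by (auto simp: bounded_iff)
  \<comment> \<open>The margin 1 ensures that two points at distance less than 1 either both lie in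
    this ball or both lie outside \<Omega>.\<close>
  have uc: "uniformly_continuous_on (cball 0 (R + 1)) w"
    by (intro compact_uniformly_continuous continuous_on_subset[OF w]) auto
  show ?thesis
    unfolding uniformly_continuous_on_def
  proof (intro allI impI)
    fix e :: real assume "e > 0"
    then obtain d where d: "d > 0" "\<And>x y. x \<in> cball 0 (R + 1) \<Longrightarrow> y \<in> cball 0 (R + 1) \<Longrightarrow> dist y x < d \<Longrightarrow> dist (w y) (w x) < e"
      using uc unfolding uniformly_continuous_on_def by metis
    have "dist (w y) (w x) < e" if "dist y x < min d 1" for x y
    proof (cases "x \<in> cball 0 (R + 1) \<and> y \<in> cball 0 (R + 1)")
      case True then show ?thesis using d(2) that by auto
    next
      case False
      then have "norm x > R" "norm y > R"
        using that norm_triangle_ineq2[of x y] norm_triangle_ineq2[of y x]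
        by (auto simp: dist_norm norm_minus_commute)
      then have "x \<notin> \<Omega>" "y \<notin> \<Omega>" using R by fastforce+
      then show ?thesis using z \<open>e > 0\<close> by simp
    qed
    then show "\<exists>d>0. \<forall>x\<in>UNIV. \<forall>x'\<in>UNIV. dist x' x < d \<longrightarrow> dist (w x') (w x) < e"
      using d(1) by (intro exI[of _ "min d 1"]) auto
  qed
qed

text \<open>The support is cut off by thresholding the values of w rather than by a cutoff factor.
  Since w is small near the boundary, v has compact support in \<Omega>; and since thresholding
  never increases differences, a Lipschitz bound for w is inherited by v with the same
  constant.\<close>

lemma test_function_approx:
  fixes w :: "'a::euclidean_space \<Rightarrow> real"
  assumes \<Omega>: "open \<Omega>" "bounded \<Omega>"
    and w: "continuous_on UNIV w" "\<And>x. x \<notin> \<Omega> \<Longrightarrow> w x = 0" and e: "e > 0"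
  obtains v h0 where "h0 > 0" "continuous_on UNIV v" "\<And>x y. \<bar>v x - v y\<bar> \<le> \<bar>w x - w y\<bar>"
    "\<And>h. 0 < h \<Longrightarrow> h < h0 \<Longrightarrow> \<exists>D. C1_test \<Omega> (conv h v) D"
    "\<And>h x. 0 < h \<Longrightarrow> h < h0 \<Longrightarrow> \<bar>conv h v x - w x\<bar> \<le> e"
proof -
  define v where "v x = w x - max (- (e/2)) (min (w x) (e/2))" for x
  define K where "K = {x. \<bar>w x\<bar> \<ge> e/2}"
  have cv: "continuous_on UNIV v" unfolding v_def[abs_def] by (intro continuous_intros w)
  have vw: "\<bar>v x - w x\<bar> \<le> e/2" for x using e unfolding v_def by auto
  have vle: "\<bar>v x - v y\<bar> \<le> \<bar>w x - w y\<bar>" for x y unfolding v_def by auto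
  have v0: "v x = 0" if "x \<notin> K" for x using that unfolding v_def K_def by auto
  have "K \<subseteq> \<Omega>" using w(2) e unfolding K_def by force
  moreover have "closed K" unfolding K_def by (intro closed_Collect_le continuous_intros w)
  ultimately have K: "compact K" "K \<subseteq> \<Omega>"
    using \<Omega>(2) bounded_subset by (auto simp: compact_eq_bounded_closed)
  obtain r where r: "r > 0" "(\<Union>x\<in>K. ball x r) \<subseteq> \<Omega>"
    using compact_subset_open_imp_ball_epsilon_subset[OF K(1) \<Omega>(1) K(2)] .
  have "uniformly_continuous_on UNIV v"
    by (rule uniformly_continuous_bounded_support[OF cv \<Omega>(2)]) (use v0 K in auto)
  then obtain d where d: "d > 0" "\<And>x y. dist y x < d \<Longrightarrow> dist (v y) (v x) < e/2"
    using e unfolding uniformly_continuous_on_def by (metis UNIV_I half_gt_zero)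
  obtain a c where ac: "\<Omega> \<subseteq> cbox a c" using cbox_superset[OF \<Omega>(2)] .
  show thesis
  \<comment> \<open>A width below r keeps the support inside \<Omega>; a width below d makes
    mollification cost at most e/2, the other half being spent on the threshold.\<close>
  proof (rule that[of "min r d"])
    show "min r d > 0" using r d by simp
    fix h :: real assume h: "0 < h" "h < min r d"
    have close: "\<bar>conv h v x - v x\<bar> \<le> e/2" for x
    proof (rule conv_approx[OF cv h(1)])
      fix y :: 'a assume "norm y < h"
      then show "\<bar>v (x + y) - v x\<bar> \<le> e/2" using d(2)[of "x + y" x] h by (simp add: dist_norm)
    qed
    show "\<bar>conv h v x - w x\<bar> \<le> e" for x using close[of x] vw[of x] by linarith
    let ?K' = "{x + y |x y. x \<in> K \<and> y \<in> cball 0 h}"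
    have "compact ?K'" by (intro compact_sums K compact_cball)
    moreover have "?K' \<subseteq> \<Omega>"
    proof safe
      fix x y :: 'a assume "x \<in> K" "y \<in> cball 0 h"
      then have "x + y \<in> ball x r" using h by (simp add: dist_norm)
      then show "x + y \<in> \<Omega>" using r(2) \<open>x \<in> K\<close> by blast
    qed
    moreover have "conv h v x = 0" if "x \<notin> ?K'" for x
    proof -
      have "\<bar>conv h v x - 0\<bar> \<le> 0"
      proof (rule conv_approx[OF cv h(1)])
        fix y :: 'a assume y: "norm y < h"
        have "x + y \<notin> K"
        proof
          assume "x + y \<in> K"
          then have "(x + y) + (- y) \<in> ?K'"
            using y by (intro CollectI exI[of _ "x + y"] exI[of _ "- y"] conjI refl) auto
          then show False using that by simp
        qed
        then show "\<bar>v (x + y) - 0\<bar> \<le> 0" using v0 by simp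
      qed
      then show ?thesis by simp
    qed
    moreover obtain D where "C1_fun (conv h v) D"
      using C1_fun_conv[OF cv h(1), of a c] v0 K ac by blast
    ultimately show "\<exists>D. C1_test \<Omega> (conv h v) D"
      unfolding C1_test_def C1_fun_def by blast
  qed (use cv vle in auto)
qed

subsection \<open>Lebesgue spaces on bounded sets\<close>

lemma LspaceI_bounded:
  fixes f :: "'a::euclidean_space \<Rightarrow> 'b::euclidean_space"
  assumes "f \<in> borel_measurable (lebesgue_on \<Omega>)" "\<And>x. x \<in> \<Omega> \<Longrightarrow> norm (f x) \<le> B" "\<Omega> \<in> lmeasurable"
  shows "f \<in> Lspace \<Omega> s"
proof -
  interpret finite_measure "lebesgue_on \<Omega>" by (rule finite_measure_lebesgue_on[OF assms(3)])
  have "integrable (lebesgue_on \<Omega>) (\<lambda>x. norm (f x) powr enn2real s)"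
  proof (rule integrable_const_bound[of _ "B powr enn2real s"])
    show "AE x in lebesgue_on \<Omega>. norm (norm (f x) powr enn2real s) \<le> B powr enn2real s"
      using assms by (intro AE_I2) (auto intro!: powr_mono2 simp: enn2real_nonneg)
    show "(\<lambda>x. norm (f x) powr enn2real s) \<in> borel_measurable (lebesgue_on \<Omega>)"
      using assms(1) by measurable
  qed
  moreover have "AE x in lebesgue_on \<Omega>. norm (f x) \<le> B"
    using assms by (intro AE_I2) auto
  ultimately show ?thesis using assms(1) by (auto simp: Lspace_def)
qed

lemma Lspace2_iff:
  fixes f :: "'a::euclidean_space \<Rightarrow> 'b::euclidean_space"
  shows "f \<in> Lspace \<Omega> 2 \<longleftrightarrow> f \<in> borel_measurable (lebesgue_on \<Omega>) \<and> integrable (lebesgue_on \<Omega>) (\<lambda>x. (norm (f x))\<^sup>2)"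
  by (simp add: Lspace_def)

lemma Lspace2_integrable_mult:
  fixes f g :: "'a::euclidean_space \<Rightarrow> real"
  assumes "f \<in> Lspace \<Omega> 2" "g \<in> Lspace \<Omega> 2"
  shows "integrable (lebesgue_on \<Omega>) (\<lambda>x. f x * g x)"
proof (rule Bochner_Integration.integrable_bound[of _ "\<lambda>x. (f x)\<^sup>2 + (g x)\<^sup>2"])
  show "integrable (lebesgue_on \<Omega>) (\<lambda>x. (f x)\<^sup>2 + (g x)\<^sup>2)"
    using assms by (auto simp: Lspace2_iff)
  show "(\<lambda>x. f x * g x) \<in> borel_measurable (lebesgue_on \<Omega>)"
    using assms by (auto simp: Lspace2_iff)
  show "AE x in lebesgue_on \<Omega>. norm (f x * g x) \<le> norm ((f x)\<^sup>2 + (g x)\<^sup>2)"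
  proof (intro AE_I2)
    fix x
    have "2 * (\<bar>f x\<bar> * \<bar>g x\<bar>) \<le> (f x)\<^sup>2 + (g x)\<^sup>2"
      using sum_squares_bound[of "\<bar>f x\<bar>" "\<bar>g x\<bar>"] by (simp add: mult_ac)
    then show "norm (f x * g x) \<le> norm ((f x)\<^sup>2 + (g x)\<^sup>2)"
      by (simp add: abs_mult) (smt (verit) mult_nonneg_nonneg abs_ge_zero)
  qed
qed

lemma Lspace2_linear:
  fixes f g :: "'a::euclidean_space \<Rightarrow> real"
  assumes "f \<in> Lspace \<Omega> 2" "g \<in> Lspace \<Omega> 2"
  shows "(\<lambda>x. \<alpha> * f x + \<beta> * g x) \<in> Lspace \<Omega> 2"
proof -
  have "integrable (lebesgue_on \<Omega>) (\<lambda>x. \<alpha>\<^sup>2 * (f x)\<^sup>2 + 2 * \<alpha> * \<beta> * (f x * g x) + \<beta>\<^sup>2 * (g x)\<^sup>2)"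
    by (intro Bochner_Integration.integrable_add integrable_mult_right Lspace2_integrable_mult[OF assms])
      (use assms in \<open>auto simp: Lspace2_iff\<close>)
  moreover have "(\<lambda>x. \<alpha>\<^sup>2 * (f x)\<^sup>2 + 2 * \<alpha> * \<beta> * (f x * g x) + \<beta>\<^sup>2 * (g x)\<^sup>2) = (\<lambda>x. (\<alpha> * f x + \<beta> * g x)\<^sup>2)"
    by (rule ext) algebra
  moreover have "(\<lambda>x. \<alpha> * f x + \<beta> * g x) \<in> borel_measurable (lebesgue_on \<Omega>)"
    using assms by (intro borel_measurable_add borel_measurable_times) (auto simp: Lspace2_iff)
  ultimately show ?thesis unfolding Lspace2_iff by simp
qed

lemma Lspace2_diff:
  fixes f g :: "'a::euclidean_space \<Rightarrow> real"
  shows "f \<in> Lspace \<Omega> 2 \<Longrightarrow> g \<in> Lspace \<Omega> 2 \<Longrightarrow> (\<lambda>x. f x - g x) \<in> Lspace \<Omega> 2"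
  using Lspace2_linear[of f \<Omega> g 1 "-1"] by simp

lemma L2_inner_linear:
  fixes f g \<eta> :: "'a::euclidean_space \<Rightarrow> real"
  assumes "f \<in> Lspace \<Omega> 2" "g \<in> Lspace \<Omega> 2" "\<eta> \<in> Lspace \<Omega> 2"
  shows "L2_inner \<Omega> (\<lambda>x. \<alpha> * f x + \<beta> * g x) \<eta> = \<alpha> * L2_inner \<Omega> f \<eta> + \<beta> * L2_inner \<Omega> g \<eta>"
  unfolding L2_inner_def using Lspace2_integrable_mult[OF assms(1,3)] Lspace2_integrable_mult[OF assms(2,3)]
  by (simp add: algebra_simps)

lemma L2_inner_diff_left:
  fixes f g \<eta> :: "'a::euclidean_space \<Rightarrow> real"
  assumes "f \<in> Lspace \<Omega> 2" "g \<in> Lspace \<Omega> 2" "\<eta> \<in> Lspace \<Omega> 2"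
  shows "L2_inner \<Omega> (\<lambda>x. f x - g x) \<eta> = L2_inner \<Omega> f \<eta> - L2_inner \<Omega> g \<eta>"
  using L2_inner_linear[OF assms, of 1 "-1"] by simp

lemma L2_inner_commute: "L2_inner \<Omega> f g = L2_inner \<Omega> g f"
  by (simp add: L2_inner_def inner_commute)

lemma L2_inner_cong_AE:
  fixes f g \<eta> :: "'a::euclidean_space \<Rightarrow> real"
  assumes "f \<in> Lspace \<Omega> 2" "g \<in> Lspace \<Omega> 2" "\<eta> \<in> Lspace \<Omega> 2" "AE x in lebesgue_on \<Omega>. f x = g x"
  shows "L2_inner \<Omega> f \<eta> = L2_inner \<Omega> g \<eta>"
  unfolding L2_inner_def using assms by (intro integral_cong_AE) (auto simp: Lspace2_iff)

lemma Lspace2_integrable: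
  fixes f :: "'a::euclidean_space \<Rightarrow> real"
  assumes "f \<in> Lspace \<Omega> 2" "\<Omega> \<in> lmeasurable"
  shows "integrable (lebesgue_on \<Omega>) f"
proof -
  have "(\<lambda>_. 1::real) \<in> Lspace \<Omega> 2" using assms(2) by (intro LspaceI_bounded) auto
  from Lspace2_integrable_mult[OF assms(1) this] show ?thesis by simp
qed

subsection \<open>The fundamental lemma of the calculus of variations\<close>

lemma C1_test_bounded:
  assumes "C1_test \<Omega> \<phi> D"
  obtains B where "\<And>x. \<bar>\<phi> x\<bar> \<le> B"
proof -
  have C: "C1_fun \<phi> D" using assms by (simp add: C1_test_def C1_fun_def)
  obtain K where K: "compact K" "\<And>x. x \<notin> K \<Longrightarrow> \<phi> x = 0" using assms by (auto simp: C1_test_def)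
  have "compact (\<phi> ` K)"
    by (rule compact_continuous_image[OF continuous_on_subset[OF C1_fun_continuous[OF C] subset_UNIV] K(1)])
  then obtain B where B: "\<And>x. x \<in> K \<Longrightarrow> \<bar>\<phi> x\<bar> \<le> B"
    by (fastforce simp: bounded_iff dest!: compact_imp_bounded)
  have "\<bar>\<phi> x\<bar> \<le> max 0 B" for x using B[of x] K(2)[of x] by (cases "x \<in> K") auto
  then show thesis by (rule that)
qed

lemma C1_test_Lspace:
  assumes "C1_test \<Omega> \<phi> D" "\<Omega> \<in> lmeasurable"
  shows "\<phi> \<in> Lspace \<Omega> s"
proof -
  obtain B where "\<And>x. \<bar>\<phi> x\<bar> \<le> B" by (rule C1_test_bounded[OF assms(1)]) blast
  moreover have "continuous_on UNIV \<phi>"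
    using assms by (intro C1_fun_continuous) (auto simp: C1_test_def C1_fun_def)
  ultimately show ?thesis
    using assms(2) by (intro LspaceI_bounded[of _ _ B] continuous_on_UNIV_measurable_lebesgue_on) auto
qed

text \<open>Test functions approximate w uniformly and g is integrable. The larger class contains
  the cutoffs that converge to indicators of open sets.\<close>

lemma integral_test_zero_imp_continuous:
  fixes g w :: "'a::euclidean_space \<Rightarrow> real"
  assumes \<Omega>: "open \<Omega>" "bounded \<Omega>" and g: "integrable (lebesgue_on \<Omega>) g"
    and z: "\<And>\<phi> D. C1_test \<Omega> \<phi> D \<Longrightarrow> integral\<^sup>L (lebesgue_on \<Omega>) (\<lambda>x. g x * \<phi> x) = 0"
    and w: "continuous_on UNIV w" "\<And>x. x \<notin> \<Omega> \<Longrightarrow> w x = 0" "\<And>x. \<bar>w x\<bar> \<le> B"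
  shows "integral\<^sup>L (lebesgue_on \<Omega>) (\<lambda>x. g x * w x) = 0"
proof -
  let ?I = "integral\<^sup>L (lebesgue_on \<Omega>)"
  define A where "A = ?I (\<lambda>x. \<bar>g x\<bar>)"
  have "\<bar>?I (\<lambda>x. g x * w x)\<bar> \<le> e * ?I (\<lambda>x. \<bar>g x\<bar>)" if "e > 0" for e
  proof -
    obtain v h0 where v: "h0 > 0" "\<And>h. 0 < h \<Longrightarrow> h < h0 \<Longrightarrow> \<exists>D. C1_test \<Omega> (conv h v) D"
      "\<And>h x. 0 < h \<Longrightarrow> h < h0 \<Longrightarrow> \<bar>conv h v x - w x\<bar> \<le> e"
      using test_function_approx[OF \<Omega> w(1,2) \<open>e > 0\<close>] by metis
    define \<phi> where "\<phi> = conv (h0/2) v"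
    obtain D where D: "C1_test \<Omega> \<phi> D" using v(2)[of "h0/2"] v(1) by (auto simp: \<phi>_def)
    have close: "\<bar>\<phi> x - w x\<bar> \<le> e" for x using v(3)[of "h0/2" x] v(1) by (simp add: \<phi>_def)
    have cont: "continuous_on UNIV \<phi>"
      using D by (intro C1_fun_continuous) (auto simp: C1_test_def C1_fun_def)
    obtain B' where B': "\<And>x. \<bar>\<phi> x\<bar> \<le> B'" by (rule C1_test_bounded[OF D]) blast
    have i: "integrable (lebesgue_on \<Omega>) (\<lambda>x. g x * w x)" "integrable (lebesgue_on \<Omega>) (\<lambda>x. g x * \<phi> x)"
      using integrable_bounded_mult[OF g continuous_on_UNIV_measurable_lebesgue_on[OF w(1)] w(3)]
        integrable_bounded_mult[OF g continuous_on_UNIV_measurable_lebesgue_on[OF cont] B']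
      by (simp_all add: mult.commute)
    have "?I (\<lambda>x. g x * w x) = ?I (\<lambda>x. g x * w x - g x * \<phi> x)"
      using z[OF D] i by simp
    also have "norm \<dots> \<le> ?I (\<lambda>x. e * \<bar>g x\<bar>)"
    proof (rule Bochner_Integration.integral_norm_bound_integral)
      fix x
      have "norm (g x * w x - g x * \<phi> x) = \<bar>g x\<bar> * \<bar>\<phi> x - w x\<bar>"
        by (simp add: abs_mult[symmetric] right_diff_distrib abs_minus_commute)
      also have "\<dots> \<le> \<bar>g x\<bar> * e" by (intro mult_left_mono close) auto
      finally show "norm (g x * w x - g x * \<phi> x) \<le> e * \<bar>g x\<bar>" by (simp add: mult.commute)
    qed (use i g in auto)
    finally show ?thesis by simp
  qed
  then have le: "\<bar>?I (\<lambda>x. g x * w x)\<bar> \<le> e * A" if "e > 0" for e using that by (simp add: A_def)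
  have A: "0 \<le> A" by (simp add: A_def)
  have "\<bar>?I (\<lambda>x. g x * w x)\<bar> \<le> 0 + \<epsilon>" if "\<epsilon> > 0" for \<epsilon>
  proof -
    have "\<epsilon> / (A + 1) > 0" using that A by (intro divide_pos_pos) auto
    moreover have "\<epsilon> / (A + 1) * A \<le> \<epsilon>" using A that by (simp add: field_simps)
    ultimately show ?thesis using le[of "\<epsilon> / (A + 1)"] by linarith
  qed
  then show ?thesis using field_le_epsilon[of "\<bar>?I (\<lambda>x. g x * w x)\<bar>" 0] by simp
qed

text \<open>The vanishing of the integral of g passes from continuous weights to indicators of open
  sets, by complements in \<Omega> to closed sets, and by increasing unions to F-sigma sets. Up to a
  null set, the set where g > 0 is one of these.\<close>

lemma fundamental_lemma_aux:
  fixes g :: "'a::euclidean_space \<Rightarrow> real"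
  assumes \<Omega>: "open \<Omega>" "bounded \<Omega>" and g: "integrable (lebesgue_on \<Omega>) g"
    and z: "\<And>\<phi> D. C1_test \<Omega> \<phi> D \<Longrightarrow> integral\<^sup>L (lebesgue_on \<Omega>) (\<lambda>x. g x * \<phi> x) = 0"
  shows "AE x in lebesgue_on \<Omega>. g x \<le> 0"
proof -
  let ?I = "integral\<^sup>L (lebesgue_on \<Omega>)"
  have [measurable]: "g \<in> borel_measurable (lebesgue_on \<Omega>)" using g by simp
  have \<Omega>m: "\<Omega> \<in> sets lebesgue" using \<Omega>(1) by (simp add: borel_open)
  have ind: "(\<lambda>x. indicator S x :: real) \<in> borel_measurable (lebesgue_on \<Omega>)" if "S \<in> sets lebesgue" for S
    using that by (intro measurable_restrict_space1) auto
  have opn: "?I (\<lambda>x. g x * indicator V x) = 0" if V: "open V" "V \<subseteq> \<Omega>" for V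
  proof -
    \<comment> \<open>\<open>infdist\<close> to the empty set is 0 by default, so the complement of
      V has to be nonempty.\<close>
    have "V \<noteq> UNIV" using bounded_subset[OF \<Omega>(2) V(2)] not_bounded_UNIV[where 'a='a] by metis
    then have ne: "- V \<noteq> {}" by auto
    \<comment> \<open>Continuous cutoffs that vanish off V and increase to its indicator.\<close>
    let ?w = "\<lambda>k x. min 1 (real k * infdist x (- V))"
    have w0: "?I (\<lambda>x. g x * ?w k x) = 0" for k
    proof (rule integral_test_zero_imp_continuous[OF \<Omega> g z])
      show "continuous_on UNIV (?w k)" by (intro continuous_intros)
      show "?w k x = 0" if "x \<notin> \<Omega>" for x
      proof -
        have "x \<in> - V" using that V(2) by auto
        then show ?thesis using infdist_zero[of x "- V"] by simp
      qed
      show "\<bar>?w k x\<bar> \<le> 1" for x using infdist_nonneg[of x "- V"] by auto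
    qed auto
    have "(\<lambda>k. ?I (\<lambda>x. g x * ?w k x)) \<longlonglongrightarrow> ?I (\<lambda>x. g x * indicator V x)"
    proof (rule integral_dominated_convergence[where w="\<lambda>x. \<bar>g x\<bar>"])
      show "(\<lambda>x. g x * indicator V x) \<in> borel_measurable (lebesgue_on \<Omega>)"
        using ind[of V] V(1) by (auto simp: borel_open)
      show "(\<lambda>x. g x * ?w k x) \<in> borel_measurable (lebesgue_on \<Omega>)" for k
        by (rule borel_measurable_times[OF \<open>g \<in> borel_measurable (lebesgue_on \<Omega>)\<close>
          continuous_on_UNIV_measurable_lebesgue_on]) (intro continuous_intros)
      show "integrable (lebesgue_on \<Omega>) (\<lambda>x. \<bar>g x\<bar>)" using g by simp
      show "AE x in lebesgue_on \<Omega>. (\<lambda>k. g x * ?w k x) \<longlonglongrightarrow> g x * indicator V x"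
      proof (intro AE_I2 tendsto_mult tendsto_const)
        fix x
        show "(\<lambda>k. ?w k x) \<longlonglongrightarrow> indicator V x"
        proof (cases "x \<in> V")
          case True
          then have p: "infdist x (- V) > 0"
            using V(1) ne by (intro infdist_pos_not_in_closed) (auto simp: closed_Compl)
          obtain k0 where k0: "1 / infdist x (- V) < real k0" using reals_Archimedean2 by blast
          have "?w k x = 1" if "k \<ge> k0" for k
          proof -
            have "1 / infdist x (- V) \<le> real k" using k0 that by linarith
            then show ?thesis using p by (simp add: field_simps)
          qed
          then have "\<forall>\<^sub>F k in sequentially. ?w k x = indicator V x"
            using True by (auto simp: eventually_sequentially)
          then show ?thesis by (rule tendsto_eventually)
        qed (auto intro!: tendsto_eventually simp: infdist_zero)
      qed
      show "AE x in lebesgue_on \<Omega>. norm (g x * ?w k x) \<le> \<bar>g x\<bar>" for k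
        using infdist_nonneg[of _ "- V"] by (intro AE_I2) (auto simp: abs_mult intro!: mult_left_le)
    qed
    then show ?thesis unfolding w0 by (simp add: LIMSEQ_const_iff)
  qed
  have cmp: "?I (\<lambda>x. g x * indicator C x) = 0" if C: "closed C" "C \<subseteq> \<Omega>" for C
  proof -
    have 1: "?I (\<lambda>x. g x * indicator (\<Omega> - C) x) = 0" using C \<Omega> by (intro opn) (auto simp: open_Diff)
    have 2: "?I (\<lambda>x. g x * indicator \<Omega> x) = 0" using \<Omega> by (intro opn) auto
    have i: "integrable (lebesgue_on \<Omega>) (\<lambda>x. g x * indicator S x)" if "S \<in> sets lebesgue" for S
      using integrable_bounded_mult[OF g ind[OF that], of 1] by (simp add: mult.commute indicator_le_1)
    have "(\<lambda>x. g x * indicator C x) = (\<lambda>x. g x * indicator \<Omega> x - g x * indicator (\<Omega> - C) x)"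
      using C(2) by (auto simp: indicator_def fun_eq_iff)
    then show ?thesis using 1 2 i[of \<Omega>] i[of "\<Omega> - C"] \<Omega>m C(1) by (simp add: sets.Diff borel_closed)
  qed
  define S where "S = {x \<in> \<Omega>. g x > 0}"
  have "S \<in> sets (lebesgue_on \<Omega>)"
    using borel_measurable_less[of "\<lambda>_. 0" "lebesgue_on \<Omega>" g] by (simp add: S_def)
  then have Sm: "S \<in> sets lebesgue" using \<Omega>m by (auto simp: sets_restrict_space)
  obtain C N where CN: "fsigma C" "N \<in> null_sets lebesgue" "C \<union> N = S"
    using lebesgue_set_almost_fsigma[OF Sm] by metis
  obtain F :: "nat \<Rightarrow> 'a set" where F: "\<And>n. closed (F n)" "C = (\<Union>n. F n)"
    using CN(1) by (cases rule: fsigma.cases) auto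
  define G where "G n = (\<Union>i<n. F i)" for n
  have G: "closed (G n)" "G n \<subseteq> \<Omega>" for n
    using F CN(3) unfolding G_def S_def by (auto intro!: closed_UN)
  have C0: "?I (\<lambda>x. g x * indicator C x) = 0"
  proof -
    have Cm: "C \<in> sets lebesgue" unfolding F(2) using F(1) by (auto simp: borel_closed)
    have "(\<lambda>k. ?I (\<lambda>x. g x * indicator (G k) x)) \<longlonglongrightarrow> ?I (\<lambda>x. g x * indicator C x)"
    proof (rule integral_dominated_convergence[where w="\<lambda>x. \<bar>g x\<bar>"])
      show "(\<lambda>x. g x * indicator C x) \<in> borel_measurable (lebesgue_on \<Omega>)" using ind[OF Cm] by auto
      show "(\<lambda>x. g x * indicator (G k) x) \<in> borel_measurable (lebesgue_on \<Omega>)" for k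
        using ind[of "G k"] G(1) by (auto simp: borel_closed)
      show "integrable (lebesgue_on \<Omega>) (\<lambda>x. \<bar>g x\<bar>)" using g by simp
      show "AE x in lebesgue_on \<Omega>. (\<lambda>k. g x * indicator (G k) x) \<longlonglongrightarrow> g x * indicator C x"
      proof (intro AE_I2 tendsto_mult tendsto_const)
        fix x
        show "(\<lambda>k. indicator (G k) x :: real) \<longlonglongrightarrow> indicator C x"
        proof (cases "x \<in> C")
          case True
          then obtain i where "x \<in> F i" using F(2) by auto
          then have "\<forall>\<^sub>F k in sequentially. (indicator (G k) x :: real) = indicator C x"
            unfolding eventually_sequentially
            using True by (intro exI[of _ "Suc i"]) (force simp: G_def indicator_def)
          then show ?thesis by (rule tendsto_eventually)
        qed (auto intro!: tendsto_eventually simp: G_def F(2))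
      qed
      show "AE x in lebesgue_on \<Omega>. norm (g x * indicator (G k) x) \<le> \<bar>g x\<bar>" for k
        by (intro AE_I2) (auto simp: indicator_def)
    qed
    then show ?thesis unfolding cmp[OF G] by (simp add: LIMSEQ_const_iff)
  qed
  have "N \<inter> \<Omega> = N" using CN(3) by (auto simp: S_def)
  then have "N \<in> null_sets (lebesgue_on \<Omega>)"
    using CN(2) \<Omega>m by (subst null_sets_restrict_space) auto
  then have aeN: "AE x in lebesgue_on \<Omega>. x \<notin> N" by (rule AE_not_in)
  \<comment> \<open>Off the null set N the set C is exactly where g is positive, so the vanishing
    integral is that of the positive part.\<close>
  have "AE x in lebesgue_on \<Omega>. g x * indicator C x = max 0 (g x)"
    using aeN AE_space
  proof eventually_elim
    case (elim x)
    then have "x \<in> C \<longleftrightarrow> g x > 0" using CN(3) by (auto simp: S_def)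
    then show ?case by (auto simp: indicator_def)
  qed
  then have "?I (\<lambda>x. max 0 (g x)) = ?I (\<lambda>x. g x * indicator C x)"
    using ind[of C] F by (intro integral_cong_AE) (auto simp: borel_closed)
  then have "AE x in lebesgue_on \<Omega>. max 0 (g x) = 0"
    using integral_nonneg_eq_0_iff_AE[of "lebesgue_on \<Omega>" "\<lambda>x. max 0 (g x)"] g C0 by simp
  then show ?thesis by eventually_elim auto
qed

lemma fundamental_lemma:
  fixes g :: "'a::euclidean_space \<Rightarrow> real"
  assumes \<Omega>: "open \<Omega>" "bounded \<Omega>" and g: "integrable (lebesgue_on \<Omega>) g"
    and z: "\<And>\<phi> D. C1_test \<Omega> \<phi> D \<Longrightarrow> integral\<^sup>L (lebesgue_on \<Omega>) (\<lambda>x. g x * \<phi> x) = 0"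
  shows "AE x in lebesgue_on \<Omega>. g x = 0"
proof -
  have "AE x in lebesgue_on \<Omega>. - g x \<le> 0"
    by (rule fundamental_lemma_aux[OF \<Omega>]) (use g z in auto)
  moreover have "AE x in lebesgue_on \<Omega>. g x \<le> 0"
    by (rule fundamental_lemma_aux[OF \<Omega> g]) (rule z)
  ultimately show ?thesis by eventually_elim auto
qed

subsection \<open>Uniqueness and linearity of the divergence\<close>

lemma is_divergence_unique:
  fixes \<Omega> :: "'a::euclidean_space set"
  assumes \<Omega>: "open \<Omega>" "bounded \<Omega>" and u: "is_divergence \<Omega> v u" "is_divergence \<Omega> v u'"
  shows "AE x in lebesgue_on \<Omega>. u x = u' x"
proof -
  have m: "\<Omega> \<in> lmeasurable" using \<Omega> by (simp add: lmeasurable_open)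
  have L: "u \<in> Lspace \<Omega> 2" "u' \<in> Lspace \<Omega> 2" using u by (auto simp: is_divergence_def)
  have "AE x in lebesgue_on \<Omega>. u x - u' x = 0"
  proof (rule fundamental_lemma[OF \<Omega>])
    show "integrable (lebesgue_on \<Omega>) (\<lambda>x. u x - u' x)"
      by (intro Bochner_Integration.integrable_diff Lspace2_integrable L m)
    fix \<phi> D assume t: "C1_test \<Omega> \<phi> D"
    have "vpair v D = - L2_inner \<Omega> u \<phi>" "vpair v D = - L2_inner \<Omega> u' \<phi>"
      using u t unfolding is_divergence_def by blast+
    then have "L2_inner \<Omega> (\<lambda>x. u x - u' x) \<phi> = 0"
      using L2_inner_diff_left[OF L C1_test_Lspace[OF t m]] by simp
    then show "integral\<^sup>L (lebesgue_on \<Omega>) (\<lambda>x. (u x - u' x) * \<phi> x) = 0"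
      by (simp add: L2_inner_def)
  qed
  then show ?thesis by eventually_elim simp
qed

text \<open>\<open>divergence\<close> picks an arbitrary representative; in inner products with L^2
  functions any divergence at hand may replace it.\<close>

lemma divergence_eq:
  fixes \<Omega> :: "'a::euclidean_space set"
  assumes \<Omega>: "open \<Omega>" "bounded \<Omega>" and u: "is_divergence \<Omega> v u"
  shows "is_divergence \<Omega> v (divergence \<Omega> v)"
    "\<eta> \<in> Lspace \<Omega> 2 \<Longrightarrow> L2_inner \<Omega> (divergence \<Omega> v) \<eta> = L2_inner \<Omega> u \<eta>"
proof -
  show d: "is_divergence \<Omega> v (divergence \<Omega> v)"
    unfolding divergence_def by (rule someI[of "is_divergence \<Omega> v", OF u])
  show "L2_inner \<Omega> (divergence \<Omega> v) \<eta> = L2_inner \<Omega> u \<eta>" if "\<eta> \<in> Lspace \<Omega> 2"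
    by (rule L2_inner_cong_AE[OF _ _ that is_divergence_unique[OF \<Omega> d u]])
      (use d u in \<open>auto simp: is_divergence_def\<close>)
qed

lemma is_divergence_diff:
  fixes \<Omega> :: "'a::euclidean_space set"
  assumes \<Omega>: "\<Omega> \<in> lmeasurable" and "is_divergence \<Omega> v u" "is_divergence \<Omega> v' u'"
  shows "is_divergence \<Omega> (v - v') (\<lambda>x. u x - u' x)"
proof -
  have L: "u \<in> Lspace \<Omega> 2" "u' \<in> Lspace \<Omega> 2" using assms by (auto simp: is_divergence_def)
  have "vpair (v - v') D = - L2_inner \<Omega> (\<lambda>x. u x - u' x) \<phi>" if t: "C1_test \<Omega> \<phi> D" for \<phi> D
  proof -
    have "vpair (v - v') D = vpair v D - vpair v' D" by (simp add: vpair_def sum_subtractf)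
    then show ?thesis using assms(2,3) t L2_inner_diff_left[OF L C1_test_Lspace[OF t \<Omega>]]
      by (simp add: is_divergence_def)
  qed
  then show ?thesis using Lspace2_diff[OF L] by (simp add: is_divergence_def)
qed

lemma continuous_on_UNIV_bounded:
  fixes f :: "'a::euclidean_space \<Rightarrow> 'b::euclidean_space"
  assumes "continuous_on UNIV f" "bounded \<Omega>"
  obtains B where "\<And>x. x \<in> \<Omega> \<Longrightarrow> norm (f x) \<le> B"
proof -
  have "compact (f ` closure \<Omega>)"
    using assms by (intro compact_continuous_image[OF continuous_on_subset[OF assms(1) subset_UNIV]]) auto
  then have "bounded (f ` closure \<Omega>)" by (rule compact_imp_bounded)
  then obtain B where B: "\<forall>y \<in> f ` closure \<Omega>. norm y \<le> B"
    unfolding bounded_iff by blast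
  show thesis
  proof (rule that)
    fix x assume "x \<in> \<Omega>"
    then have "f x \<in> f ` closure \<Omega>" using closure_subset[of \<Omega>] by auto
    then show "norm (f x) \<le> B" using B by auto
  qed
qed

text \<open>The divergence is tested with functions \<psi> of compact support in \<Omega>, so \<phi>
  \<psi> has compact support whatever \<phi> does on the boundary, and its partial derivative
  integrates to 0.\<close>

lemma C1_fun_is_divergence:
  fixes \<Omega> :: "'a::euclidean_space set"
  assumes \<Omega>: "open \<Omega>" "bounded \<Omega>" and C: "C1_fun \<phi> D" and b: "b \<in> Basis"
  shows "is_divergence \<Omega> (vdens \<Omega> (\<lambda>x. \<phi> x *\<^sub>R b)) (\<lambda>x. D x \<bullet> b)"
proof -
  have m: "\<Omega> \<in> lmeasurable" using \<Omega> by (simp add: lmeasurable_open)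
  have cD: "continuous_on UNIV (\<lambda>x. D x \<bullet> b)" "continuous_on UNIV D"
    using C by (auto simp: C1_fun_def intro!: continuous_intros)
  have c\<phi>: "continuous_on UNIV \<phi>" by (rule C1_fun_continuous[OF C])
  obtain B where "\<And>x. x \<in> \<Omega> \<Longrightarrow> norm (D x \<bullet> b) \<le> B" by (rule continuous_on_UNIV_bounded[OF cD(1) \<Omega>(2)]) blast
  then have L: "(\<lambda>x. D x \<bullet> b) \<in> Lspace \<Omega> 2"
    using m by (intro LspaceI_bounded continuous_on_UNIV_measurable_lebesgue_on cD)
  have "vpair (vdens \<Omega> (\<lambda>x. \<phi> x *\<^sub>R b)) E = - L2_inner \<Omega> (\<lambda>x. D x \<bullet> b) \<psi>" if t: "C1_test \<Omega> \<psi> E" for \<psi> E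
  proof -
    have C': "C1_fun \<psi> E" using t by (simp add: C1_test_def C1_fun_def)
    have cE: "continuous_on UNIV E" "continuous_on UNIV \<psi>"
      using C' C1_fun_continuous[OF C'] by (auto simp: C1_fun_def)
    obtain K where K: "compact K" "K \<subseteq> \<Omega>" "\<And>x. x \<notin> K \<Longrightarrow> \<psi> x = 0" using t by (auto simp: C1_test_def)
    have E0: "E x = 0" if "x \<notin> K" for x
    proof (rule GDERIV_zero_open[of "- K"])
      show "GDERIV \<psi> x :> E x" using C' by (simp add: C1_fun_def)
    qed (use K that in \<open>auto simp: compact_imp_closed\<close>)
    obtain a c where ac: "\<Omega> \<subseteq> cbox a c" using cbox_superset[OF \<Omega>(2)] .
    have supp: "E x = 0" "\<psi> x = 0" if "x \<notin> \<Omega>" for x using that K E0 by blast+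
    have i1: "integrable lborel (\<lambda>x. (E x \<bullet> b) * \<phi> x)" 
      by (rule integrable_lborel_continuous_support(1)[of _ a c])
       (use ac supp(1) in \<open>force intro!: continuous_intros cE c\<phi>\<close>)+
    have i2: "integrable lborel (\<lambda>x. (D x \<bullet> b) * \<psi> x)" 
      by (rule integrable_lborel_continuous_support(1)[of _ a c])
       (use ac supp(2) in \<open>force intro!: continuous_intros cE cD\<close>)+
    have "vpair (vdens \<Omega> (\<lambda>x. \<phi> x *\<^sub>R b)) E
      = (\<Sum>b'\<in>Basis. if b' = b then integral\<^sup>L (lebesgue_on \<Omega>) (\<lambda>x. (E x \<bullet> b) * \<phi> x) else 0)"
      unfolding vpair_def vdens_def using b by (intro sum.cong refl) (auto simp: inner_Basis)
    also have "\<dots> = integral\<^sup>L (lebesgue_on \<Omega>) (\<lambda>x. (E x \<bullet> b) * \<phi> x)"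
      using b by simp
    also have "\<dots> = integral\<^sup>L lborel (\<lambda>x. (E x \<bullet> b) * \<phi> x)"
      using m supp by (intro lebesgue_on_integral_support borel_measurable_continuous_onI continuous_intros cE c\<phi>) auto
    finally have 1: "vpair (vdens \<Omega> (\<lambda>x. \<phi> x *\<^sub>R b)) E = integral\<^sup>L lborel (\<lambda>x. (E x \<bullet> b) * \<phi> x)" .
    have 2: "L2_inner \<Omega> (\<lambda>x. D x \<bullet> b) \<psi> = integral\<^sup>L lborel (\<lambda>x. (D x \<bullet> b) * \<psi> x)"
      unfolding L2_inner_def inner_real_def
      using m supp by (intro lebesgue_on_integral_support borel_measurable_continuous_onI continuous_intros cE cD) auto
    have "integral\<^sup>L lborel (\<lambda>x. (\<phi> x *\<^sub>R E x + \<psi> x *\<^sub>R D x) \<bullet> b) = 0"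
    proof (rule integral_partial_derivative_eq_0[OF _ K(1)])
      show "C1_fun (\<lambda>x. \<phi> x * \<psi> x) (\<lambda>x. \<phi> x *\<^sub>R E x + \<psi> x *\<^sub>R D x)"
        using C C' unfolding C1_fun_def by (auto intro!: GDERIV_mult continuous_intros c\<phi> cE)
      show "\<phi> x * \<psi> x = 0" if "x \<notin> K" for x using K(3)[OF that] by simp
    qed
    then have "integral\<^sup>L lborel (\<lambda>x. (E x \<bullet> b) * \<phi> x + (D x \<bullet> b) * \<psi> x) = 0"
      by (simp add: inner_add_left mult.commute)
    then show ?thesis using i1 i2 1 2 by simp
  qed
  then show ?thesis using L by (simp add: is_divergence_def)
qed

subsection \<open>Weak gradients of Lipschitz functions\<close>

text \<open>Mazur's argument without duality: nearly norm-minimal elements of a decreasing sequence of convex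
  sets form a Cauchy sequence in \<open>L\<^sup>2\<close>, by the parallelogram identity.\<close>

lemma decreasing_convex_sets_AE_limit:
  fixes S :: "nat \<Rightarrow> ('a \<Rightarrow> real) set"
  assumes fin: "finite_measure M"
    and ne: "\<And>k. S k \<noteq> {}" and anti: "\<And>k m. k \<le> m \<Longrightarrow> S m \<subseteq> S k"
    and mid: "\<And>k f g. f \<in> S k \<Longrightarrow> g \<in> S k \<Longrightarrow> (\<lambda>x. (f x + g x) / 2) \<in> S k"
    and meas: "\<And>k f. f \<in> S k \<Longrightarrow> f \<in> borel_measurable M"
    and bd: "\<And>k f x. f \<in> S k \<Longrightarrow> x \<in> space M \<Longrightarrow> \<bar>f x\<bar> \<le> K"
  obtains h where "\<And>k. h k \<in> S k" "AE x in M. convergent (\<lambda>k. h k x)"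
proof -
  interpret finite_measure M by (rule fin)
  define J where "J f = integral\<^sup>L M (\<lambda>x. (f x)\<^sup>2)" for f :: "'a \<Rightarrow> real"
  define I where "I k = Inf (J ` S k)" for k
  let ?\<mu> = "measure M (space M)"
  have sq: "integrable M (\<lambda>x. f x * g x)" if "f \<in> S k" "g \<in> S l" for f g k l
  proof (rule integrable_const_bound[of _ "K * K"])
    show "AE x in M. norm (f x * g x) \<le> K * K"
      using bd that by (intro AE_I2) (auto simp: abs_mult intro!: mult_mono order_trans[OF abs_ge_zero bd])
    show "(\<lambda>x. f x * g x) \<in> borel_measurable M" using meas that by (intro borel_measurable_times) auto
  qed
  have sq2: "integrable M (\<lambda>x. (f x)\<^sup>2)" if "f \<in> S k" for f k
    using sq[OF that that] by (simp add: power2_eq_square)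
  have J0: "J f \<ge> 0" for f unfolding J_def by simp
  have bdd: "bdd_below (J ` S k)" for k using J0 by (auto intro!: bdd_belowI[of _ 0])
  have Ile: "I k \<le> J f" if "f \<in> S k" for k f
    unfolding I_def using that bdd by (intro cInf_lower) auto
  have Imono: "I k \<le> I m" if "k \<le> m" for k m
    unfolding I_def using that ne bdd anti[OF that] by (intro cInf_superset_mono) auto
  have JK: "J f \<le> K\<^sup>2 * ?\<mu>" if "f \<in> S k" for f k
  proof -
    have "J f \<le> integral\<^sup>L M (\<lambda>x. K\<^sup>2)"
      unfolding J_def
    proof (rule integral_mono[OF sq2[OF that]])
      fix x assume "x \<in> space M"
      then show "(f x)\<^sup>2 \<le> K\<^sup>2" using power_mono[OF bd[OF that], of x 2] by simp
    qed simp
    then show ?thesis by (simp add: mult.commute)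
  qed
  have IK: "I k \<le> K\<^sup>2 * ?\<mu>" for k
  proof -
    obtain f where "f \<in> S k" using ne[of k] by blast
    from order_trans[OF Ile[OF this] JK[OF this]] show ?thesis .
  qed
  \<comment> \<open>The sets shrink, so the infima increase; they are bounded, hence Cauchy, and
    this makes the near minimizers Cauchy in turn.\<close>
  have "incseq I" using Imono by (simp add: incseq_def)
  moreover have "\<forall>i. I i \<le> K\<^sup>2 * ?\<mu>" using IK by blast
  ultimately obtain L where "I \<longlonglongrightarrow> L" by (rule incseq_convergent)
  then have CI: "Cauchy I" by (rule LIMSEQ_imp_Cauchy)
  have "\<exists>f. f \<in> S k \<and> J f < I k + 1 / Suc k" for k
  proof -
    have "Inf (J ` S k) < I k + 1 / Suc k" by (simp add: I_def)
    then obtain y where "y \<in> J ` S k" "y < I k + 1 / Suc k"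
      using ne[of k] cInf_lessD by (metis image_is_empty)
    then show ?thesis by auto
  qed
  then obtain f where f: "\<And>k. f k \<in> S k" "\<And>k. J (f k) < I k + 1 / Suc k" by metis
  \<comment> \<open>For k \<le> m both functions lie in \<open>S k\<close>, hence so does their
    midpoint, whose squared norm is at least \<open>I k\<close>. The parallelogram identity leaves
    the gap of the infima and the errors of near minimality.\<close>
  have diff: "integral\<^sup>L M (\<lambda>x. (f k x - f m x)\<^sup>2) \<le> 2 * (I m - I k) + 4 / Suc k" if "k \<le> m" for k m
  proof -
    have fm: "f m \<in> S k" using f(1) anti[OF that] by auto
    let ?a = "\<lambda>x. (f k x + f m x) / 2"
    have a: "?a \<in> S k" by (rule mid[OF f(1) fm])
    have "(\<lambda>x. (f k x - f m x)\<^sup>2) = (\<lambda>x. 2 * (f k x)\<^sup>2 + 2 * (f m x)\<^sup>2 - 4 * (?a x)\<^sup>2)"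
      by (rule ext) (simp add: power2_eq_square field_simps)
    then have "integral\<^sup>L M (\<lambda>x. (f k x - f m x)\<^sup>2) = 2 * J (f k) + 2 * J (f m) - 4 * J ?a"
      using sq2[OF f(1)[of k]] sq2[OF fm] sq2[OF a] unfolding J_def by simp
    moreover have "J ?a \<ge> I k" by (rule Ile[OF a])
    moreover have "1 / real (Suc m) \<le> 1 / real (Suc k)" using that by (intro divide_left_mono) auto
    moreover have "x \<le> 2 * (i2 - i1) + 4 * d1" 
      if "x = 2 * a + 2 * b - 4 * c" "i1 \<le> c" "d2 \<le> d1" "a < i1 + d1" "b < i2 + d2"
      for x a b c d1 d2 i1 i2 :: real
      using that by argo
    ultimately show ?thesis using f(2)[of k] f(2)[of m] by fastforce
  qed
  have int1: "integrable M (f k)" for k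
    using meas[OF f(1)] bd[OF f(1)] by (intro integrable_const_bound[of _ K]) auto
  have dsq: "integrable M (\<lambda>x. (f k x - f m x)\<^sup>2)" for k m
    using sq[OF f(1) f(1), of k k] sq[OF f(1) f(1), of m m] sq[OF f(1) f(1), of k m]
    by (simp add: power2_eq_square algebra_simps)
  have cauchy: "\<exists>N. \<forall>i\<ge>N. \<forall>j\<ge>N. LINT x|M. norm (f i x - f j x) < e" if "e > 0" for e
  proof -
    \<comment> \<open>The L^1 distance is bounded through t \<le> \<delta> + t^2 / \<delta>. The
      constants are made so that \<delta> times the total mass and \<theta> / \<delta> are each at
      most e/2; the summand 1 guards against total mass 0.\<close>
    define \<delta> where "\<delta> = e / (2 * (?\<mu> + 1))"
    have \<delta>: "\<delta> > 0" using that by (simp add: \<delta>_def add_nonneg_pos)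
    have \<mu>1: "0 < ?\<mu> + 1" by (simp add: add_nonneg_pos)
    have "\<delta> * ?\<mu> = (e / 2) * (?\<mu> / (?\<mu> + 1))" by (simp add: \<delta>_def)
    also have "\<dots> \<le> (e / 2) * 1" using \<mu>1 that by (intro mult_left_mono) auto
    finally have \<delta>\<mu>: "\<delta> * ?\<mu> \<le> e / 2" by simp
    define \<theta> where "\<theta> = \<delta> * e / 2"
    have \<theta>: "\<theta> > 0" using \<delta> that by (simp add: \<theta>_def)
    have \<theta>8: "\<theta> / 8 > 0" using \<theta> by simp
    from CI[unfolded Cauchy_def dist_real_def, rule_format, OF \<theta>8]
    obtain N1 where N1: "\<And>i j. i \<ge> N1 \<Longrightarrow> j \<ge> N1 \<Longrightarrow> \<bar>I i - I j\<bar> < \<theta> / 8" by blast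
    obtain N2 :: nat where N2: "8 / \<theta> < real N2" using reals_Archimedean2 by blast
    have l2: "integral\<^sup>L M (\<lambda>x. (f i x - f j x)\<^sup>2) < \<theta>" if "i \<ge> max N1 N2" "i \<le> j" for i j
    proof -
      have "8 / \<theta> < real (Suc i)" using N2 that by linarith
      then have "4 / real (Suc i) < \<theta> / 2" using \<theta> by (simp add: field_simps)
      moreover have "I j - I i < \<theta> / 8"
      proof -
        have ij: "N1 \<le> j" "N1 \<le> i" using that by auto
        show ?thesis by (rule le_less_trans[OF abs_ge_self N1[OF ij]])
      qed
      moreover have "x < \<theta>" if "x \<le> 2 * d + y" "y < \<theta> / 2" "d < \<theta> / 8" for x d y :: real
        using that \<theta> by argo
      ultimately show ?thesis using diff[OF that(2)] by blast
    qed
    have l2': "integral\<^sup>L M (\<lambda>x. (f i x - f j x)\<^sup>2) < \<theta>" if "i \<ge> max N1 N2" "j \<ge> max N1 N2" for i j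
      using l2[of i j] l2[of j i] that by (cases "i \<le> j") (auto simp: power2_commute)
    show ?thesis
    proof (intro exI[of _ "max N1 N2"] allI impI)
      fix i j assume ij: "max N1 N2 \<le> i" "max N1 N2 \<le> j"
      have "(LINT x|M. norm (f i x - f j x)) \<le> (LINT x|M. \<delta> + (f i x - f j x)\<^sup>2 / \<delta>)"
      proof (rule integral_mono)
        show "integrable M (\<lambda>x. norm (f i x - f j x))" using int1 by auto
        show "integrable M (\<lambda>x. \<delta> + (f i x - f j x)\<^sup>2 / \<delta>)" using dsq by auto
        fix x
        have "t \<le> \<delta> + t\<^sup>2 / \<delta>" if "t \<ge> 0" for t :: real
        proof (cases "t \<le> \<delta>")
          case False
          then have "t * \<delta> \<le> t\<^sup>2" using that by (simp add: power2_eq_square mult_left_mono)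
          then have "t \<le> t\<^sup>2 / \<delta>" using \<delta> by (simp add: field_simps)
          then show ?thesis using \<delta> by simp
        qed (use \<delta> in \<open>auto intro!: add_increasing2\<close>)
        from this[of "\<bar>f i x - f j x\<bar>"] show "norm (f i x - f j x) \<le> \<delta> + (f i x - f j x)\<^sup>2 / \<delta>" by simp
      qed
      also have "\<dots> = \<delta> * ?\<mu> + integral\<^sup>L M (\<lambda>x. (f i x - f j x)\<^sup>2) / \<delta>" using dsq by simp
      also have "\<dots> < e / 2 + e / 2"
      proof (rule add_le_less_mono[OF \<delta>\<mu>])
        show "integral\<^sup>L M (\<lambda>x. (f i x - f j x)\<^sup>2) / \<delta> < e / 2"
          using l2'[OF ij] \<delta> by (simp add: \<theta>_def field_simps)
      qed
      finally show "(LINT x|M. norm (f i x - f j x)) < e" by simp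
    qed
  qed
  obtain r where r: "strict_mono r" "AE x in M. Cauchy (\<lambda>i. f (r i) x)"
    using cauchy_L1_AE_cauchy_subseq[OF int1 cauchy] by blast
  show thesis
  proof (rule that[of "\<lambda>k. f (r k)"])
    show "f (r k) \<in> S k" for k using f(1) anti[OF seq_suble[OF r(1)]] by blast
    show "AE x in M. convergent (\<lambda>k. f (r k) x)"
      using r(2) by eventually_elim (simp add: Cauchy_convergent)
  qed
qed

lemma C1_test_gradient_bounded:
  assumes "C1_test \<Omega> \<phi> D"
  obtains B where "\<And>x. norm (D x) \<le> B" "B \<ge> 0"
proof -
  have C: "C1_fun \<phi> D" using assms by (simp add: C1_test_def C1_fun_def)
  then have cD: "continuous_on UNIV D" by (simp add: C1_fun_def)
  obtain K where K: "compact K" "\<And>x. x \<notin> K \<Longrightarrow> \<phi> x = 0" using assms unfolding C1_test_def by blast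
  have D0: "D x = 0" if "x \<notin> K" for x
  proof (rule GDERIV_zero_open[of "- K"])
    show "GDERIV \<phi> x :> D x" using C by (simp add: C1_fun_def)
  qed (use K that in \<open>auto simp: compact_imp_closed\<close>)
  obtain B where B: "\<And>x. x \<in> K \<Longrightarrow> norm (D x) \<le> B"
    by (rule continuous_on_UNIV_bounded[OF cD compact_imp_bounded[OF K(1)]]) blast
  have "norm (D x) \<le> max 0 B" for x using B[of x] D0[of x] by (cases "x \<in> K") auto
  then show thesis by (rule that) simp
qed

text \<open>The zero extension turns the integral into one over the whole space, where a shift moves
  the difference quotient from w to the differentiable function \<phi>, with the opposite
  sign.\<close>

lemma difference_quotient_weak_limit:
  fixes w :: "'a::euclidean_space \<Rightarrow> real"
  assumes \<Omega>: "open \<Omega>" "bounded \<Omega>"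
    and w: "continuous_on UNIV w" "\<And>x. x \<notin> \<Omega> \<Longrightarrow> w x = 0" and t: "C1_test \<Omega> \<phi> D"
  shows "(\<lambda>n. integral\<^sup>L (lebesgue_on \<Omega>) (\<lambda>x. (w (x + (1 / Suc n) *\<^sub>R b) - w x) * Suc n * \<phi> x))
    \<longlonglongrightarrow> - integral\<^sup>L (lebesgue_on \<Omega>) (\<lambda>x. w x * (D x \<bullet> b))"
proof -
  have \<Omega>m: "\<Omega> \<in> sets lebesgue" using \<Omega>(1) by (simp add: borel_open)
  have C: "C1_fun \<phi> D" using t by (simp add: C1_test_def C1_fun_def)
  have cD: "continuous_on UNIV D" using C by (simp add: C1_fun_def)
  have c\<phi>: "continuous_on UNIV \<phi>" by (rule C1_fun_continuous[OF C])
  have \<phi>0: "\<phi> x = 0" if "x \<notin> \<Omega>" for x using t that unfolding C1_test_def by blast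
  obtain a c where ac: "\<Omega> \<subseteq> cbox a c" using cbox_superset[OF \<Omega>(2)] .
  have cw': "continuous_on UNIV (\<lambda>x. w (x + s *\<^sub>R b))" for s
    by (intro continuous_on_compose2[OF w(1)] continuous_intros) auto
  have c\<phi>': "continuous_on UNIV (\<lambda>x. \<phi> (x - s *\<^sub>R b))" for s
    by (intro continuous_on_compose2[OF c\<phi>] continuous_intros) auto
  have i1: "integrable lborel (\<lambda>x. w (x + s *\<^sub>R b) * \<phi> x)" for s
  proof (rule integrable_lborel_continuous_support(1))
    show "continuous_on UNIV (\<lambda>x. w (x + s *\<^sub>R b) * \<phi> x)" by (intro continuous_on_mult cw' c\<phi>)
    show "w (x + s *\<^sub>R b) * \<phi> x = 0" if "x \<notin> cbox a c" for x using \<phi>0[of x] that ac by auto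
  qed
  have i2: "integrable lborel (\<lambda>x. w x * \<phi> (x - s *\<^sub>R b))" for s
  proof (rule integrable_lborel_continuous_support(1))
    show "continuous_on UNIV (\<lambda>x. w x * \<phi> (x - s *\<^sub>R b))" by (intro continuous_on_mult w c\<phi>')
    show "w x * \<phi> (x - s *\<^sub>R b) = 0" if "x \<notin> cbox a c" for x using w(2)[of x] that ac by auto
  qed
  have iw: "integrable lborel w"
    by (rule integrable_lborel_continuous_support(1)[OF w(1), of a c]) (use w(2) ac in auto)
  have eq: "integral\<^sup>L (lebesgue_on \<Omega>) (\<lambda>x. (w (x + (1 / Suc n) *\<^sub>R b) - w x) * Suc n * \<phi> x)
     = integral\<^sup>L lborel (\<lambda>x. w x * ((\<phi> (x - (1 / Suc n) *\<^sub>R b) - \<phi> x) * Suc n))" for n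
  proof -
    let ?s = "1 / real (Suc n)"
    have "integral\<^sup>L (lebesgue_on \<Omega>) (\<lambda>x. (w (x + ?s *\<^sub>R b) - w x) * Suc n * \<phi> x)
        = integral\<^sup>L lborel (\<lambda>x. (w (x + ?s *\<^sub>R b) - w x) * Suc n * \<phi> x)"
      by (rule lebesgue_on_integral_support[OF \<Omega>m])
        (auto simp: \<phi>0 intro!: borel_measurable_continuous_onI continuous_intros w(1) cw' c\<phi>)
    also have "\<dots> = integral\<^sup>L lborel (\<lambda>x. Suc n * (w (x + ?s *\<^sub>R b) * \<phi> x - w x * \<phi> x))"
      by (simp add: algebra_simps)
    also have "\<dots> = Suc n * (integral\<^sup>L lborel (\<lambda>x. w (x + ?s *\<^sub>R b) * \<phi> x) - integral\<^sup>L lborel (\<lambda>x. w x * \<phi> x))"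
      using i1[of ?s] i1[of 0] by simp
    also have "integral\<^sup>L lborel (\<lambda>x. w (x + ?s *\<^sub>R b) * \<phi> x) = integral\<^sup>L lborel (\<lambda>x. w x * \<phi> (x - ?s *\<^sub>R b))"
      using lborel_integral_affine[of "\<lambda>x. w x * \<phi> (x - ?s *\<^sub>R b)" 1 "?s *\<^sub>R b"] w(1) c\<phi>'[of ?s]
      by (simp add: borel_measurable_continuous_onI continuous_on_mult add.commute)
    also have "Suc n * (integral\<^sup>L lborel (\<lambda>x. w x * \<phi> (x - ?s *\<^sub>R b)) - integral\<^sup>L lborel (\<lambda>x. w x * \<phi> x))
      = integral\<^sup>L lborel (\<lambda>x. Suc n * (w x * \<phi> (x - ?s *\<^sub>R b) - w x * \<phi> x))"
      using i2[of ?s] i2[of 0] by simp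
    finally show ?thesis by (simp add: algebra_simps)
  qed
  obtain B where B: "\<And>x. norm (D x) \<le> B" "B \<ge> 0" by (rule C1_test_gradient_bounded[OF t]) blast
  have "(\<lambda>n. integral\<^sup>L lborel (\<lambda>x. w x * ((\<phi> (x - (1 / Suc n) *\<^sub>R b) - \<phi> x) * Suc n)))
      \<longlonglongrightarrow> integral\<^sup>L lborel (\<lambda>x. w x * (- (D x \<bullet> b)))"
  proof (rule integral_dominated_convergence[where w="\<lambda>x. \<bar>w x\<bar> * (B * norm b)"])
    show "(\<lambda>x. w x * (- (D x \<bullet> b))) \<in> borel_measurable lborel"
      by (auto intro!: borel_measurable_continuous_onI continuous_intros w cD)
    show "(\<lambda>x. w x * ((\<phi> (x - (1 / Suc n) *\<^sub>R b) - \<phi> x) * Suc n)) \<in> borel_measurable lborel" for n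
      by (auto intro!: borel_measurable_continuous_onI continuous_intros w c\<phi>' c\<phi>)
    show "integrable lborel (\<lambda>x. \<bar>w x\<bar> * (B * norm b))" using iw by auto
    show "AE x in lborel. (\<lambda>n. w x * ((\<phi> (x - (1 / Suc n) *\<^sub>R b) - \<phi> x) * Suc n)) \<longlonglongrightarrow> w x * (- (D x \<bullet> b))"
    proof (intro AE_I2 tendsto_mult tendsto_const)
      fix x
      have "((\<lambda>s. \<phi> (x + s *\<^sub>R (- b))) has_field_derivative D x \<bullet> (- b)) (at 0)"
        by (rule GDERIV_imp_directional) (use C in \<open>simp add: C1_fun_def\<close>)
      then have lim: "((\<lambda>s. (\<phi> (x - s *\<^sub>R b) - \<phi> x) / s) \<longlongrightarrow> - (D x \<bullet> b)) (at 0)"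
        by (simp add: DERIV_def)
      have "filterlim (\<lambda>n. 1 / real (Suc n)) (at 0) sequentially"
        unfolding filterlim_at using LIMSEQ_inverse_real_of_nat
        by (auto simp: inverse_eq_divide intro!: always_eventually)
      from filterlim_compose[OF lim this]
      show "(\<lambda>n. (\<phi> (x - (1 / Suc n) *\<^sub>R b) - \<phi> x) * Suc n) \<longlonglongrightarrow> - (D x \<bullet> b)"
        by simp
    qed
    show "AE x in lborel. norm (w x * ((\<phi> (x - (1 / Suc n) *\<^sub>R b) - \<phi> x) * Suc n)) \<le> \<bar>w x\<bar> * (B * norm b)" for n
    proof (intro AE_I2)
      fix x
      let ?s = "1 / real (Suc n)"
      have "norm (\<phi> (x - ?s *\<^sub>R b) - \<phi> x) \<le> B * norm (x - ?s *\<^sub>R b - x)"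
      proof (rule differentiable_bound[of UNIV \<phi> "\<lambda>z v. v \<bullet> D z"])
        show "(\<phi> has_derivative (\<lambda>v. v \<bullet> D z)) (at z within UNIV)" for z
          using C by (simp add: C1_fun_def gderiv_def)
        show "onorm (\<lambda>v. v \<bullet> D z) \<le> B" for z
        proof (rule onorm_le)
          fix v
          show "norm (v \<bullet> D z) \<le> B * norm v"
            using Cauchy_Schwarz_ineq2[of v "D z"] B(1)[of z]
            by (smt (verit) mult.commute mult_left_mono norm_ge_zero real_norm_def)
        qed
      qed auto
      then have "\<bar>\<phi> (x - ?s *\<^sub>R b) - \<phi> x\<bar> * Suc n \<le> B * norm b" by (simp add: field_simps)
      then have "\<bar>w x\<bar> * (\<bar>\<phi> (x - ?s *\<^sub>R b) - \<phi> x\<bar> * Suc n) \<le> \<bar>w x\<bar> * (B * norm b)"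
        by (intro mult_left_mono) auto
      then show "norm (w x * ((\<phi> (x - ?s *\<^sub>R b) - \<phi> x) * Suc n)) \<le> \<bar>w x\<bar> * (B * norm b)"
        by (simp add: abs_mult)
    qed
  qed
  moreover have "integral\<^sup>L lborel (\<lambda>x. w x * (- (D x \<bullet> b))) = - integral\<^sup>L (lebesgue_on \<Omega>) (\<lambda>x. w x * (D x \<bullet> b))"
    using lebesgue_on_integral_support[OF \<Omega>m, of "\<lambda>x. w x * (D x \<bullet> b)"] w cD
    by (simp add: borel_measurable_continuous_onI continuous_intros)
  ultimately show ?thesis unfolding eq by simp
qed

text \<open>The derivative is a weak limit of difference quotients, which are bounded by K. Near
  minimizers from \<open>decreasing_convex_sets_AE_limit\<close> converge almost everywhere, so the
  bound and the tested identities pass to the limit by dominated convergence.\<close>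

lemma lipschitz_weak_partial_derivative:
  fixes w :: "'a::euclidean_space \<Rightarrow> real"
  assumes \<Omega>: "open \<Omega>" "bounded \<Omega>"
    and w: "\<And>x. x \<notin> \<Omega> \<Longrightarrow> w x = 0" and lip: "\<And>x y. \<bar>w x - w y\<bar> \<le> K * norm (x - y)"
    and b: "b \<in> Basis"
  shows "\<exists>g. g \<in> borel_measurable (lebesgue_on \<Omega>) \<and> (AE x in lebesgue_on \<Omega>. \<bar>g x\<bar> \<le> K) \<and>
    (\<forall>\<phi> D. C1_test \<Omega> \<phi> D \<longrightarrow> integral\<^sup>L (lebesgue_on \<Omega>) (\<lambda>x. w x * (D x \<bullet> b))
       = - integral\<^sup>L (lebesgue_on \<Omega>) (\<lambda>x. \<phi> x * g x))"
proof -
  let ?I = "integral\<^sup>L (lebesgue_on \<Omega>)"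
  have \<Omega>m: "\<Omega> \<in> lmeasurable" using \<Omega> by (simp add: lmeasurable_open)
  have fin: "finite_measure (lebesgue_on \<Omega>)" by (rule finite_measure_lebesgue_on[OF \<Omega>m])
  have K0: "K \<ge> 0"
    using lip[of b 0] b by simp
  have cw: "continuous_on UNIV w"
  proof (rule continuous_onI)
    fix x y :: 'a and e :: real assume "e > 0"
    show "\<exists>d>0. \<forall>x'\<in>UNIV. dist x' x < d \<longrightarrow> dist (w x') (w x) \<le> e" for x
    proof (intro exI[of _ "e / (K + 1)"] conjI ballI impI)
      show "0 < e / (K + 1)" using \<open>e > 0\<close> K0 by simp
      fix x' assume d: "dist x' x < e / (K + 1)"
      have "K * norm (x' - x) \<le> K * (e / (K + 1))" using d K0 by (intro mult_left_mono) (auto simp: dist_norm)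
      also have "\<dots> \<le> e" using K0 \<open>e > 0\<close> by (simp add: field_simps)
      finally show "dist (w x') (w x) \<le> e" using lip[of x' x] by (simp add: dist_real_def)
    qed
  qed
  define q where "q n x = (w (x + (1 / Suc n) *\<^sub>R b) - w x) * Suc n" for n :: nat and x
  define L where "L D = ?I (\<lambda>x. w x * (D x \<bullet> b))" for D
  \<comment> \<open>This stands in for the closed convex hull of the quotients from index k on: any
    error bound e that all of them satisfy in a test against \<phi> is also satisfied by the members
    of \<open>S k\<close>. Phrased by inequalities, it is visibly decreasing in k and stable under
    midpoints.\<close>
  define S where "S k = {f \<in> borel_measurable (lebesgue_on \<Omega>). (\<forall>x\<in>\<Omega>. \<bar>f x\<bar> \<le> K) \<and>
      (\<forall>\<phi> D e. C1_test \<Omega> \<phi> D \<longrightarrow> (\<forall>n\<ge>k. \<bar>?I (\<lambda>x. q n x * \<phi> x) + L D\<bar> \<le> e) \<longrightarrow> \<bar>?I (\<lambda>x. f x * \<phi> x) + L D\<bar> \<le> e)}" for k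
  have cw': "continuous_on UNIV (\<lambda>x. w (x + s *\<^sub>R b))" for s
    by (intro continuous_on_compose2[OF cw] continuous_intros) auto
  have qS: "q k \<in> S k" for k
  proof -
    have "q k \<in> borel_measurable (lebesgue_on \<Omega>)"
      unfolding q_def[abs_def] by (intro continuous_on_UNIV_measurable_lebesgue_on continuous_intros cw cw')
    moreover have "\<bar>q k x\<bar> \<le> K" for x
    proof -
      have "\<bar>w (x + (1 / Suc k) *\<^sub>R b) - w x\<bar> \<le> K * (1 / Suc k)"
        using lip[of "x + (1 / Suc k) *\<^sub>R b" x] b by simp
      then have "\<bar>w (x + (1 / Suc k) *\<^sub>R b) - w x\<bar> * Suc k \<le> K * (1 / Suc k) * Suc k"
        by (intro mult_right_mono) auto
      then show ?thesis by (simp add: q_def abs_mult del: of_nat_Suc)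
    qed
    ultimately show ?thesis by (auto simp: S_def)
  qed
  have iS: "integrable (lebesgue_on \<Omega>) (\<lambda>x. f x * \<phi> x)" if "f \<in> S k" "C1_test \<Omega> \<phi> D" for f k \<phi> D
  proof -
    have "f \<in> Lspace \<Omega> 2" using that(1) by (intro LspaceI_bounded[of _ _ K] \<Omega>m) (auto simp: S_def)
    then show ?thesis by (rule Lspace2_integrable_mult[OF _ C1_test_Lspace[OF that(2) \<Omega>m]])
  qed
  obtain h where h: "\<And>k. h k \<in> S k" "AE x in lebesgue_on \<Omega>. convergent (\<lambda>k. h k x)"
  proof (rule decreasing_convex_sets_AE_limit[OF fin, of S K])
    show "S k \<noteq> {}" for k using qS by blast
    show "S m \<subseteq> S k" if "k \<le> m" for k m
    proof
      fix f assume f: "f \<in> S m"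
      show "f \<in> S k" unfolding S_def
      proof (intro CollectI conjI allI impI)
        show "f \<in> borel_measurable (lebesgue_on \<Omega>)" "\<forall>x\<in>\<Omega>. \<bar>f x\<bar> \<le> K" using f by (auto simp: S_def)
        fix \<phi> D e assume "C1_test \<Omega> \<phi> D" "\<forall>n\<ge>k. \<bar>?I (\<lambda>x. q n x * \<phi> x) + L D\<bar> \<le> e"
        moreover have "\<forall>n\<ge>m. \<bar>?I (\<lambda>x. q n x * \<phi> x) + L D\<bar> \<le> e" using calculation(2) that by auto
        ultimately show "\<bar>?I (\<lambda>x. f x * \<phi> x) + L D\<bar> \<le> e" using f unfolding S_def by blast
      qed
    qed
    show "(\<lambda>x. (f x + g x) / 2) \<in> S k" if fg: "f \<in> S k" "g \<in> S k" for k f g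
      unfolding S_def
    proof (intro CollectI conjI allI impI ballI)
      show "(\<lambda>x. (f x + g x) / 2) \<in> borel_measurable (lebesgue_on \<Omega>)"
        using fg unfolding S_def by (intro borel_measurable_divide borel_measurable_add) auto
      fix x assume "x \<in> \<Omega>"
      then have "\<bar>f x\<bar> \<le> K" "\<bar>g x\<bar> \<le> K" using fg by (auto simp: S_def)
      then show "\<bar>(f x + g x) / 2\<bar> \<le> K" by auto
    next
      fix \<phi> D e assume t: "C1_test \<Omega> \<phi> D" "\<forall>n\<ge>k. \<bar>?I (\<lambda>x. q n x * \<phi> x) + L D\<bar> \<le> e"
      have "\<bar>?I (\<lambda>x. f x * \<phi> x) + L D\<bar> \<le> e" "\<bar>?I (\<lambda>x. g x * \<phi> x) + L D\<bar> \<le> e"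
        using fg t unfolding S_def by blast+
      moreover have "?I (\<lambda>x. (f x + g x) / 2 * \<phi> x) = (?I (\<lambda>x. f x * \<phi> x) + ?I (\<lambda>x. g x * \<phi> x)) / 2"
        using iS[OF fg(1) t(1)] iS[OF fg(2) t(1)] by (simp add: add_divide_distrib distrib_right)
      ultimately show "\<bar>?I (\<lambda>x. (f x + g x) / 2 * \<phi> x) + L D\<bar> \<le> e" by (simp add: field_simps)
    qed
    show "f \<in> borel_measurable (lebesgue_on \<Omega>)" if "f \<in> S k" for k f using that by (simp add: S_def)
    show "\<bar>f x\<bar> \<le> K" if "f \<in> S k" "x \<in> space (lebesgue_on \<Omega>)" for k f x using that by (simp add: S_def)
  qed (use that in blast)
  have hm: "h k \<in> borel_measurable (lebesgue_on \<Omega>)" "\<And>x. x \<in> \<Omega> \<Longrightarrow> \<bar>h k x\<bar> \<le> K" for k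
    using h(1)[of k] by (auto simp: S_def)
  define g where "g x = lim (\<lambda>k. h k x)" for x
  have gm: "g \<in> borel_measurable (lebesgue_on \<Omega>)"
    unfolding g_def[abs_def] by (rule borel_measurable_lim_metric) (rule hm)
  have hg: "AE x in lebesgue_on \<Omega>. (\<lambda>k. h k x) \<longlonglongrightarrow> g x"
    using h(2) by eventually_elim (simp add: convergent_LIMSEQ_iff g_def)
  have gK: "AE x in lebesgue_on \<Omega>. \<bar>g x\<bar> \<le> K"
    using hg AE_space
  proof eventually_elim
    case (elim x)
    then have "(\<lambda>k. \<bar>h k x\<bar>) \<longlonglongrightarrow> \<bar>g x\<bar>" by (intro tendsto_rabs)
    then show ?case by (rule LIMSEQ_le_const2) (use hm(2) elim in auto)
  qed
  have "L D = - ?I (\<lambda>x. \<phi> x * g x)" if t: "C1_test \<Omega> \<phi> D" for \<phi> D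
  proof -
    obtain B where B: "\<And>x. \<bar>\<phi> x\<bar> \<le> B" by (rule C1_test_bounded[OF t]) blast
    have c\<phi>: "continuous_on UNIV \<phi>"
      using t by (intro C1_fun_continuous) (auto simp: C1_test_def C1_fun_def)
    have m\<phi>: "\<phi> \<in> borel_measurable (lebesgue_on \<Omega>)" by (rule continuous_on_UNIV_measurable_lebesgue_on[OF c\<phi>])
    interpret finite_measure "lebesgue_on \<Omega>" by (rule fin)
    have "(\<lambda>k. ?I (\<lambda>x. h k x * \<phi> x)) \<longlonglongrightarrow> ?I (\<lambda>x. g x * \<phi> x)"
    proof (rule integral_dominated_convergence[where w="\<lambda>_. K * B"])
      show "(\<lambda>x. g x * \<phi> x) \<in> borel_measurable (lebesgue_on \<Omega>)" by (intro borel_measurable_times gm m\<phi>)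
      show "(\<lambda>x. h k x * \<phi> x) \<in> borel_measurable (lebesgue_on \<Omega>)" for k by (intro borel_measurable_times hm m\<phi>)
      show "AE x in lebesgue_on \<Omega>. (\<lambda>k. h k x * \<phi> x) \<longlonglongrightarrow> g x * \<phi> x"
        using hg by eventually_elim (intro tendsto_mult tendsto_const)
      show "AE x in lebesgue_on \<Omega>. norm (h k x * \<phi> x) \<le> K * B" for k
        using hm(2) B K0 by (intro AE_I2) (auto simp: abs_mult intro!: mult_mono)
    qed simp
    moreover have "(\<lambda>k. ?I (\<lambda>x. h k x * \<phi> x)) \<longlonglongrightarrow> - L D"
    proof (rule LIMSEQ_I)
      fix e :: real assume "e > 0"
      have "(\<lambda>n. ?I (\<lambda>x. q n x * \<phi> x)) \<longlonglongrightarrow> - L D"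
        unfolding q_def L_def by (rule difference_quotient_weak_limit[OF \<Omega> cw w t])
      from LIMSEQ_D[OF this half_gt_zero[OF \<open>e > 0\<close>]]
      obtain N where N: "\<And>n. n \<ge> N \<Longrightarrow> norm (?I (\<lambda>x. q n x * \<phi> x) - - L D) < e / 2" by blast
      have "norm (?I (\<lambda>x. h n x * \<phi> x) - - L D) < e" if "n \<ge> N" for n
      proof -
        have "\<bar>?I (\<lambda>x. q m x * \<phi> x) + L D\<bar> \<le> e / 2" if "m \<ge> n" for m
          using N[of m] \<open>n \<ge> N\<close> that by simp
        then have "\<bar>?I (\<lambda>x. h n x * \<phi> x) + L D\<bar> \<le> e / 2" using h(1)[of n] t unfolding S_def by blast
        then show ?thesis using \<open>e > 0\<close> by simp
      qed
      then show "\<exists>N. \<forall>n\<ge>N. norm (?I (\<lambda>x. h n x * \<phi> x) - - L D) < e" by blast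
    qed
    ultimately have "?I (\<lambda>x. g x * \<phi> x) = - L D" by (rule LIMSEQ_unique)
    then show ?thesis by (simp add: mult.commute)
  qed
  then show ?thesis using gm gK unfolding L_def by blast
qed

lemma lipschitz_W10_infinity:
  fixes w :: "'a::euclidean_space \<Rightarrow> real"
  assumes \<Omega>: "open \<Omega>" "bounded \<Omega>"
    and w: "\<And>x. x \<notin> \<Omega> \<Longrightarrow> w x = 0" and lip: "\<And>x y. \<bar>w x - w y\<bar> \<le> K * norm (x - y)"
    and cw: "continuous_on UNIV w"
  shows "w \<in> W10 \<Omega> \<infinity>"
proof -
  have \<Omega>m: "\<Omega> \<in> lmeasurable" using \<Omega> by (simp add: lmeasurable_open)
  interpret finite_measure "lebesgue_on \<Omega>" by (rule finite_measure_lebesgue_on[OF \<Omega>m])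
  have "\<exists>g. \<forall>b\<in>Basis. g b \<in> borel_measurable (lebesgue_on \<Omega>) \<and> (AE x in lebesgue_on \<Omega>. \<bar>g b x\<bar> \<le> K) \<and>
    (\<forall>\<phi> D. C1_test \<Omega> \<phi> D \<longrightarrow> integral\<^sup>L (lebesgue_on \<Omega>) (\<lambda>x. w x * (D x \<bullet> b))
       = - integral\<^sup>L (lebesgue_on \<Omega>) (\<lambda>x. \<phi> x * g b x))"
    by (rule bchoice, rule ballI) (rule lipschitz_weak_partial_derivative[OF \<Omega> w lip])
  then obtain g where gm: "\<And>b. b \<in> Basis \<Longrightarrow> g b \<in> borel_measurable (lebesgue_on \<Omega>)"
    and gK: "\<And>b. b \<in> Basis \<Longrightarrow> AE x in lebesgue_on \<Omega>. \<bar>g b x\<bar> \<le> K"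
    and g: "\<And>b \<phi> D. b \<in> Basis \<Longrightarrow> C1_test \<Omega> \<phi> D \<Longrightarrow> integral\<^sup>L (lebesgue_on \<Omega>) (\<lambda>x. w x * (D x \<bullet> b))
       = - integral\<^sup>L (lebesgue_on \<Omega>) (\<lambda>x. \<phi> x * g b x)" by blast
  define G where "G x = (\<Sum>b\<in>Basis. g b x *\<^sub>R b)" for x
  have Gb: "G x \<bullet> b = g b x" if "b \<in> Basis" for x b using that by (simp add: G_def inner_sum_left inner_Basis if_distrib cong: if_cong)
  have Gm: "G \<in> borel_measurable (lebesgue_on \<Omega>)"
    unfolding G_def[abs_def] by (intro borel_measurable_sum borel_measurable_scaleR gm) auto
  have "AE x in lebesgue_on \<Omega>. \<forall>b\<in>Basis. \<bar>g b x\<bar> \<le> K"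
    by (rule AE_finite_allI) (auto intro: gK)
  then have GK: "AE x in lebesgue_on \<Omega>. norm (G x) \<le> DIM('a) * K"
  proof eventually_elim
    case (elim x)
    have "norm (G x) \<le> (\<Sum>b\<in>Basis. \<bar>G x \<bullet> b\<bar>)" by (rule norm_le_l1)
    also have "\<dots> \<le> (\<Sum>b\<in>(Basis::'a set). K)" by (rule sum_mono) (use elim Gb in auto)
    finally show ?case by simp
  qed
  have GL: "G \<in> Lspace \<Omega> \<infinity>" using Gm GK by (auto simp: Lspace_def)
  have wg: "weak_gradient \<Omega> w G" unfolding weak_gradient_def
  proof (intro allI impI)
    fix \<phi> D assume t: "C1_test \<Omega> \<phi> D"
    obtain B where B: "\<And>x. \<bar>\<phi> x\<bar> \<le> B" by (rule C1_test_bounded[OF t]) blast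
    have C: "C1_fun \<phi> D" using t by (simp add: C1_test_def C1_fun_def)
    have cD: "continuous_on UNIV D" using C by (simp add: C1_fun_def)
    have m\<phi>: "\<phi> \<in> borel_measurable (lebesgue_on \<Omega>)"
      by (rule continuous_on_UNIV_measurable_lebesgue_on[OF C1_fun_continuous[OF C]])
    have cwD: "continuous_on UNIV (\<lambda>x. w x *\<^sub>R D x)" by (intro continuous_intros cw cD)
    obtain B' where B': "\<And>x. x \<in> \<Omega> \<Longrightarrow> norm (w x *\<^sub>R D x) \<le> B'"
      by (rule continuous_on_UNIV_bounded[OF cwD \<Omega>(2)]) blast
    have i1: "integrable (lebesgue_on \<Omega>) (\<lambda>x. w x *\<^sub>R D x)"
    proof (rule integrable_const_bound)
      show "AE x in lebesgue_on \<Omega>. norm (w x *\<^sub>R D x) \<le> B'" by (intro AE_I2 B') simp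
      show "(\<lambda>x. w x *\<^sub>R D x) \<in> borel_measurable (lebesgue_on \<Omega>)"
        by (rule continuous_on_UNIV_measurable_lebesgue_on[OF cwD])
    qed
    have i2: "integrable (lebesgue_on \<Omega>) (\<lambda>x. \<phi> x *\<^sub>R G x)"
    proof (rule integrable_bounded_mult[OF _ m\<phi> B])
      show "integrable (lebesgue_on \<Omega>) G" by (rule integrable_const_bound[OF GK Gm])
    qed
    show "integral\<^sup>L (lebesgue_on \<Omega>) (\<lambda>x. w x *\<^sub>R D x) = - integral\<^sup>L (lebesgue_on \<Omega>) (\<lambda>x. \<phi> x *\<^sub>R G x)"
    proof (rule euclidean_eqI)
      fix b :: 'a assume b: "b \<in> Basis"
      show "integral\<^sup>L (lebesgue_on \<Omega>) (\<lambda>x. w x *\<^sub>R D x) \<bullet> b = - integral\<^sup>L (lebesgue_on \<Omega>) (\<lambda>x. \<phi> x *\<^sub>R G x) \<bullet> b"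
        using integral_inner_left[OF i1, of b] integral_inner_left[OF i2, of b] g[OF b t] Gb[OF b] by simp
    qed
  qed
  obtain B where B: "\<And>x. x \<in> \<Omega> \<Longrightarrow> norm (w x) \<le> B" by (rule continuous_on_UNIV_bounded[OF cw \<Omega>(2)]) blast
  have "w \<in> Lspace \<Omega> \<infinity>"
    by (rule LspaceI_bounded[OF continuous_on_UNIV_measurable_lebesgue_on[OF cw] B \<Omega>m])
  moreover have "w x = 0" if "x \<in> frontier \<Omega>" for x
    using that \<Omega>(1) by (intro w) (auto simp: frontier_def interior_open)
  moreover have "continuous_on (closure \<Omega>) w" by (rule continuous_on_subset[OF cw subset_UNIV])
  ultimately show ?thesis using GL wg by (auto simp: W10_def W1_def)
qed

subsection \<open>The operator \<open>M\<^sub>\<epsilon>\<close>\<close>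

text \<open>With a clamped slope in place of the three cases, continuity and the Lipschitz
  dependence on \<eta> can be read off.\<close>

lemma M_op_eq:
  assumes "\<epsilon> > 0"
  shows "M_op \<Omega> k0 \<epsilon> w0 \<eta> x = max k0 (norm (grad \<Omega> w0 x)) +
    (k0 - max k0 (norm (grad \<Omega> w0 x))) * max 0 (min 1 ((\<eta> x - w0 x) / \<epsilon>))"
proof -
  consider "\<eta> x \<ge> w0 x + \<epsilon>" | "\<eta> x < w0 x + \<epsilon>" "\<eta> x \<ge> w0 x" | "\<eta> x < w0 x" using assms by linarith
  then show ?thesis
  proof cases
    case 1
    then have "(\<eta> x - w0 x) / \<epsilon> \<ge> 1" using assms by (simp add: field_simps)
    then show ?thesis using 1 by (simp add: M_op_def Let_def)
  next
    case 2
    then have "(\<eta> x - w0 x) / \<epsilon> \<le> 1" "0 \<le> (\<eta> x - w0 x) / \<epsilon>" using assms by (simp_all add: field_simps)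
    then show ?thesis using 2 by (simp add: M_op_def Let_def)
  next
    case 3
    then have "(\<eta> x - w0 x) / \<epsilon> \<le> 0" using assms by (simp add: field_simps)
    then show ?thesis using 3 assms by (simp add: M_op_def Let_def)
  qed
qed

text \<open>Collects what the limit passage uses of the operator. The Lipschitz constant is K /
  \<epsilon> because the value moves by at most K while \<eta> crosses a range of length
  \<epsilon>.\<close>

lemma M_op_props:
  fixes \<Omega> :: "'a::euclidean_space set"
  assumes "bounded \<Omega>" "w0 \<in> C1_closure \<Omega>" "k0 > 0" "\<epsilon> > 0"
  obtains K where "K > 0"
    "\<And>\<eta> x. x \<in> closure \<Omega> \<Longrightarrow> k0 \<le> M_op \<Omega> k0 \<epsilon> w0 \<eta> x"
    "\<And>\<eta> x. x \<in> closure \<Omega> \<Longrightarrow> M_op \<Omega> k0 \<epsilon> w0 \<eta> x \<le> K"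
    "\<And>\<eta> \<zeta> x. x \<in> closure \<Omega> \<Longrightarrow>
       \<bar>M_op \<Omega> k0 \<epsilon> w0 \<eta> x - M_op \<Omega> k0 \<epsilon> w0 \<zeta> x\<bar> \<le> K / \<epsilon> * \<bar>\<eta> x - \<zeta> x\<bar>"
    "\<And>\<eta>. continuous_on (closure \<Omega>) \<eta> \<Longrightarrow> continuous_on (closure \<Omega>) (M_op \<Omega> k0 \<epsilon> w0 \<eta>)"
proof -
  define k1 where "k1 x = max k0 (norm (grad \<Omega> w0 x))" for x
  have M: "M_op \<Omega> k0 \<epsilon> w0 \<eta> x = k1 x + (k0 - k1 x) * max 0 (min 1 ((\<eta> x - w0 x) / \<epsilon>))" for \<eta> x
    using M_op_eq[OF assms(4)] by (simp add: k1_def)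
  obtain g where "closure_gradient \<Omega> w0 g" using assms(2) by (auto simp: C1_closure_def)
  then have "closure_gradient \<Omega> w0 (grad \<Omega> w0)"
    unfolding grad_def by (rule someI[of "closure_gradient \<Omega> w0"])
  then have "continuous_on (closure \<Omega>) (grad \<Omega> w0)" by (simp add: closure_gradient_def)
  then have c1: "continuous_on (closure \<Omega>) k1" unfolding k1_def[abs_def] by (intro continuous_intros)
  have cw0: "continuous_on (closure \<Omega>) w0" using assms(2) by (simp add: C1_closure_def)
  have "compact (k1 ` closure \<Omega>)" using c1 assms(1) by (intro compact_continuous_image) auto
  then have "bounded (k1 ` closure \<Omega>)" by (rule compact_imp_bounded)
  then obtain K where K: "\<forall>y\<in>k1 ` closure \<Omega>. norm y \<le> K" unfolding bounded_iff by blast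
  have k1: "k0 \<le> k1 x" for x by (simp add: k1_def)
  have k1K: "k1 x \<le> max k0 K" if "x \<in> closure \<Omega>" for x using K that by fastforce
  show thesis
  proof (rule that[of "max k0 K"])
    show "max k0 K > 0" using assms(3) by simp
    fix \<eta> \<zeta> :: "'a \<Rightarrow> real" and x
    assume x: "x \<in> closure \<Omega>"
    let ?c = "\<lambda>\<eta>. max 0 (min 1 ((\<eta> x - w0 x) / \<epsilon>))"
    have c: "0 \<le> ?c \<eta>" "?c \<eta> \<le> 1" for \<eta> by auto
    have "(k1 x - k0) * ?c \<eta> \<le> (k1 x - k0)" "0 \<le> (k1 x - k0) * ?c \<eta>" 
      using k1[of x] c[of \<eta>] by (auto intro!: mult_left_le)
    then show "k0 \<le> M_op \<Omega> k0 \<epsilon> w0 \<eta> x" "M_op \<Omega> k0 \<epsilon> w0 \<eta> x \<le> max k0 K"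
      unfolding M using k1K[OF x] by (auto simp: algebra_simps)
    have "\<bar>?c \<eta> - ?c \<zeta>\<bar> \<le> \<bar>(\<eta> x - w0 x) / \<epsilon> - (\<zeta> x - w0 x) / \<epsilon>\<bar>" by (auto simp: max_def min_def)
    also have "\<dots> = \<bar>\<eta> x - \<zeta> x\<bar> / \<epsilon>" using assms(4) by (simp add: diff_divide_distrib[symmetric])
    finally have 1: "\<bar>?c \<eta> - ?c \<zeta>\<bar> \<le> \<bar>\<eta> x - \<zeta> x\<bar> / \<epsilon>" .
    have "\<bar>M_op \<Omega> k0 \<epsilon> w0 \<eta> x - M_op \<Omega> k0 \<epsilon> w0 \<zeta> x\<bar> = \<bar>k0 - k1 x\<bar> * \<bar>?c \<eta> - ?c \<zeta>\<bar>"
      unfolding M by (simp add: abs_mult[symmetric] algebra_simps)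
    also have "\<dots> \<le> max k0 K * (\<bar>\<eta> x - \<zeta> x\<bar> / \<epsilon>)"
      using k1[of x] k1K[OF x] assms(3) 1 by (intro mult_mono) auto
    finally show "\<bar>M_op \<Omega> k0 \<epsilon> w0 \<eta> x - M_op \<Omega> k0 \<epsilon> w0 \<zeta> x\<bar> \<le> max k0 K / \<epsilon> * \<bar>\<eta> x - \<zeta> x\<bar>" by simp
  next
    fix \<eta> :: "'a \<Rightarrow> real" assume "continuous_on (closure \<Omega>) \<eta>"
    then show "continuous_on (closure \<Omega>) (M_op \<Omega> k0 \<epsilon> w0 \<eta>)"
      unfolding M[abs_def] using assms(4) by (intro continuous_intros c1 cw0) auto
  qed
qed

subsection \<open>Estimates for one time step, uniform in \<open>r\<close>\<close>

text \<open>The tangent at a to the concave function t powr \<theta>, enlarged by dropping the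
  summand - \<theta>. The point a stays free so that it can be adapted to the width of the
  kernel.\<close>

lemma powr_le_affine:
  fixes t a \<theta> :: real
  assumes "0 \<le> t" "0 < a" "0 \<le> \<theta>" "\<theta> \<le> 1"
  shows "t powr \<theta> \<le> a powr \<theta> * (1 + \<theta> * t / a)"
proof (cases "t = 0")
  case False
  then have "(t / a) powr \<theta> * 1 powr (1 - \<theta>) \<le> \<theta> * (t / a) + (1 - \<theta>) * 1"
    using assms by (intro Youngs_inequality_0) auto
  then have "(t / a) powr \<theta> \<le> 1 + \<theta> * t / a" using assms by simp
  then have "a powr \<theta> * (t / a) powr \<theta> \<le> a powr \<theta> * (1 + \<theta> * t / a)" by (intro mult_left_mono) auto
  moreover have "a powr \<theta> * (t / a) powr \<theta> = t powr \<theta>"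
    using assms by (simp add: powr_mult[symmetric])
  ultimately show ?thesis by simp
qed (use assms in simp)

lemma integral_moll_le_1:
  assumes "h > 0" "\<Omega> \<in> sets lebesgue"
  shows "integrable (lebesgue_on \<Omega>) (\<lambda>u::'a::euclidean_space. moll h (u - x))"
    "integral\<^sup>L (lebesgue_on \<Omega>) (\<lambda>u::'a. moll h (u - x)) \<le> 1"
proof -
  have m: "(\<lambda>u. moll h (u - x)) \<in> borel_measurable borel"
    by (intro borel_measurable_continuous_onI continuous_intros)
  have i: "integrable lebesgue (\<lambda>u::'a. moll h (u - x))"
    using integrable_moll_shift(1)[OF assms(1), of x] m by (subst integrable_completion) auto
  have i': "integrable lebesgue (\<lambda>u. indicator \<Omega> u *\<^sub>R moll h (u - x))"
    using integrable_mult_indicator[OF assms(2) i] .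
  show "integrable (lebesgue_on \<Omega>) (\<lambda>u. moll h (u - x))"
    using i' assms(2) by (subst integrable_restrict_space) auto
  have "integral\<^sup>L (lebesgue_on \<Omega>) (\<lambda>u. moll h (u - x)) = integral\<^sup>L lebesgue (\<lambda>u. indicator \<Omega> u *\<^sub>R moll h (u - x))"
    using assms(2) by (subst integral_restrict_space) auto
  also have "\<dots> \<le> integral\<^sup>L lebesgue (\<lambda>u. moll h (u - x))"
    using moll_nonneg[OF assms(1)] by (intro integral_mono i i') (auto simp: indicator_def)
  also have "\<dots> = 1" using integrable_moll_shift(2)[OF assms(1), of x] m by (subst integral_completion) auto
  finally show "integral\<^sup>L (lebesgue_on \<Omega>) (\<lambda>u. moll h (u - x)) \<le> 1" .
qed

text \<open>Young's inequality replaces Hoelder's inequality with exponents close to 1 and \<open>\<infinity>\<close>.\<close>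

lemma flux_potential_bound:
  fixes q :: "'a::euclidean_space \<Rightarrow> 'a"
  assumes r: "r > 1" and \<Omega>: "\<Omega> \<in> sets lebesgue" and h: "h > 0" and a: "a > 0"
    and q: "q \<in> borel_measurable (lebesgue_on \<Omega>)" "integrable (lebesgue_on \<Omega>) (\<lambda>x. norm (q x) powr r)"
      "integral\<^sup>L (lebesgue_on \<Omega>) (\<lambda>x. norm (q x) powr r) \<le> C"
    and M: "M \<in> borel_measurable (lebesgue_on \<Omega>)" "\<And>u. u \<in> \<Omega> \<Longrightarrow> 0 \<le> M u"
      "\<And>u. u \<in> \<Omega> \<Longrightarrow> norm (u - x) < h \<Longrightarrow> M u \<le> m" and m: "m \<ge> 0"
  shows "integral\<^sup>L (lebesgue_on \<Omega>) (\<lambda>u. moll h (u - x) * (M u * norm (q u) powr (r - 1)))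
     \<le> m * a powr ((r - 1) / r) * (1 + (r - 1) / r * C / (a * (h ^ DIM('a) * bump_mass TYPE('a))))"
proof -
  define \<theta> where "\<theta> = (r - 1) / r"
  have \<theta>: "0 \<le> \<theta>" "\<theta> \<le> 1" using r by (auto simp: \<theta>_def)
  define c where "c = 1 / (h ^ DIM('a) * bump_mass TYPE('a))"
  have c: "c > 0" using h bump_mass_pos[where 'a='a] by (simp add: c_def)
  let ?t = "\<lambda>u. norm (q u) powr r"
  let ?R = "\<lambda>u. m * a powr \<theta> * (moll h (u - x) + \<theta> / a * c * ?t u)"
  have iR: "integrable (lebesgue_on \<Omega>) ?R"
    using integral_moll_le_1(1)[OF h \<Omega>, of x] q(2) by auto
  have pt: "moll h (u - x) * (M u * norm (q u) powr (r - 1)) \<le> ?R u" if u: "u \<in> \<Omega>" for u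
  proof (cases "norm (u - x) < h")
    case True
    \<comment> \<open>The power r - 1 is the power \<theta> of |q|^r, the quantity whose integral is
      bounded by the energy.\<close>
    have t: "norm (q u) powr (r - 1) = ?t u powr \<theta>" using r by (simp add: powr_powr \<theta>_def)
    have "M u * norm (q u) powr (r - 1) \<le> m * (a powr \<theta> * (1 + \<theta> * ?t u / a))"
      unfolding t using M(2)[OF u] M(3)[OF u True] a \<theta> by (intro mult_mono powr_le_affine m) auto
    then have "moll h (u - x) * (M u * norm (q u) powr (r - 1))
       \<le> moll h (u - x) * (m * (a powr \<theta> * (1 + \<theta> * ?t u / a)))"
      by (rule mult_left_mono) (rule moll_nonneg[OF h])
    also have "\<dots> = m * a powr \<theta> * (moll h (u - x) + \<theta> / a * ?t u * moll h (u - x))" by (simp add: algebra_simps)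
    also have "\<dots> \<le> m * a powr \<theta> * (moll h (u - x) + \<theta> / a * ?t u * c)"
      using moll_le[OF h, of "u - x"] m \<theta> a unfolding c_def[symmetric]
      by (intro mult_left_mono add_left_mono) auto
    finally show ?thesis by (simp add: mult_ac)
  next
    case False
    then have "moll h (u - x) = 0" using moll_support(1)[OF h, of "u - x"] by simp
    then show ?thesis using m \<theta> a c by simp
  qed
  have "integral\<^sup>L (lebesgue_on \<Omega>) (\<lambda>u. moll h (u - x) * (M u * norm (q u) powr (r - 1))) \<le> integral\<^sup>L (lebesgue_on \<Omega>) ?R"
  proof (rule integral_mono[OF _ iR])
    show "integrable (lebesgue_on \<Omega>) (\<lambda>u. moll h (u - x) * (M u * norm (q u) powr (r - 1)))"
    proof (rule Bochner_Integration.integrable_bound[OF iR])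
      show "(\<lambda>u. moll h (u - x) * (M u * norm (q u) powr (r - 1))) \<in> borel_measurable (lebesgue_on \<Omega>)"
        using q(1) M(1) by (intro borel_measurable_times measurable_moll) auto
      show "AE u in lebesgue_on \<Omega>. norm (moll h (u - x) * (M u * norm (q u) powr (r - 1))) \<le> norm (?R u)"
      proof (intro AE_I2)
        fix u assume "u \<in> space (lebesgue_on \<Omega>)"
        then have u: "u \<in> \<Omega>" by simp
        have "0 \<le> moll h (u - x) * (M u * norm (q u) powr (r - 1))"
          using moll_nonneg[OF h, of "u - x"] M(2)[OF u] by simp
        then show "norm (moll h (u - x) * (M u * norm (q u) powr (r - 1))) \<le> norm (?R u)"
          using pt[OF u] by (smt (verit) real_norm_def)
      qed
    qed
  qed (use pt in simp)
  also have "\<dots> = m * a powr \<theta> * (integral\<^sup>L (lebesgue_on \<Omega>) (\<lambda>u. moll h (u - x)) + \<theta> / a * c * integral\<^sup>L (lebesgue_on \<Omega>) ?t)"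
    using integral_moll_le_1(1)[OF h \<Omega>, of x] q(2) by simp
  also have "\<dots> \<le> m * a powr \<theta> * (1 + \<theta> / a * c * C)"
    using integral_moll_le_1(2)[OF h \<Omega>, of x] q(3) m \<theta> a c
    by (intro mult_left_mono add_mono mult_left_mono) auto
  also have "\<dots> = m * a powr \<theta> * (1 + \<theta> * C / (a * (h ^ DIM('a) * bump_mass TYPE('a))))"
    by (simp add: c_def)
  finally show ?thesis by (simp add: \<theta>_def)
qed

text \<open>One step with predecessor w' and an abstract right-hand side U shared by all r. Of
  \<open>W10\<close> it records continuity and the zero boundary values; the gradient of w is
  recovered from the second equation in \<open>step_zero_ext_gradient\<close>.\<close>

definition step_solution ::
  "'a::euclidean_space set \<Rightarrow> (('a \<Rightarrow> real) \<Rightarrow> 'a \<Rightarrow> real) \<Rightarrow> real \<Rightarrow> ('a \<Rightarrow> real) \<Rightarrow> real \<Rightarrow>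
   ('a \<Rightarrow> real) \<Rightarrow> ('a \<Rightarrow> real) \<Rightarrow> ('a \<Rightarrow> 'a) \<Rightarrow> bool" where
  "step_solution \<Omega> M \<tau> U r w' w q \<longleftrightarrow>
     continuous_on (closure \<Omega>) w' \<and> continuous_on (closure \<Omega>) w \<and> (\<forall>x\<in>frontier \<Omega>. w x = 0) \<and>
     q \<in> Vr \<Omega> r \<and>
     (\<forall>\<eta>. \<eta> \<in> Lspace \<Omega> 2 \<longrightarrow> L2_inner \<Omega> (\<lambda>x. (w x - w' x) / \<tau>) \<eta> + L2_inner \<Omega> (divergence \<Omega> (vdens \<Omega> q)) \<eta>
        = L2_inner \<Omega> U \<eta>) \<and>
     (\<forall>v\<in>Vr \<Omega> r.
        L2_inner \<Omega> (\<lambda>x. (M w x * norm (q x) powr (r - 2)) *\<^sub>R q x) v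
          - L2_inner \<Omega> w (divergence \<Omega> (vdens \<Omega> v)) = 0)"

section \<open>One time step for an abstract weight, bounded, bounded away from 0 and Lipschitz in
  w\<close>

locale nonlinearity =
  fixes \<Omega> :: "'a::euclidean_space set" and M :: "('a \<Rightarrow> real) \<Rightarrow> 'a \<Rightarrow> real" and k0 K L :: real
  assumes \<Omega>: "open \<Omega>" "bounded \<Omega>"
    and k0: "k0 > 0" and K: "K > 0" and L: "L \<ge> 0"
    and M_ge: "\<And>\<eta> x. x \<in> closure \<Omega> \<Longrightarrow> k0 \<le> M \<eta> x"
    and M_le: "\<And>\<eta> x. x \<in> closure \<Omega> \<Longrightarrow> M \<eta> x \<le> K"
    and M_lip: "\<And>\<eta> \<zeta> x. x \<in> closure \<Omega> \<Longrightarrow> \<bar>M \<eta> x - M \<zeta> x\<bar> \<le> L * \<bar>\<eta> x - \<zeta> x\<bar>"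
    and M_cont: "\<And>\<eta>. continuous_on (closure \<Omega>) \<eta> \<Longrightarrow> continuous_on (closure \<Omega>) (M \<eta>)"
begin

lemma \<Omega>_lmeasurable: "\<Omega> \<in> lmeasurable" and \<Omega>_sets: "\<Omega> \<in> sets lebesgue"
  using \<Omega> by (auto simp: lmeasurable_open borel_open)

lemma finite_measure_\<Omega>: "finite_measure (lebesgue_on \<Omega>)"
  by (rule finite_measure_lebesgue_on[OF \<Omega>_lmeasurable])

lemma in_closure: "x \<in> \<Omega> \<Longrightarrow> x \<in> closure \<Omega>"
  using closure_subset by auto

lemma measurable_closure:
  fixes f :: "'a \<Rightarrow> 'b::euclidean_space"
  assumes "continuous_on (closure \<Omega>) f" 
  shows "f \<in> borel_measurable (lebesgue_on \<Omega>)"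
  by (rule continuous_imp_measurable_on_sets_lebesgue[OF continuous_on_subset[OF assms closure_subset] \<Omega>_sets])

lemma bounded_closure:
  fixes f :: "'a \<Rightarrow> 'b::euclidean_space"
  assumes "continuous_on (closure \<Omega>) f" 
  obtains B where "\<And>x. x \<in> closure \<Omega> \<Longrightarrow> norm (f x) \<le> B"
proof -
  have "compact (f ` closure \<Omega>)" using assms \<Omega> by (intro compact_continuous_image) auto
  then have "bounded (f ` closure \<Omega>)" by (rule compact_imp_bounded)
  then obtain B where "\<forall>y\<in>f ` closure \<Omega>. norm y \<le> B" unfolding bounded_iff by blast
  then show thesis by (intro that[of B]) auto
qed

lemma Lspace_closure:
  fixes f :: "'a \<Rightarrow> 'b::euclidean_space"
  assumes "continuous_on (closure \<Omega>) f" 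
  shows "f \<in> Lspace \<Omega> s"
proof -
  obtain B where "\<And>x. x \<in> closure \<Omega> \<Longrightarrow> norm (f x) \<le> B" by (rule bounded_closure[OF assms]) blast
  then show ?thesis using in_closure
    by (intro LspaceI_bounded[OF measurable_closure[OF assms] _ \<Omega>_lmeasurable]) auto
qed

lemma Vr_integrable:
  assumes "q \<in> Vr \<Omega> r" "r > 1"
  shows "q \<in> borel_measurable (lebesgue_on \<Omega>)" "integrable (lebesgue_on \<Omega>) (\<lambda>x. norm (q x) powr r)"
    "integrable (lebesgue_on \<Omega>) q"
proof -
  show m: "q \<in> borel_measurable (lebesgue_on \<Omega>)" and i: "integrable (lebesgue_on \<Omega>) (\<lambda>x. norm (q x) powr r)"
    using assms by (auto simp: Vr_def Lspace_def)
  interpret finite_measure "lebesgue_on \<Omega>" by (rule finite_measure_\<Omega>)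
  show "integrable (lebesgue_on \<Omega>) q"
  proof (rule Bochner_Integration.integrable_bound[OF _ m])
    show "integrable (lebesgue_on \<Omega>) (\<lambda>x. 1 + norm (q x) powr r)" using i by auto
    show "AE x in lebesgue_on \<Omega>. norm (q x) \<le> norm (1 + norm (q x) powr r)"
    proof (intro AE_I2)
      fix x
      have "norm (q x) \<le> 1 + norm (q x) powr r"
      proof (cases "norm (q x) \<le> 1")
        case False
        then have "norm (q x) powr 1 \<le> norm (q x) powr r" using assms(2) by (intro powr_mono) auto
        then show ?thesis using False by simp
      qed (simp add: add_increasing2)
      then show "norm (q x) \<le> norm (1 + norm (q x) powr r)" by simp
    qed
  qed
qed

text \<open>At z = 0 both sides are 0, the right one by the default
  \<open>0 powr a = 0\<close>.\<close>

lemma norm_flux: "norm ((- (m * norm (z::'a) powr (r - 2))) *\<^sub>R z) = \<bar>m\<bar> * norm z powr (r - 1)"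
proof (cases "z = 0")
  case False
  have "norm z powr (r - 2) * norm z = norm z powr (r - 2) * norm z powr 1" using False by simp
  also have "\<dots> = norm z powr (r - 1)" by (simp only: powr_add[symmetric]) simp
  finally show ?thesis by (simp add: abs_mult mult.assoc)
qed simp

lemma step_zero_ext_gradient:
  assumes s: "step_solution \<Omega> M \<tau> U r w' w q" and r: "r > 1"
  shows "zero_ext_gradient \<Omega> (zext \<Omega> w) (\<lambda>x. (- (M w x * norm (q x) powr (r - 2))) *\<^sub>R q x)"
    (is "zero_ext_gradient _ _ ?G")
proof -
  have w: "continuous_on (closure \<Omega>) w" "\<And>x. x \<in> frontier \<Omega> \<Longrightarrow> w x = 0" and qV: "q \<in> Vr \<Omega> r"
    and eq: "\<And>v. v \<in> Vr \<Omega> r \<Longrightarrow> L2_inner \<Omega> (\<lambda>x. (M w x * norm (q x) powr (r - 2)) *\<^sub>R q x) v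
          = L2_inner \<Omega> w (divergence \<Omega> (vdens \<Omega> v))"
    using s by (auto simp: step_solution_def)
  note q = Vr_integrable[OF qV r]
  have Mm: "M w \<in> borel_measurable (lebesgue_on \<Omega>)" by (rule measurable_closure[OF M_cont[OF w(1)]])
  interpret finite_measure "lebesgue_on \<Omega>" by (rule finite_measure_\<Omega>)
  have iG: "integrable (lebesgue_on \<Omega>) ?G"
  proof (rule Bochner_Integration.integrable_bound)
    show "integrable (lebesgue_on \<Omega>) (\<lambda>x. K * (1 + norm (q x) powr r))" using q(2) by auto
    show "?G \<in> borel_measurable (lebesgue_on \<Omega>)" using q(1) Mm
      by (intro borel_measurable_scaleR borel_measurable_uminus borel_measurable_times powr_real_measurable borel_measurable_norm) auto
    show "AE x in lebesgue_on \<Omega>. norm (?G x) \<le> norm (K * (1 + norm (q x) powr r))"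
    proof (intro AE_I2)
      fix x assume "x \<in> space (lebesgue_on \<Omega>)"
      then have x: "x \<in> closure \<Omega>" using in_closure by simp
      have "norm (q x) powr (r - 1) \<le> 1 + norm (q x) powr r"
      proof (cases "norm (q x) \<le> 1")
        case True
        then have "norm (q x) powr (r - 1) \<le> 1" using r by (simp add: powr_le1)
        then show ?thesis by (simp add: add_increasing2)
      next
        case False
        then have "norm (q x) powr (r - 1) \<le> norm (q x) powr r" using r by (intro powr_mono) auto
        then show ?thesis by simp
      qed
      then have "\<bar>M w x\<bar> * norm (q x) powr (r - 1) \<le> K * (1 + norm (q x) powr r)"
        using M_ge[OF x, of w] M_le[OF x, of w] k0 by (intro mult_mono) auto
      then show "norm (?G x) \<le> norm (K * (1 + norm (q x) powr r))" unfolding norm_flux using K by simp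
    qed
  qed
  have "integral\<^sup>L (lebesgue_on \<Omega>) (\<lambda>x. zext \<Omega> w x * (D x \<bullet> b)) = - integral\<^sup>L (lebesgue_on \<Omega>) (\<lambda>x. \<phi> x * (?G x \<bullet> b))"
    if C: "C1_fun \<phi> D" and b: "b \<in> Basis" for \<phi> D b
  proof -
    let ?v = "\<lambda>x. \<phi> x *\<^sub>R b"
    have c: "continuous_on UNIV \<phi>" by (rule C1_fun_continuous[OF C])
    have cv: "continuous_on (closure \<Omega>) ?v" by (intro continuous_intros continuous_on_subset[OF c]) auto
    note d = C1_fun_is_divergence[OF \<Omega> C b]
    have "?v \<in> Vr \<Omega> r" unfolding Vr_def using Lspace_closure[OF cv] d by blast
    from eq[OF this] have "L2_inner \<Omega> (\<lambda>x. (M w x * norm (q x) powr (r - 2)) *\<^sub>R q x) ?v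
      = L2_inner \<Omega> (divergence \<Omega> (vdens \<Omega> ?v)) w" by (simp add: L2_inner_commute)
    also have "\<dots> = L2_inner \<Omega> (\<lambda>x. D x \<bullet> b) w" by (rule divergence_eq(2)[OF \<Omega> d Lspace_closure[OF w(1)]])
    also have "\<dots> = integral\<^sup>L (lebesgue_on \<Omega>) (\<lambda>x. zext \<Omega> w x * (D x \<bullet> b))"
      unfolding L2_inner_def by (intro Bochner_Integration.integral_cong refl) (auto simp: zext_def mult.commute)
    also have "L2_inner \<Omega> (\<lambda>x. (M w x * norm (q x) powr (r - 2)) *\<^sub>R q x) ?v
      = - integral\<^sup>L (lebesgue_on \<Omega>) (\<lambda>x. \<phi> x * (?G x \<bullet> b))"
      unfolding L2_inner_def by (simp add: mult_ac)
    finally show ?thesis by simp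
  qed
  then show ?thesis
    unfolding zero_ext_gradient_def using iG continuous_on_zext[OF \<Omega>(1) w] by (auto simp: zext_def)
qed

text \<open>The second equation tested with v = q, where |q|^(r-2) q \<bullet> q = |q|^r.\<close>

lemma step_energy:
  assumes s: "step_solution \<Omega> M \<tau> U r w' w q" and r: "r > 1"
  shows "integrable (lebesgue_on \<Omega>) (\<lambda>x. M w x * norm (q x) powr r)"
    "integral\<^sup>L (lebesgue_on \<Omega>) (\<lambda>x. M w x * norm (q x) powr r) = L2_inner \<Omega> (divergence \<Omega> (vdens \<Omega> q)) w"
proof -
  have w: "continuous_on (closure \<Omega>) w" and qV: "q \<in> Vr \<Omega> r"
    and eq: "L2_inner \<Omega> (\<lambda>x. (M w x * norm (q x) powr (r - 2)) *\<^sub>R q x) q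
          = L2_inner \<Omega> w (divergence \<Omega> (vdens \<Omega> q))"
    using s by (auto simp: step_solution_def)
  have B: "\<bar>M w x\<bar> \<le> K" if "x \<in> space (lebesgue_on \<Omega>)" for x
  proof -
    have "x \<in> closure \<Omega>" using that in_closure by simp
    then show ?thesis using M_ge[of x w] M_le[of x w] k0 by auto
  qed
  show "integrable (lebesgue_on \<Omega>) (\<lambda>x. M w x * norm (q x) powr r)"
    using integrable_bounded_mult[OF Vr_integrable(2)[OF qV r] measurable_closure[OF M_cont[OF w]] B] by simp
  have pt: "norm z powr (r - 2) * (z \<bullet> z) = norm z powr r" for z :: 'a
  proof (cases "z = 0")
    case False
    have "norm z powr (r - 2) * (z \<bullet> z) = norm z powr (r - 2) * norm z powr 2"
      using False by (simp add: dot_square_norm)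
    also have "\<dots> = norm z powr r" by (simp only: powr_add[symmetric]) simp
    finally show ?thesis .
  qed simp
  show "integral\<^sup>L (lebesgue_on \<Omega>) (\<lambda>x. M w x * norm (q x) powr r) = L2_inner \<Omega> (divergence \<Omega> (vdens \<Omega> q)) w"
    using eq by (simp add: L2_inner_def mult.assoc pt mult.commute[of "w _"])
qed

text \<open>The weight 1/4 allows two applications in \<open>step_L2_bounds\<close> to be absorbed
  while half of the squared norm of w remains.\<close>

lemma L2_inner_young:
  fixes f g :: "'a \<Rightarrow> real"
  assumes "f \<in> Lspace \<Omega> 2" "g \<in> Lspace \<Omega> 2"
  shows "L2_inner \<Omega> f g \<le> L2_inner \<Omega> f f + L2_inner \<Omega> g g / 4"
proof -
  note i = Lspace2_integrable_mult
  have "0 \<le> integral\<^sup>L (lebesgue_on \<Omega>) (\<lambda>x. (f x - g x / 2)\<^sup>2)" by simp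
  also have "(\<lambda>x. (f x - g x / 2)\<^sup>2) = (\<lambda>x. f x * f x - f x * g x + g x * g x / 4)"
    by (rule ext) (simp add: power2_eq_square field_simps)
  also have "integral\<^sup>L (lebesgue_on \<Omega>) \<dots> = L2_inner \<Omega> f f - L2_inner \<Omega> f g + L2_inner \<Omega> g g / 4"
    unfolding L2_inner_def using i[OF assms(1,1)] i[OF assms] i[OF assms(2,2)] by simp
  finally show ?thesis by simp
qed

text \<open>The first equation is tested with w and multiplied by \<tau>, and the energy identity
  replaces the divergence term. The squared norm and the energy then appear on the same side, both
  nonnegative, so that dropping one bounds the other.\<close>

lemma step_L2_bounds:
  assumes s: "step_solution \<Omega> M \<tau> U r w' w q" and r: "r > 1" and \<tau>: "\<tau> > 0" and U: "U \<in> Lspace \<Omega> 2"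
  shows "L2_inner \<Omega> w w \<le> 2 * (\<tau>\<^sup>2 * L2_inner \<Omega> U U + L2_inner \<Omega> w' w')"
    "integral\<^sup>L (lebesgue_on \<Omega>) (\<lambda>x. norm (q x) powr r) \<le> (\<tau> * L2_inner \<Omega> U U + L2_inner \<Omega> w' w' / \<tau>) / k0"
proof -
  have w: "continuous_on (closure \<Omega>) w" "continuous_on (closure \<Omega>) w'" and qV: "q \<in> Vr \<Omega> r"
    and bal: "\<And>\<eta>. \<eta> \<in> Lspace \<Omega> 2 \<Longrightarrow> L2_inner \<Omega> (\<lambda>x. (w x - w' x) / \<tau>) \<eta> + L2_inner \<Omega> (divergence \<Omega> (vdens \<Omega> q)) \<eta>
        = L2_inner \<Omega> U \<eta>"
    using s by (auto simp: step_solution_def)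
  have wL: "w \<in> Lspace \<Omega> 2" "w' \<in> Lspace \<Omega> 2" by (intro Lspace_closure w)+
  let ?e = "integral\<^sup>L (lebesgue_on \<Omega>) (\<lambda>x. M w x * norm (q x) powr r)"
  let ?J = "integral\<^sup>L (lebesgue_on \<Omega>) (\<lambda>x. norm (q x) powr r)"
  have e: "k0 * ?J \<le> ?e"
  proof -
    have "k0 * ?J = integral\<^sup>L (lebesgue_on \<Omega>) (\<lambda>x. k0 * norm (q x) powr r)" by simp
    also have "\<dots> \<le> ?e"
      using Vr_integrable(2)[OF qV r] step_energy(1)[OF s r] M_ge[OF in_closure]
      by (intro integral_mono) (auto intro!: mult_right_mono)
    finally show ?thesis .
  qed
  have J0: "0 \<le> ?J" by simp
  have "L2_inner \<Omega> (\<lambda>x. (w x - w' x) / \<tau>) w = (L2_inner \<Omega> w w - L2_inner \<Omega> w' w) / \<tau>"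
    using L2_inner_linear[OF wL wL(1), of "1 / \<tau>" "- (1 / \<tau>)"] by (simp add: diff_divide_distrib)
  then have 1: "(L2_inner \<Omega> w w - L2_inner \<Omega> w' w) / \<tau> + ?e = L2_inner \<Omega> U w"
    using bal[OF wL(1)] step_energy(2)[OF s r] by simp
  have \<tau>U: "(\<lambda>x. \<tau> * U x) \<in> Lspace \<Omega> 2" using Lspace2_linear[OF U U, of \<tau> 0] by simp
  have lin: "L2_inner \<Omega> (\<lambda>x. \<tau> * U x) g = \<tau> * L2_inner \<Omega> U g" if "g \<in> Lspace \<Omega> 2" for g
    using L2_inner_linear[OF U U that, of \<tau> 0] by simp
  have "L2_inner \<Omega> (\<lambda>x. \<tau> * U x) (\<lambda>x. \<tau> * U x) = \<tau>\<^sup>2 * L2_inner \<Omega> U U"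
    using lin[OF \<tau>U] L2_inner_commute[of \<Omega> U "\<lambda>x. \<tau> * U x"] lin[OF U] by (simp add: power2_eq_square)
  moreover note lin[OF wL(1)] \<tau>U
  ultimately have 2: "\<tau> * L2_inner \<Omega> U w \<le> \<tau>\<^sup>2 * L2_inner \<Omega> U U + L2_inner \<Omega> w w / 4"
    using L2_inner_young[of "\<lambda>x. \<tau> * U x" w] wL by simp
  have 3: "L2_inner \<Omega> w' w \<le> L2_inner \<Omega> w' w' + L2_inner \<Omega> w w / 4" by (rule L2_inner_young[OF wL(2,1)])
  have "L2_inner \<Omega> w w - L2_inner \<Omega> w' w + \<tau> * ?e = \<tau> * L2_inner \<Omega> U w"
    unfolding 1[symmetric] using \<tau> by (simp add: field_simps)
  then have 4: "L2_inner \<Omega> w w / 2 + \<tau> * ?e \<le> \<tau>\<^sup>2 * L2_inner \<Omega> U U + L2_inner \<Omega> w' w'" using 2 3 by linarith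
  have ww: "0 \<le> L2_inner \<Omega> w w" by (simp add: L2_inner_def)
  have "0 \<le> k0 * ?J" using J0 k0 by simp
  then have e0: "0 \<le> ?e" using e by linarith
  then have "0 \<le> \<tau> * ?e" using \<tau> by simp
  then show "L2_inner \<Omega> w w \<le> 2 * (\<tau>\<^sup>2 * L2_inner \<Omega> U U + L2_inner \<Omega> w' w')" using 4 by argo
  have "\<tau> * (k0 * ?J) \<le> \<tau> * ?e" using e \<tau> by (intro mult_left_mono) auto
  then have "\<tau> * (k0 * ?J) \<le> \<tau>\<^sup>2 * L2_inner \<Omega> U U + L2_inner \<Omega> w' w'" using 4 ww by argo
  then show "?J \<le> (\<tau> * L2_inner \<Omega> U U + L2_inner \<Omega> w' w' / \<tau>) / k0"
    using \<tau> k0 by (simp add: field_simps power2_eq_square)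
qed

lemma L2_inner_bounded:
  fixes f :: "'a \<Rightarrow> real"
  assumes "continuous_on (closure \<Omega>) f" "\<And>x. x \<in> closure \<Omega> \<Longrightarrow> \<bar>f x\<bar> \<le> B"
  shows "L2_inner \<Omega> f f \<le> B\<^sup>2 * measure (lebesgue_on \<Omega>) \<Omega>"
proof -
  interpret finite_measure "lebesgue_on \<Omega>" by (rule finite_measure_\<Omega>)
  have "L2_inner \<Omega> f f \<le> integral\<^sup>L (lebesgue_on \<Omega>) (\<lambda>_. B\<^sup>2)"
    unfolding L2_inner_def inner_real_def
  proof (rule integral_mono[OF Lspace2_integrable_mult[OF Lspace_closure Lspace_closure]])
    fix x assume "x \<in> space (lebesgue_on \<Omega>)"
    then have "\<bar>f x\<bar>\<^sup>2 \<le> B\<^sup>2" using assms(2) in_closure by (intro power_mono) auto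
    then show "f x * f x \<le> B\<^sup>2" by (simp add: power2_eq_square)
  qed (use assms(1) in auto)
  then show ?thesis by (simp add: mult.commute)
qed

text \<open>Since \<open>r > 1\<close> enters only through the factor \<open>h powr (- DIM('a) * (r - 1) / r)\<close>, the bounds are
  uniform as soon as the conjugate exponent of \<open>r\<close> is at least twice the dimension.\<close>

lemma step_uniform_bounds:
  fixes B \<tau> :: real and U :: "'a \<Rightarrow> real"
  assumes U: "U \<in> Lspace \<Omega> 2" and \<tau>: "\<tau> > 0"
  shows "\<exists>C. \<forall>r w' w q. step_solution \<Omega> M \<tau> U r w' w q \<longrightarrow> r > 1 \<longrightarrow> DIM('a) * ((r - 1) / r) \<le> 1 / 2 \<longrightarrow>
    (\<forall>x\<in>closure \<Omega>. \<bar>w' x\<bar> \<le> B) \<longrightarrow>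
    integral\<^sup>L (lebesgue_on \<Omega>) (\<lambda>x. norm (q x) powr r) \<le> C \<and> (\<forall>x\<in>closure \<Omega>. \<bar>w x\<bar> \<le> C) \<and>
    (\<forall>x y. norm (x - y) \<le> 1 \<longrightarrow> \<bar>zext \<Omega> w x - zext \<Omega> w y\<bar> \<le> C * sqrt (norm (x - y)))"
proof -
  let ?\<mu> = "measure (lebesgue_on \<Omega>) \<Omega>"
  let ?b = "bump_mass TYPE('a)"
  interpret finite_measure "lebesgue_on \<Omega>" by (rule finite_measure_\<Omega>)
  \<comment> \<open>W bounds the squared L^2 norm of w, C0 the integral of |q|^r, and H / sqrt h the
    averages of the gradient at width h. C then covers C0, the Hoelder constant 5 H and the sup
    bound, in this order.\<close>
  define W where "W = 2 * (\<tau>\<^sup>2 * L2_inner \<Omega> U U + B\<^sup>2 * ?\<mu>)"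
  define C0 where "C0 = (\<tau> * L2_inner \<Omega> U U + B\<^sup>2 * ?\<mu> / \<tau>) / k0"
  define H where "H = K * (1 + \<bar>C0\<bar> / ?b)"
  define C where "C = max C0 (max (5 * H) (2 * H + (?\<mu> + W) / ?b))"
  have b: "?b > 0" by (rule bump_mass_pos)
  have "integral\<^sup>L (lebesgue_on \<Omega>) (\<lambda>x. norm (q x) powr r) \<le> C \<and> (\<forall>x\<in>closure \<Omega>. \<bar>w x\<bar> \<le> C) \<and>
    (\<forall>x y. norm (x - y) \<le> 1 \<longrightarrow> \<bar>zext \<Omega> w x - zext \<Omega> w y\<bar> \<le> C * sqrt (norm (x - y)))"
    if s: "step_solution \<Omega> M \<tau> U r w' w q" and r: "r > 1" and rd: "DIM('a) * ((r - 1) / r) \<le> 1 / 2"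
      and B: "\<forall>x\<in>closure \<Omega>. \<bar>w' x\<bar> \<le> B" for r w' w q
  proof -
    have w: "continuous_on (closure \<Omega>) w" "\<And>x. x \<in> frontier \<Omega> \<Longrightarrow> w x = 0" "continuous_on (closure \<Omega>) w'" and qV: "q \<in> Vr \<Omega> r"
      using s by (auto simp: step_solution_def)
    have w'B: "L2_inner \<Omega> w' w' \<le> B\<^sup>2 * ?\<mu>" using L2_inner_bounded[OF w(3)] B by auto
    have wW: "L2_inner \<Omega> w w \<le> W" using step_L2_bounds(1)[OF s r \<tau> U] w'B by (simp add: W_def)
    have "(\<tau> * L2_inner \<Omega> U U + L2_inner \<Omega> w' w' / \<tau>) / k0 \<le> C0"
      unfolding C0_def using w'B k0 \<tau> by (intro divide_right_mono add_left_mono) auto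
    then have J: "integral\<^sup>L (lebesgue_on \<Omega>) (\<lambda>x. norm (q x) powr r) \<le> C0"
      using step_L2_bounds(2)[OF s r \<tau> U] by linarith
    let ?G = "\<lambda>x. (- (M w x * norm (q x) powr (r - 2))) *\<^sub>R q x"
    note z = step_zero_ext_gradient[OF s r]
    have pot: "integral\<^sup>L (lebesgue_on \<Omega>) (\<lambda>u. moll h (u - x) * norm (?G u)) \<le> H / sqrt h"
      if h: "0 < h" "h \<le> 1" for h x
    proof -
      \<comment> \<open>This a cancels the volume factor of the kernel, and a powr \<theta> is h to
        the power - d \<theta>, hence at most 1 / sqrt h by the assumption on r and h \<le>
        1.\<close>
      define a where "a = 1 / h ^ DIM('a)"
      have a: "a > 0" "a * (h ^ DIM('a) * ?b) = ?b" using h by (simp_all add: a_def)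
      have "integral\<^sup>L (lebesgue_on \<Omega>) (\<lambda>u. moll h (u - x) * norm (?G u))
        = integral\<^sup>L (lebesgue_on \<Omega>) (\<lambda>u. moll h (u - x) * (M w u * norm (q u) powr (r - 1)))"
        unfolding norm_flux using M_ge[OF in_closure] k0
        by (intro Bochner_Integration.integral_cong refl) (simp add: order_trans[OF less_imp_le])
      also have "\<dots> \<le> K * a powr ((r - 1) / r) * (1 + (r - 1) / r * C0 / (a * (h ^ DIM('a) * ?b)))"
      proof (rule flux_potential_bound[OF r \<Omega>_sets h(1) a(1) Vr_integrable(1,2)[OF qV r] J measurable_closure[OF M_cont[OF w(1)]]])
        show "0 \<le> M w u" "M w u \<le> K" if "u \<in> \<Omega>" for u
          using M_ge[OF in_closure[OF that], of w] M_le[OF in_closure[OF that], of w] k0 by auto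
      qed (use K in auto)
      also have "\<dots> \<le> K * (1 / sqrt h) * (1 + \<bar>C0\<bar> / ?b)"
      proof (intro mult_mono mult_left_mono)
        have "a = h powr (- real DIM('a))" using h by (simp add: a_def powr_minus powr_realpow divide_inverse)
        then have "a powr ((r - 1) / r) = h powr (- (DIM('a) * ((r - 1) / r)))" by (simp add: powr_powr)
        also have "\<dots> \<le> h powr (- (1 / 2))" using h rd by (intro powr_mono') auto
        also have "\<dots> = 1 / sqrt h" using powr_half_sqrt[of h] h unfolding powr_minus by (simp add: inverse_eq_divide)
        finally show "a powr ((r - 1) / r) \<le> 1 / sqrt h" .
        have "(r - 1) / r * C0 \<le> (r - 1) / r * \<bar>C0\<bar>" using r by (intro mult_left_mono) auto
        also have "\<dots> \<le> \<bar>C0\<bar>" using r by (intro mult_left_le_one_le) auto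
        finally show "1 + (r - 1) / r * C0 / (a * (h ^ DIM('a) * ?b)) \<le> 1 + \<bar>C0\<bar> / ?b"
          unfolding a(2) using b by (intro add_left_mono divide_right_mono) auto
        have "0 \<le> C0" using J by (meson Bochner_Integration.integral_nonneg order_trans powr_ge_zero)
        then show "0 \<le> 1 + (r - 1) / r * C0 / (a * (h ^ DIM('a) * ?b))"
          unfolding a(2) using r b by (intro add_nonneg_nonneg divide_nonneg_nonneg mult_nonneg_nonneg) auto
      qed (use K h in auto)
      finally show ?thesis by (simp add: H_def)
    qed
    have H0: "H \<ge> 0" using K b by (simp add: H_def)
    have wz: "w x = zext \<Omega> w x" if "x \<in> closure \<Omega>" for x by (rule zext_closure[OF \<Omega>(1) w(2) that, symmetric])
    have hol: "\<bar>zext \<Omega> w x - zext \<Omega> w y\<bar> \<le> 5 * H * sqrt (norm (x - y))" if "norm (x - y) \<le> 1" for x y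
      by (rule hoelder_bound[OF z \<Omega>_sets \<Omega>(2) pot that])
    have cz: "continuous_on UNIV (zext \<Omega> w)" by (rule continuous_on_zext[OF \<Omega>(1) w(1,2)])
    have iw: "integrable (lebesgue_on \<Omega>) (\<lambda>u. (1 + w u * w u))"
      using Lspace2_integrable_mult[OF Lspace_closure Lspace_closure, OF w(1) w(1)] by auto
    \<comment> \<open>The average at width 1 is bounded by the L^2 norm through |w| \<le> 1 + w^2,
      and w differs from this average by at most 2 H.\<close>
    have bd: "\<bar>w x\<bar> \<le> 2 * H + (?\<mu> + W) / ?b" if x: "x \<in> closure \<Omega>" for x
    proof -
      have "conv 1 (zext \<Omega> w) x = integral\<^sup>L (lebesgue_on \<Omega>) (\<lambda>u. zext \<Omega> w u * moll 1 (u - x))"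
        unfolding conv_def using cz \<Omega>_sets
        by (intro lebesgue_on_integral_support[symmetric] borel_measurable_continuous_onI continuous_intros) (auto simp: zext_def)
      also have "norm \<dots> \<le> integral\<^sup>L (lebesgue_on \<Omega>) (\<lambda>u. (1 + w u * w u) * (1 / ?b))"
      proof (rule Bochner_Integration.integral_norm_bound_integral)
        show "integrable (lebesgue_on \<Omega>) (\<lambda>u. zext \<Omega> w u * moll 1 (u - x))"
        proof -
          have "zext \<Omega> w \<in> Lspace \<Omega> 2" by (rule Lspace_closure[OF continuous_on_subset[OF cz subset_UNIV]])
          then have "integrable (lebesgue_on \<Omega>) (zext \<Omega> w)" by (rule Lspace2_integrable[OF _ \<Omega>_lmeasurable])
          from integrable_moll_mult[OF this, of 1 x] show ?thesis by (simp add: mult.commute)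
        qed
        show "integrable (lebesgue_on \<Omega>) (\<lambda>u. (1 + w u * w u) * (1 / ?b))" using iw by (intro integrable_mult_left)
        fix u assume "u \<in> space (lebesgue_on \<Omega>)"
        then have u: "zext \<Omega> w u = w u" by (simp add: zext_def)
        have "\<bar>w u\<bar> \<le> 1 + w u * w u"
        proof -
          have "0 \<le> (\<bar>w u\<bar> - 1)\<^sup>2" by simp
          then have "2 * \<bar>w u\<bar> \<le> 1 + \<bar>w u\<bar> * \<bar>w u\<bar>" by (simp add: power2_eq_square algebra_simps)
          moreover have "\<bar>w u\<bar> * \<bar>w u\<bar> = w u * w u" by simp
          ultimately show ?thesis by linarith
        qed
        then show "norm (zext \<Omega> w u * moll 1 (u - x)) \<le> (1 + w u * w u) * (1 / ?b)"
          unfolding u real_norm_def abs_mult using moll_abs_le[of 1 "u - x"] by (intro mult_mono) auto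
      qed
      also have "\<dots> = (integral\<^sup>L (lebesgue_on \<Omega>) (\<lambda>u. 1 + w u * w u)) / ?b" by simp
      also have "integral\<^sup>L (lebesgue_on \<Omega>) (\<lambda>u. 1 + w u * w u) = ?\<mu> + L2_inner \<Omega> w w"
        using Lspace2_integrable_mult[OF Lspace_closure Lspace_closure, OF w(1) w(1)] by (simp add: L2_inner_def)
      also have "(?\<mu> + L2_inner \<Omega> w w) / ?b \<le> (?\<mu> + W) / ?b" using b wW by (intro divide_right_mono) auto
      finally have "\<bar>conv 1 (zext \<Omega> w) x\<bar> \<le> (?\<mu> + W) / ?b" by simp
      moreover have "\<bar>zext \<Omega> w x - conv 1 (zext \<Omega> w) x\<bar> \<le> 2 * H * sqrt 1"
        by (rule conv_close[OF z \<Omega>_sets \<Omega>(2) pot]) auto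
      ultimately show ?thesis using wz[OF x] by simp
    qed
    have H5: "5 * H * sqrt (norm (x - y)) \<le> C * sqrt (norm (x - y))" for x y :: 'a
      by (rule mult_right_mono) (auto simp: C_def)
    have C: "C0 \<le> C" "2 * H + (?\<mu> + W) / ?b \<le> C" by (auto simp: C_def)
    show ?thesis
      by (intro conjI ballI allI impI order_trans[OF J C(1)] order_trans[OF bd C(2)] order_trans[OF hol H5])
  qed
  then show ?thesis by blast
qed

end

subsection \<open>Measures\<close>

lemma radon_bound:
  fixes K :: "'a::euclidean_space set"
  assumes "\<mu> \<in> radon K"
  obtains C where "C \<ge> 0" "\<And>f B. continuous_on K f \<Longrightarrow> (\<And>x. x \<in> K \<Longrightarrow> \<bar>f x\<bar> \<le> B) \<Longrightarrow> B \<ge> 0 \<Longrightarrow> \<bar>\<mu> f\<bar> \<le> C * B"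
proof -
  obtain C where C: "\<And>f B. continuous_on K f \<Longrightarrow> (\<forall>x\<in>K. \<bar>f x\<bar> \<le> B) \<Longrightarrow> \<bar>\<mu> f\<bar> \<le> C * B"
    using assms unfolding radon_def by blast
  show thesis
  proof (rule that[of "\<bar>C\<bar>"])
    fix f :: "'a \<Rightarrow> real" and B assume "continuous_on K f" "\<And>x. x \<in> K \<Longrightarrow> \<bar>f x\<bar> \<le> B" "B \<ge> 0"
    then have "\<bar>\<mu> f\<bar> \<le> C * B" by (intro C) auto
    also have "\<dots> \<le> \<bar>C\<bar> * B" using \<open>B \<ge> 0\<close> by (intro mult_right_mono) auto
    finally show "\<bar>\<mu> f\<bar> \<le> \<bar>C\<bar> * B" .
  qed simp
qed

lemma vpair_bound:
  fixes v :: "'a::euclidean_space vmeas"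
  assumes "v \<in> vradon K"
  obtains C where "\<And>\<psi> B. continuous_on K \<psi> \<Longrightarrow> (\<And>x. x \<in> K \<Longrightarrow> norm (\<psi> x) \<le> B) \<Longrightarrow> B \<ge> 0 \<Longrightarrow> \<bar>vpair v \<psi>\<bar> \<le> C * B"
proof -
  have "\<exists>C. \<forall>b\<in>Basis. \<forall>f B. continuous_on K f \<longrightarrow> (\<forall>x\<in>K. \<bar>f x\<bar> \<le> B) \<longrightarrow> B \<ge> 0 \<longrightarrow> \<bar>v b f\<bar> \<le> C b * B"
  proof (rule bchoice, rule ballI)
    fix b :: 'a assume "b \<in> Basis"
    then have "v b \<in> radon K" using assms by (simp add: vradon_def)
    then obtain C where "C \<ge> 0" "\<And>f B. continuous_on K f \<Longrightarrow> (\<And>x. x \<in> K \<Longrightarrow> \<bar>f x\<bar> \<le> B) \<Longrightarrow> B \<ge> 0 \<Longrightarrow> \<bar>v b f\<bar> \<le> C * B"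
      by (rule radon_bound) blast
    then show "\<exists>C. \<forall>f B. continuous_on K f \<longrightarrow> (\<forall>x\<in>K. \<bar>f x\<bar> \<le> B) \<longrightarrow> B \<ge> 0 \<longrightarrow> \<bar>v b f\<bar> \<le> C * B" by blast
  qed
  then obtain C where C: "\<And>b f B. b \<in> Basis \<Longrightarrow> continuous_on K f \<Longrightarrow> (\<forall>x\<in>K. \<bar>f x\<bar> \<le> B) \<Longrightarrow> B \<ge> 0 \<Longrightarrow> \<bar>v b f\<bar> \<le> C b * B" by blast
  show thesis
  proof (rule that)
    fix \<psi> :: "'a \<Rightarrow> 'a" and B assume \<psi>: "continuous_on K \<psi>" "\<And>x. x \<in> K \<Longrightarrow> norm (\<psi> x) \<le> B" "B \<ge> 0"
    have "\<bar>vpair v \<psi>\<bar> \<le> (\<Sum>b\<in>Basis. \<bar>v b (\<lambda>x. \<psi> x \<bullet> b)\<bar>)" unfolding vpair_def by (rule sum_abs)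
    also have "\<dots> \<le> (\<Sum>b\<in>Basis. C b * B)"
    proof (rule sum_mono)
      fix b :: 'a assume b: "b \<in> Basis"
      show "\<bar>v b (\<lambda>x. \<psi> x \<bullet> b)\<bar> \<le> C b * B"
      proof (rule C[OF b _ _ \<psi>(3)])
        show "continuous_on K (\<lambda>x. \<psi> x \<bullet> b)" by (intro continuous_intros \<psi>)
        show "\<forall>x\<in>K. \<bar>\<psi> x \<bullet> b\<bar> \<le> B" using \<psi>(2) Basis_le_norm[OF b] order_trans by blast
      qed
    qed
    also have "\<dots> = sum C Basis * B" by (simp add: sum_distrib_right)
    finally show "\<bar>vpair v \<psi>\<bar> \<le> sum C Basis * B" .
  qed
qed

lemma vpair_scale:
  assumes "v \<in> vradon K" "continuous_on K \<psi>"
  shows "vpair v (\<lambda>x. c *\<^sub>R \<psi> x) = c * vpair v \<psi>"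
  unfolding vpair_def sum_distrib_left
proof (rule sum.cong[OF refl])
  fix b :: 'a assume "b \<in> Basis"
  then have "v b \<in> radon K" using assms(1) by (simp add: vradon_def)
  moreover have "continuous_on K (\<lambda>x. \<psi> x \<bullet> b)" by (intro continuous_intros assms)
  ultimately have "v b (\<lambda>x. c * (\<psi> x \<bullet> b)) = c * v b (\<lambda>x. \<psi> x \<bullet> b)" unfolding radon_def by blast
  then show "v b (\<lambda>x. c *\<^sub>R \<psi> x \<bullet> b) = c * v b (\<lambda>x. \<psi> x \<bullet> b)" by simp
qed

text \<open>For \<eta> \<ge> 0 the second supremum of the definition runs over fields that vanish on
  K, so it is the supremum of {0}.\<close>

lemma total_variation_eq_Sup:
  fixes v :: "'a::euclidean_space vmeas"
  assumes v: "v \<in> vradon K" and \<eta>: "\<And>x. x \<in> K \<Longrightarrow> 0 \<le> \<eta> x"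
  shows "total_variation K v \<eta> = Sup {vpair v \<psi> |\<psi>. continuous_on K \<psi> \<and> (\<forall>x\<in>K. norm (\<psi> x) \<le> \<eta> x)}"
proof -
  obtain C where C: "\<And>\<psi> B. continuous_on K \<psi> \<Longrightarrow> (\<And>x. x \<in> K \<Longrightarrow> norm (\<psi> x) \<le> B) \<Longrightarrow> B \<ge> 0 \<Longrightarrow> \<bar>vpair v \<psi>\<bar> \<le> C * B"
    by (rule vpair_bound[OF v]) blast
  have z: "vpair v \<psi> = 0" if "continuous_on K \<psi>" "\<forall>x\<in>K. norm (\<psi> x) \<le> max 0 (- \<eta> x)" for \<psi>
  proof -
    have "norm (\<psi> x) \<le> 0" if "x \<in> K" for x using \<open>\<forall>x\<in>K. _ x\<close> \<eta>[OF that] that by (metis max.absorb1 neg_le_0_iff_le)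
    then show ?thesis using C[OF that(1), of 0] by simp
  qed
  have "{vpair v \<psi> |\<psi>. continuous_on K \<psi> \<and> (\<forall>x\<in>K. norm (\<psi> x) \<le> max 0 (- \<eta> x))} = {0}"
  proof (intro equalityI subsetI)
    fix y :: real assume "y \<in> {0}"
    then show "y \<in> {vpair v \<psi> |\<psi>. continuous_on K \<psi> \<and> (\<forall>x\<in>K. norm (\<psi> x) \<le> max 0 (- \<eta> x))}"
      using z[of "\<lambda>_. 0"] by (intro CollectI exI[of _ "\<lambda>_. 0"]) auto
  qed (use z in auto)
  moreover have "{vpair v \<psi> |\<psi>. continuous_on K \<psi> \<and> (\<forall>x\<in>K. norm (\<psi> x) \<le> max 0 (\<eta> x))}
     = {vpair v \<psi> |\<psi>. continuous_on K \<psi> \<and> (\<forall>x\<in>K. norm (\<psi> x) \<le> \<eta> x)}"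
    using \<eta> by (simp add: max_absorb2 cong: ball_cong_simp)
  ultimately show ?thesis by (simp add: total_variation_def)
qed

text \<open>The upper bound B for \<eta> makes the set of pairings bounded above; otherwise
  \<open>Sup\<close> would carry no information.\<close>

lemma vpair_le_total_variation:
  fixes v :: "'a::euclidean_space vmeas"
  assumes v: "v \<in> vradon K" and \<eta>: "\<And>x. x \<in> K \<Longrightarrow> 0 \<le> \<eta> x" "\<And>x. x \<in> K \<Longrightarrow> \<eta> x \<le> B"
    and \<psi>: "continuous_on K \<psi>" "\<And>x. x \<in> K \<Longrightarrow> norm (\<psi> x) \<le> \<eta> x"
  shows "vpair v \<psi> \<le> total_variation K v \<eta>"
proof -
  obtain C where C: "\<And>\<psi> B. continuous_on K \<psi> \<Longrightarrow> (\<And>x. x \<in> K \<Longrightarrow> norm (\<psi> x) \<le> B) \<Longrightarrow> B \<ge> 0 \<Longrightarrow> \<bar>vpair v \<psi>\<bar> \<le> C * B"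
    by (rule vpair_bound[OF v]) blast
  show ?thesis
    unfolding total_variation_eq_Sup[of v K \<eta>, OF v \<eta>(1), simplified]
  proof (rule cSup_upper)
    show "vpair v \<psi> \<in> {vpair v \<psi> |\<psi>. continuous_on K \<psi> \<and> (\<forall>x\<in>K. norm (\<psi> x) \<le> \<eta> x)}" using \<psi> by blast
    show "bdd_above {vpair v \<psi> |\<psi>. continuous_on K \<psi> \<and> (\<forall>x\<in>K. norm (\<psi> x) \<le> \<eta> x)}"
    proof (rule bdd_aboveI)
      fix y assume "y \<in> {vpair v \<psi> |\<psi>. continuous_on K \<psi> \<and> (\<forall>x\<in>K. norm (\<psi> x) \<le> \<eta> x)}"
      then obtain \<psi> where \<psi>: "y = vpair v \<psi>" "continuous_on K \<psi>" "\<forall>x\<in>K. norm (\<psi> x) \<le> \<eta> x" by blast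
      have "\<bar>vpair v \<psi>\<bar> \<le> C * \<bar>B\<bar>"
      proof (rule C[OF \<psi>(2)])
        show "norm (\<psi> x) \<le> \<bar>B\<bar>" if "x \<in> K" for x using \<psi>(3) \<eta>(2)[OF that] that by fastforce
      qed simp
      then show "y \<le> C * \<bar>B\<bar>" using \<psi>(1) by simp
    qed
  qed
qed

lemma total_variation_le:
  fixes v :: "'a::euclidean_space vmeas"
  assumes v: "v \<in> vradon K" and \<eta>: "\<And>x. x \<in> K \<Longrightarrow> 0 \<le> \<eta> x"
    and le: "\<And>\<psi>. continuous_on K \<psi> \<Longrightarrow> (\<And>x. x \<in> K \<Longrightarrow> norm (\<psi> x) \<le> \<eta> x) \<Longrightarrow> vpair v \<psi> \<le> c"
  shows "total_variation K v \<eta> \<le> c"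
  unfolding total_variation_eq_Sup[of v K \<eta>, OF v \<eta>, simplified]
proof (rule cSup_least)
  have "vpair v (\<lambda>_. 0) \<in> {vpair v \<psi> |\<psi>. continuous_on K \<psi> \<and> (\<forall>x\<in>K. norm (\<psi> x) \<le> \<eta> x)}"
    using \<eta> by (intro CollectI exI[of _ "\<lambda>_. 0"]) auto
  then show "{vpair v \<psi> |\<psi>. continuous_on K \<psi> \<and> (\<forall>x\<in>K. norm (\<psi> x) \<le> \<eta> x)} \<noteq> {}" by blast
qed (use le in blast)

subsection \<open>Vague compactness\<close>

lemma convergent_approx:
  fixes a :: "nat \<Rightarrow> real"
  assumes "\<And>e. e > 0 \<Longrightarrow> \<exists>s. convergent s \<and> (\<forall>j. \<bar>a j - s j\<bar> \<le> e)"
  shows "convergent a"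
proof (rule Cauchy_convergent, rule metric_CauchyI)
  fix e :: real assume "e > 0"
  then have "e / 4 > 0" by simp
  from assms[OF this] obtain s where s: "convergent s" "\<And>j. \<bar>a j - s j\<bar> \<le> e / 4" by blast
  obtain N where N: "\<And>m n. m \<ge> N \<Longrightarrow> n \<ge> N \<Longrightarrow> dist (s m) (s n) < e / 4"
    using metric_CauchyD[OF convergent_Cauchy[OF s(1)] \<open>e / 4 > 0\<close>] by blast
  show "\<exists>M. \<forall>m\<ge>M. \<forall>n\<ge>M. dist (a m) (a n) < e"
  proof (intro exI allI impI)
    fix m n assume "m \<ge> N" "n \<ge> N"
    then show "dist (a m) (a n) < e"
    proof -
      have tri: "\<bar>x - y\<bar> < 4 * d" if "\<bar>x - p\<bar> \<le> d" "\<bar>y - q\<bar> \<le> d" "\<bar>p - q\<bar> < d" for x y p q d :: real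
        using that by linarith
      have "\<bar>s m - s n\<bar> < e / 4" using N \<open>m \<ge> N\<close> \<open>n \<ge> N\<close> by (simp add: dist_real_def)
      from tri[OF s(2)[of m] s(2)[of n] this] show ?thesis by (simp add: dist_real_def)
    qed
  qed
qed

text \<open>The lower corner of the dyadic cube of side 2^(-k) that contains x. The cubes are the
  fibres of this map and need no indexing of their own.\<close>

definition grid :: "nat \<Rightarrow> 'a::euclidean_space \<Rightarrow> 'a" where
  "grid k x = (\<Sum>b\<in>Basis. (of_int \<lfloor>2 ^ k * (x \<bullet> b)\<rfloor> / 2 ^ k) *\<^sub>R b)"

lemma grid_measurable: "grid k \<in> borel_measurable borel"
proof -
  have "(\<lambda>x::'a. (of_int \<lfloor>2 ^ k * (x \<bullet> b)\<rfloor> / 2 ^ k :: real) *\<^sub>R b) \<in> borel_measurable borel" for b :: 'a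
    by (intro borel_measurable_scaleR borel_measurable_divide borel_measurable_const
      measurable_compose[OF _ borel_measurable_real_floor] borel_measurable_times borel_measurable_inner) auto
  then show ?thesis unfolding grid_def[abs_def] by (intro borel_measurable_sum) auto
qed

lemma grid_dist: "norm (grid k x - x) \<le> DIM('a) / 2 ^ k" for x :: "'a::euclidean_space"
proof -
  have b: "\<bar>(grid k x - x) \<bullet> b\<bar> \<le> 1 / 2 ^ k" if "b \<in> Basis" for b
  proof -
    have "grid k x \<bullet> b = of_int \<lfloor>2 ^ k * (x \<bullet> b)\<rfloor> / 2 ^ k"
      using that by (simp add: grid_def inner_sum_left inner_Basis if_distrib cong: if_cong)
    moreover have "\<bar>of_int \<lfloor>y\<rfloor> - y\<bar> \<le> 1" for y :: real by linarith
    then have "\<bar>of_int \<lfloor>2 ^ k * (x \<bullet> b)\<rfloor> - 2 ^ k * (x \<bullet> b)\<bar> / 2 ^ k \<le> 1 / 2 ^ k"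
      by (intro divide_right_mono) auto
    moreover have "\<bar>a - 2 ^ k * c\<bar> / 2 ^ k = \<bar>a / 2 ^ k - c\<bar>" for a c :: real
    proof -
      have "a / 2 ^ k - c = (a - 2 ^ k * c) / 2 ^ k" by (simp add: diff_divide_distrib)
      then show ?thesis by (simp add: abs_divide)
    qed
    ultimately have "\<bar>grid k x \<bullet> b - x \<bullet> b\<bar> \<le> 1 / 2 ^ k" by metis
    then show ?thesis by (simp add: inner_diff_left)
  qed
  have "norm (grid k x - x) \<le> (\<Sum>b\<in>Basis. \<bar>(grid k x - x) \<bullet> b\<bar>)" by (rule norm_le_l1)
  also have "\<dots> \<le> (\<Sum>b\<in>(Basis::'a set). 1 / 2 ^ k)" by (rule sum_mono) (rule b)
  finally show ?thesis by simp
qed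

lemma finite_grid_image:
  fixes \<Omega> :: "'a::euclidean_space set"
  assumes "bounded \<Omega>"
  shows "finite (grid k ` \<Omega>)"
proof -
  obtain R where R: "\<And>x. x \<in> \<Omega> \<Longrightarrow> norm x \<le> R" using assms by (auto simp: bounded_iff)
  let ?I = "{\<lfloor>- (2 ^ k * R)\<rfloor>..\<lfloor>2 ^ k * R\<rfloor>}"
  let ?F = "(Basis::'a set) \<rightarrow>\<^sub>E ?I"
  let ?g = "\<lambda>f::'a \<Rightarrow> int. \<Sum>b\<in>Basis. (of_int (f b) / 2 ^ k) *\<^sub>R b"
  have "grid k ` \<Omega> \<subseteq> ?g ` ?F"
  proof
    fix y assume "y \<in> grid k ` \<Omega>"
    then obtain x where x: "x \<in> \<Omega>" "y = grid k x" by blast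
    let ?f = "restrict (\<lambda>b. \<lfloor>2 ^ k * (x \<bullet> b)\<rfloor>) Basis"
    have "?f \<in> ?F"
    proof (intro restrict_PiE_iff[THEN iffD2] ballI)
      fix b :: 'a assume "b \<in> Basis"
      then have "\<bar>x \<bullet> b\<bar> \<le> R" using Basis_le_norm R[OF x(1)] order_trans by blast
      then have "2 ^ k * (x \<bullet> b) \<le> 2 ^ k * R" "2 ^ k * (- R) \<le> 2 ^ k * (x \<bullet> b)" by (intro mult_left_mono; simp)+
      then show "\<lfloor>2 ^ k * (x \<bullet> b)\<rfloor> \<in> ?I" by (auto intro!: floor_mono)
    qed
    moreover have "y = ?g ?f" using x(2) by (simp add: grid_def)
    ultimately show "y \<in> ?g ` ?F" by blast
  qed
  moreover have "finite ?F" by (intro finite_PiE) auto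
  ultimately show ?thesis using finite_surj by blast
qed

text \<open>The integrals over the cells of the dyadic grids are countably many bounded sequences, and
  continuous functions are uniformly close to functions constant on the cells.\<close>

lemma vague_compactness:
  fixes q :: "nat \<Rightarrow> 'a::euclidean_space \<Rightarrow> 'a"
  assumes \<Omega>: "open \<Omega>" "bounded \<Omega>"
    and q: "\<And>j. integrable (lebesgue_on \<Omega>) (q j)" "\<And>j. integral\<^sup>L (lebesgue_on \<Omega>) (\<lambda>x. norm (q j x)) \<le> C"
  obtains \<sigma> :: "nat \<Rightarrow> nat" where "strict_mono \<sigma>"
    "\<And>b \<eta>. b \<in> Basis \<Longrightarrow> continuous_on (closure \<Omega>) \<eta> \<Longrightarrow> convergent (\<lambda>j. vdens \<Omega> (q (\<sigma> j)) b \<eta>)"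
proof -
  let ?I = "integral\<^sup>L (lebesgue_on \<Omega>)"
  define S where "S = (\<Union>k. {k} \<times> (grid k ` \<Omega>) \<times> (Basis::'a set))"
  define cell where "cell k y = grid k -` {y}" for k and y :: 'a
  define F where "F j s = (case s of (k, y, b) \<Rightarrow> ?I (\<lambda>x. indicator (cell k y) x * (q j x \<bullet> b)))" for j and s :: "nat \<times> 'a \<times> 'a"
  have qb: "integrable (lebesgue_on \<Omega>) (\<lambda>x. q j x \<bullet> b)" for j b
    using q(1) by (rule integrable_inner_left)
  have C0: "C \<ge> 0" using q(2)[of 0] by (rule order_trans[rotated]) simp
  have m: "(\<lambda>x. indicator (cell k y) x :: real) \<in> borel_measurable (lebesgue_on \<Omega>)" for k y
  proof -
    have "cell k y \<in> sets borel"
      using measurable_sets[OF grid_measurable, of "{y}" k] by (simp add: cell_def)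
    then show ?thesis by (intro measurable_restrict_space1 borel_measurable_indicator) simp
  qed
  have fi: "integrable (lebesgue_on \<Omega>) (\<lambda>x. indicator (cell k y) x * (q j x \<bullet> b))" for k y j b
    using integrable_bounded_mult[OF qb m, where B=1] by (simp add: indicator_le_1)
  have norm1: "\<bar>q j x \<bullet> b\<bar> \<le> norm (q j x)" if "b \<in> Basis" for j b x using Basis_le_norm[OF that] .
  have cS: "countable S"
    unfolding S_def
    by (rule countable_UN) (simp_all add: countable_finite finite_cartesian_product finite_grid_image[OF \<Omega>(2)])
  have FC: "norm (F j s) \<le> C" if "s \<in> S" for j s
  proof -
    obtain k y b where s: "s = (k, y, b)" "b \<in> Basis" using \<open>s \<in> S\<close> by (auto simp: S_def)
    have "norm (F j s) \<le> ?I (\<lambda>x. norm (q j x))"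
      unfolding F_def s(1) prod.case
    proof (rule Bochner_Integration.integral_norm_bound_integral[OF fi])
      show "integrable (lebesgue_on \<Omega>) (\<lambda>x. norm (q j x))" using q(1) by auto
      show "norm (indicator (cell k y) x * (q j x \<bullet> b)) \<le> norm (q j x)" for x
        using norm1[OF s(2)] by (auto simp: indicator_def)
    qed
    then show ?thesis using q(2)[of j] by linarith
  qed
  \<comment> \<open>The diagonal argument: one subsequence along which the integrals over all cells,
    at all levels and for all components, converge.\<close>
  have "\<exists>\<sigma>::nat \<Rightarrow> nat. strict_mono \<sigma> \<and> (\<forall>s\<in>S. \<exists>l. (\<lambda>n. F (\<sigma> n) s) \<longlonglongrightarrow> l)"
  proof (rule function_convergent_subsequence[OF cS FC])
    fix k :: "nat \<Rightarrow> nat"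
    assume "strict_mono k" "\<And>s. s \<in> S \<Longrightarrow> \<exists>l. (\<lambda>n. F (k n) s) \<longlonglongrightarrow> l"
    then show ?thesis by (intro exI[of _ k]) simp
  qed
  then obtain \<sigma> :: "nat \<Rightarrow> nat" where \<sigma>: "strict_mono \<sigma>" "\<And>s. s \<in> S \<Longrightarrow> \<exists>l. (\<lambda>n. F (\<sigma> n) s) \<longlonglongrightarrow> l"
    by metis
  show thesis
  proof (rule that[OF \<sigma>(1)])
    fix b :: 'a and \<eta> :: "'a \<Rightarrow> real"
    assume b: "b \<in> Basis" and \<eta>: "continuous_on (closure \<Omega>) \<eta>"
    have \<eta>m: "\<eta> \<in> borel_measurable (lebesgue_on \<Omega>)"
      using \<Omega>(1) by (intro continuous_imp_measurable_on_sets_lebesgue[OF continuous_on_subset[OF \<eta> closure_subset]]) (simp add: borel_open)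
    have uc: "uniformly_continuous_on (closure \<Omega>) \<eta>"
      using \<Omega>(2) by (intro compact_uniformly_continuous \<eta>) auto
    have "bounded (\<eta> ` closure \<Omega>)"
      using \<Omega>(2) by (intro compact_imp_bounded compact_continuous_image \<eta>) auto
    then obtain B where B: "\<forall>y\<in>\<eta> ` closure \<Omega>. norm y \<le> B" unfolding bounded_iff by blast
    have \<eta>B: "\<bar>\<eta> x\<bar> \<le> B" if "x \<in> \<Omega>" for x
      using B that closure_subset[of \<Omega>] by auto
    show "convergent (\<lambda>j. vdens \<Omega> (q (\<sigma> j)) b \<eta>)"
    proof (rule convergent_approx)
      fix e :: real assume e: "e > 0"
      define e' where "e' = e / (C + 1)"
      have e': "e' > 0" "e' * C \<le> e" using e C0 by (simp_all add: e'_def field_simps)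
      obtain d where d: "d > 0" "\<And>x y. x \<in> closure \<Omega> \<Longrightarrow> y \<in> closure \<Omega> \<Longrightarrow> dist y x < d \<Longrightarrow> dist (\<eta> y) (\<eta> x) < e'"
        using uc[unfolded uniformly_continuous_on_def, rule_format, OF e'(1)] by blast
      \<comment> \<open>Two points of one cell are each within DIM('a) / 2^k of its corner, so this
        level makes them closer than d.\<close>
      obtain k :: nat where k: "2 * DIM('a) / d < 2 ^ k" using real_arch_pow[of 2] by auto
      \<comment> \<open>A sample point of \<Omega> in every cell that meets \<Omega>; the corner
        itself may lie outside the closure, where \<eta> is not controlled.\<close>
      define p where "p y = (SOME x. x \<in> \<Omega> \<and> grid k x = y)" for y
      have p: "p (grid k x) \<in> \<Omega>" "grid k (p (grid k x)) = grid k x" if "x \<in> \<Omega>" for x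
        using someI[of "\<lambda>z. z \<in> \<Omega> \<and> grid k z = grid k x" x] that by (auto simp: p_def)
      have close: "\<bar>\<eta> x - \<eta> (p (grid k x))\<bar> \<le> e'" if x: "x \<in> \<Omega>" for x
      proof -
        have "dist x (p (grid k x)) \<le> norm (grid k x - x) + norm (grid k (p (grid k x)) - p (grid k x))"
          unfolding p(2)[OF x] dist_norm using norm_triangle_ineq4[of "grid k x - p (grid k x)" "grid k x - x"] by simp
        also have "\<dots> \<le> DIM('a) / 2 ^ k + DIM('a) / 2 ^ k" by (intro add_mono grid_dist)
        also have "\<dots> < d" using k d(1) by (simp add: field_simps)
        finally have "dist (\<eta> x) (\<eta> (p (grid k x))) < e'"
          using x p(1)[OF x] closure_subset[of \<Omega>] by (intro d(2)) auto
        then show ?thesis by (simp add: dist_real_def)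
      qed
      let ?Y = "grid k ` \<Omega>"
      let ?s = "\<lambda>j. \<Sum>y\<in>?Y. \<eta> (p y) * F (\<sigma> j) (k, y, b)"
      have "convergent ?s"
      proof (rule convergent_sum)
        fix y assume "y \<in> ?Y"
        then have "(k, y, b) \<in> S" using b by (auto simp: S_def)
        then obtain l where "(\<lambda>n. F (\<sigma> n) (k, y, b)) \<longlonglongrightarrow> l" using \<sigma>(2) by blast
        then have "(\<lambda>n. \<eta> (p y) * F (\<sigma> n) (k, y, b)) \<longlonglongrightarrow> \<eta> (p y) * l" by (rule tendsto_mult_left)
        then show "convergent (\<lambda>n. \<eta> (p y) * F (\<sigma> n) (k, y, b))" by (rule convergentI)
      qed
      moreover have "\<bar>vdens \<Omega> (q (\<sigma> j)) b \<eta> - ?s j\<bar> \<le> e" for j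
      proof -
        let ?q = "\<lambda>x. q (\<sigma> j) x \<bullet> b"
        have i1: "integrable (lebesgue_on \<Omega>) (\<lambda>x. \<eta> x * ?q x)"
          using integrable_bounded_mult[OF qb \<eta>m, of B] \<eta>B by simp
        have i2: "integrable (lebesgue_on \<Omega>) (\<lambda>x. \<Sum>y\<in>?Y. \<eta> (p y) * (indicator (cell k y) x * ?q x))"
          using fi by auto
        have "?s j = ?I (\<lambda>x. \<Sum>y\<in>?Y. \<eta> (p y) * (indicator (cell k y) x * ?q x))"
          unfolding F_def prod.case using fi by (subst Bochner_Integration.integral_sum) auto
        then have "vdens \<Omega> (q (\<sigma> j)) b \<eta> - ?s j = ?I (\<lambda>x. \<eta> x * ?q x - (\<Sum>y\<in>?Y. \<eta> (p y) * (indicator (cell k y) x * ?q x)))"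
          using i1 i2 by (simp add: vdens_def)
        also have "norm \<dots> \<le> ?I (\<lambda>x. e' * norm (q (\<sigma> j) x))"
        proof (rule Bochner_Integration.integral_norm_bound_integral[OF Bochner_Integration.integrable_diff[OF i1 i2]])
          show "integrable (lebesgue_on \<Omega>) (\<lambda>x. e' * norm (q (\<sigma> j) x))" using q(1) by auto
          fix x assume "x \<in> space (lebesgue_on \<Omega>)"
          then have x: "x \<in> \<Omega>" by simp
          have "(\<Sum>y\<in>?Y. \<eta> (p y) * (indicator (cell k y) x * ?q x))
            = (\<Sum>y\<in>?Y. if y = grid k x then \<eta> (p y) * ?q x else 0)"
            by (intro sum.cong) (auto simp: cell_def)
          also have "\<dots> = \<eta> (p (grid k x)) * ?q x"
            using x finite_grid_image[OF \<Omega>(2), of k] by (subst sum.delta) auto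
          finally have "\<eta> x * ?q x - (\<Sum>y\<in>?Y. \<eta> (p y) * (indicator (cell k y) x * ?q x)) = (\<eta> x - \<eta> (p (grid k x))) * ?q x"
            by (simp add: left_diff_distrib)
          also have "norm \<dots> \<le> e' * norm (q (\<sigma> j) x)"
            unfolding real_norm_def abs_mult using close[OF x] norm1[OF b] e' by (intro mult_mono) auto
          finally show "norm (\<eta> x * ?q x - (\<Sum>y\<in>?Y. \<eta> (p y) * (indicator (cell k y) x * ?q x))) \<le> e' * norm (q (\<sigma> j) x)" .
        qed
        also have "\<dots> \<le> e' * C" using q(2)[of "\<sigma> j"] e' by simp
        finally show ?thesis using e'(2) by simp
      qed
      ultimately show "\<exists>s. convergent s \<and> (\<forall>j. \<bar>vdens \<Omega> (q (\<sigma> j)) b \<eta> - s j\<bar> \<le> e)"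
        by (intro exI[of _ ?s]) blast
    qed
  qed
qed

text \<open>The densities are linear functionals with the common bound C, and both properties
  survive pointwise limits. A point of \<Omega> serves to see that a bound B on |f| is
  nonnegative.\<close>

lemma vague_limit_vradon:
  fixes q :: "nat \<Rightarrow> 'a::euclidean_space \<Rightarrow> 'a"
  assumes \<Omega>: "open \<Omega>" "bounded \<Omega>" "\<Omega> \<noteq> {}"
    and q: "\<And>j. integrable (lebesgue_on \<Omega>) (q j)" "\<And>j. integral\<^sup>L (lebesgue_on \<Omega>) (\<lambda>x. norm (q j x)) \<le> C"
    and lim: "vaguely_tendsto (closure \<Omega>) (\<lambda>j. vdens \<Omega> (q j)) Q"
  shows "Q \<in> vradon (closure \<Omega>)"
  unfolding vradon_def radon_def
proof (intro CollectI ballI conjI allI impI exI)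
  fix b :: 'a assume b: "b \<in> Basis"
  have lim': "(\<lambda>j. vdens \<Omega> (q j) b \<eta>) \<longlonglongrightarrow> Q b \<eta>" if "continuous_on (closure \<Omega>) \<eta>" for \<eta>
    using lim b that by (simp add: vaguely_tendsto_def)
  have i: "integrable (lebesgue_on \<Omega>) (\<lambda>x. f x * (q j x \<bullet> b))" if f: "continuous_on (closure \<Omega>) f" for f :: "'a \<Rightarrow> real" and j
  proof -
    have "bounded (f ` closure \<Omega>)"
      using \<Omega>(2) by (intro compact_imp_bounded compact_continuous_image f) auto
    then obtain B where B: "\<forall>y\<in>f ` closure \<Omega>. norm y \<le> B" unfolding bounded_iff by blast
    have fB: "\<bar>f x\<bar> \<le> B" if "x \<in> space (lebesgue_on \<Omega>)" for x
      using B that closure_subset[of \<Omega>] by auto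
    have fm: "f \<in> borel_measurable (lebesgue_on \<Omega>)"
      using \<Omega>(1) by (intro continuous_imp_measurable_on_sets_lebesgue[OF continuous_on_subset[OF f closure_subset]]) (simp add: borel_open)
    show ?thesis using integrable_bounded_mult[OF integrable_inner_left[OF q(1)] fm fB] by simp
  qed
  {
    fix f g :: "'a \<Rightarrow> real" assume f: "continuous_on (closure \<Omega>) f" "continuous_on (closure \<Omega>) g"
    have "vdens \<Omega> (q j) b (\<lambda>x. f x + g x) = vdens \<Omega> (q j) b f + vdens \<Omega> (q j) b g" for j
      using i[OF f(1)] i[OF f(2)] by (simp add: vdens_def distrib_right)
    then have "(\<lambda>j. vdens \<Omega> (q j) b (\<lambda>x. f x + g x)) \<longlonglongrightarrow> Q b f + Q b g"
      using tendsto_add[OF lim'[OF f(1)] lim'[OF f(2)]] by simp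
    then show "Q b (\<lambda>x. f x + g x) = Q b f + Q b g"
      using LIMSEQ_unique[OF lim'[OF continuous_on_add[OF f]]] by blast
  }
  {
    fix c and f :: "'a \<Rightarrow> real" assume f: "continuous_on (closure \<Omega>) f"
    have "vdens \<Omega> (q j) b (\<lambda>x. c * f x) = c * vdens \<Omega> (q j) b f" for j
      by (simp add: vdens_def mult.assoc)
    then have "(\<lambda>j. vdens \<Omega> (q j) b (\<lambda>x. c * f x)) \<longlonglongrightarrow> c * Q b f"
      using tendsto_mult_left[OF lim'[OF f]] by simp
    then show "Q b (\<lambda>x. c * f x) = c * Q b f"
      using LIMSEQ_unique[OF lim'[OF continuous_on_mult_left[OF f]]] by blast
  }
  fix f :: "'a \<Rightarrow> real" and B assume f: "continuous_on (closure \<Omega>) f" "\<forall>x\<in>closure \<Omega>. \<bar>f x\<bar> \<le> B"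
  have "\<bar>vdens \<Omega> (q j) b f\<bar> \<le> C * B" for j
  proof -
    have "norm (vdens \<Omega> (q j) b f) \<le> integral\<^sup>L (lebesgue_on \<Omega>) (\<lambda>x. B * norm (q j x))"
      unfolding vdens_def
    proof (rule Bochner_Integration.integral_norm_bound_integral[OF i[OF f(1)]])
      show "integrable (lebesgue_on \<Omega>) (\<lambda>x. B * norm (q j x))" using q(1) by auto
      fix x assume "x \<in> space (lebesgue_on \<Omega>)"
      then have fx: "\<bar>f x\<bar> \<le> B" using f(2) closure_subset[of \<Omega>] by auto
      show "norm (f x * (q j x \<bullet> b)) \<le> B * norm (q j x)"
        unfolding real_norm_def abs_mult
        using fx Basis_le_norm[OF b] order_trans[OF abs_ge_zero fx] by (intro mult_mono) auto
    qed
    also have "\<dots> = B * integral\<^sup>L (lebesgue_on \<Omega>) (\<lambda>x. norm (q j x))" by simp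
    also have "\<dots> \<le> C * B"
    proof -
      obtain x where "x \<in> closure \<Omega>" using \<Omega>(3) closure_subset[of \<Omega>] by blast
      then have "B \<ge> 0" using f(2) by (intro order_trans[OF abs_ge_zero]) blast
      then show ?thesis using q(2)[of j] by (simp add: mult.commute mult_left_mono)
    qed
    finally show ?thesis by simp
  qed
  then show "\<bar>Q b f\<bar> \<le> C * B"
    using tendsto_rabs[OF lim'[OF f(1)]] by (intro LIMSEQ_le_const2) auto
qed

section \<open>Flux bounds in L^1 that are uniform in r, and convergence of the weights\<close>

context nonlinearity
begin

lemma Vr_L1_bound:
  assumes "q \<in> Vr \<Omega> r" "r > 1" and C: "integral\<^sup>L (lebesgue_on \<Omega>) (\<lambda>x. norm (q x) powr r) \<le> C"
  shows "integral\<^sup>L (lebesgue_on \<Omega>) (\<lambda>x. norm (q x)) \<le> C + measure (lebesgue_on \<Omega>) \<Omega>"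
proof -
  interpret finite_measure "lebesgue_on \<Omega>" by (rule finite_measure_\<Omega>)
  note i = Vr_integrable[OF assms(1,2)]
  have "integral\<^sup>L (lebesgue_on \<Omega>) (\<lambda>x. norm (q x)) \<le> integral\<^sup>L (lebesgue_on \<Omega>) (\<lambda>x. norm (q x) powr r + 1)"
  proof (rule integral_mono)
    fix x
    show "norm (q x) \<le> norm (q x) powr r + 1"
    proof (cases "norm (q x) \<le> 1")
      case False
      then have "norm (q x) powr 1 \<le> norm (q x) powr r" using assms(2) by (intro powr_mono) auto
      then show ?thesis using False by simp
    qed (simp add: add_increasing)
  qed (use i in auto)
  also have "\<dots> = integral\<^sup>L (lebesgue_on \<Omega>) (\<lambda>x. norm (q x) powr r) + measure (lebesgue_on \<Omega>) \<Omega>" using i by simp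
  finally show ?thesis using C by linarith
qed

lemma M_uniform_limit:
  assumes "uniform_limit (closure \<Omega>) w W sequentially"
  shows "uniform_limit (closure \<Omega>) (\<lambda>j. M (w j)) (M W) sequentially"
proof (rule uniform_limitI)
  fix e :: real assume e: "e > 0"
  have L1: "L + 1 > 0" using L by simp
  have "\<forall>\<^sub>F j in sequentially. \<forall>x\<in>closure \<Omega>. dist (w j x) (W x) < e / (L + 1)"
    by (rule uniform_limitD[OF assms divide_pos_pos[OF e L1]])
  then show "\<forall>\<^sub>F j in sequentially. \<forall>x\<in>closure \<Omega>. dist (M (w j) x) (M W x) < e"
  proof eventually_elim
    case (elim j)
    show ?case
    proof
      fix x assume x: "x \<in> closure \<Omega>"
      have "dist (M (w j) x) (M W x) \<le> L * dist (w j x) (W x)"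
        using M_lip[OF x] by (simp add: dist_real_def)
      also have "\<dots> \<le> (L + 1) * dist (w j x) (W x)" by (intro mult_right_mono) auto
      also have "\<dots> < (L + 1) * (e / (L + 1))" using elim x L1 by (intro mult_strict_left_mono) auto
      also have "\<dots> = e" using L1 by simp
      finally show "dist (M (w j) x) (M W x) < e" .
    qed
  qed
qed

end

subsection \<open>Passage to the limit in one time step\<close>

text \<open>One step along a sequence that already converges. Existence of the limits is assumed
  here, so that the final proof can interpret the locale for every step along one common
  subsequence.\<close>

locale limit_step = nonlinearity \<Omega> M k0 K L
  for \<Omega> :: "'a::euclidean_space set" and M k0 K L +
  fixes \<tau> :: real and U :: "'a \<Rightarrow> real" and r :: "nat \<Rightarrow> real"
    and w' w :: "nat \<Rightarrow> 'a \<Rightarrow> real" and q :: "nat \<Rightarrow> 'a \<Rightarrow> 'a"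
    and W' W :: "'a \<Rightarrow> real" and Q :: "'a vmeas" and C :: real
  assumes nonempty: "\<Omega> \<noteq> {}" and \<tau>: "\<tau> > 0" and U: "U \<in> Lspace \<Omega> 2"
    and r: "\<And>j. r j > 1" "r \<longlonglongrightarrow> 1"
    and sol: "\<And>j. step_solution \<Omega> M \<tau> U (r j) (w' j) (w j) (q j)"
    and C: "\<And>j. integral\<^sup>L (lebesgue_on \<Omega>) (\<lambda>x. norm (q j x) powr r j) \<le> C"
    and w'_lim: "uniform_limit (closure \<Omega>) w' W' sequentially"
    and w_lim: "uniform_limit (closure \<Omega>) w W sequentially"
    and q_lim: "vaguely_tendsto (closure \<Omega>) (\<lambda>j. vdens \<Omega> (q j)) Q"
begin

text \<open>The reciprocal of the conjugate exponent of \<open>r j\<close>, the small parameter of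
  the limit.\<close>

abbreviation "\<theta> j \<equiv> (r j - 1) / r j"

lemma \<theta>_lim: "\<theta> \<longlonglongrightarrow> 0"
proof -
  have "\<theta> \<longlonglongrightarrow> (1 - 1) / 1" by (intro tendsto_intros r) auto
  then show ?thesis by simp
qed

lemma \<theta>_bounds: "0 \<le> \<theta> j" "\<theta> j \<le> 1"
  using r(1)[of j] by auto

lemma C_nonneg: "0 \<le> C"
  by (rule order_trans[OF _ C[of 0]]) simp

lemma w_cont: "continuous_on (closure \<Omega>) (w j)" "continuous_on (closure \<Omega>) (w' j)"
  and w_frontier: "x \<in> frontier \<Omega> \<Longrightarrow> w j x = 0" and q_Vr: "q j \<in> Vr \<Omega> (r j)"
  using sol[of j] by (auto simp: step_solution_def)

lemma W_cont: "continuous_on (closure \<Omega>) W" "continuous_on (closure \<Omega>) W'"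
  by (rule uniform_limit_theorem[OF _ w_lim] uniform_limit_theorem[OF _ w'_lim]; simp add: w_cont)+

lemma frontier_closure: "x \<in> frontier \<Omega> \<Longrightarrow> x \<in> closure \<Omega>"
  by (simp add: frontier_def)

lemma W_frontier:
  assumes "x \<in> frontier \<Omega>"
  shows "W x = 0"
proof -
  have "(\<lambda>j. w j x) \<longlonglongrightarrow> W x" by (rule tendsto_uniform_limitI[OF w_lim frontier_closure[OF assms]])
  then show ?thesis using w_frontier[OF assms] by (simp add: LIMSEQ_const_iff)
qed

lemma w_close:
  assumes "\<delta> > 0"
  shows "\<forall>\<^sub>F j in sequentially. \<forall>x\<in>closure \<Omega>. \<bar>w j x - W x\<bar> \<le> \<delta>"
  using uniform_limitD[OF w_lim assms] by eventually_elim (auto simp: dist_real_def intro: less_imp_le)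

lemma integral_uniform_limit:
  fixes f :: "nat \<Rightarrow> 'a \<Rightarrow> real"
  assumes f: "uniform_limit (closure \<Omega>) f F sequentially" "\<And>j. continuous_on (closure \<Omega>) (f j)"
    and g: "integrable (lebesgue_on \<Omega>) g"
  shows "(\<lambda>j. integral\<^sup>L (lebesgue_on \<Omega>) (\<lambda>x. f j x * g x)) \<longlonglongrightarrow> integral\<^sup>L (lebesgue_on \<Omega>) (\<lambda>x. F x * g x)"
proof (rule LIMSEQ_I)
  fix e :: real assume e: "e > 0"
  let ?A = "integral\<^sup>L (lebesgue_on \<Omega>) (\<lambda>x. \<bar>g x\<bar>)"
  have A: "0 \<le> ?A" by simp
  define d where "d = e / (?A + 1)"
  have A1: "0 < ?A + 1" by (rule add_nonneg_pos) simp_all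
  have d: "d > 0" unfolding d_def by (rule divide_pos_pos[OF e A1])
  have dA: "d * ?A < e" 
  proof -
    have "d * ?A < d * (?A + 1)" using d by (intro mult_strict_left_mono) auto
    also have "\<dots> = e" unfolding d_def by (rule nonzero_eq_divide_eq[THEN iffD1, OF _ refl]) (use A1 in linarith)
    finally show ?thesis .
  qed
  have cF: "continuous_on (closure \<Omega>) F" by (rule uniform_limit_theorem[OF _ f(1)]) (simp_all add: f(2))
  have i: "integrable (lebesgue_on \<Omega>) (\<lambda>x. h x * g x)" if h: "continuous_on (closure \<Omega>) h" for h
  proof -
    obtain B where B: "\<And>x. x \<in> closure \<Omega> \<Longrightarrow> norm (h x) \<le> B" by (rule bounded_closure[OF h]) blast
    have "\<bar>h x\<bar> \<le> B" if "x \<in> space (lebesgue_on \<Omega>)" for x using B in_closure that by simp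
    from integrable_bounded_mult[OF g measurable_closure[OF h] this] show ?thesis by simp
  qed
  obtain N where N: "\<And>j x. j \<ge> N \<Longrightarrow> x \<in> closure \<Omega> \<Longrightarrow> dist (f j x) (F x) < d"
    using uniform_limitD[OF f(1) d] unfolding eventually_sequentially by blast
  show "\<exists>N. \<forall>j\<ge>N. norm (integral\<^sup>L (lebesgue_on \<Omega>) (\<lambda>x. f j x * g x) - integral\<^sup>L (lebesgue_on \<Omega>) (\<lambda>x. F x * g x)) < e"
  proof (intro exI allI impI)
    fix j assume j: "j \<ge> N"
    have "norm (integral\<^sup>L (lebesgue_on \<Omega>) (\<lambda>x. f j x * g x) - integral\<^sup>L (lebesgue_on \<Omega>) (\<lambda>x. F x * g x))
      = norm (integral\<^sup>L (lebesgue_on \<Omega>) (\<lambda>x. f j x * g x - F x * g x))"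
      using i[OF f(2)[of j]] i[OF cF] by simp
    also have "\<dots> \<le> integral\<^sup>L (lebesgue_on \<Omega>) (\<lambda>x. d * \<bar>g x\<bar>)"
    proof (rule Bochner_Integration.integral_norm_bound_integral)
      show "integrable (lebesgue_on \<Omega>) (\<lambda>x. f j x * g x - F x * g x)" using i[OF f(2)[of j]] i[OF cF] by simp
      show "integrable (lebesgue_on \<Omega>) (\<lambda>x. d * \<bar>g x\<bar>)" using g by simp
      fix x assume "x \<in> space (lebesgue_on \<Omega>)"
      then have "x \<in> closure \<Omega>" using in_closure by simp
      then have le: "\<bar>f j x - F x\<bar> \<le> d" using N[OF j, of x] by (simp add: dist_real_def)
      have "norm (f j x * g x - F x * g x) = \<bar>f j x - F x\<bar> * \<bar>g x\<bar>"
        by (simp add: left_diff_distrib[symmetric] abs_mult)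
      also have "\<dots> \<le> d * \<bar>g x\<bar>" using le by (intro mult_right_mono) auto
      finally show "norm (f j x * g x - F x * g x) \<le> d * \<bar>g x\<bar>" .
    qed
    also have "\<dots> < e" using dA by simp
    finally show "norm (integral\<^sup>L (lebesgue_on \<Omega>) (\<lambda>x. f j x * g x) - integral\<^sup>L (lebesgue_on \<Omega>) (\<lambda>x. F x * g x)) < e" .
  qed
qed

lemma L2_inner_uniform_limit:
  fixes f :: "nat \<Rightarrow> 'a \<Rightarrow> real"
  assumes "uniform_limit (closure \<Omega>) f F sequentially" "\<And>j. continuous_on (closure \<Omega>) (f j)" "g \<in> Lspace \<Omega> 2"
  shows "(\<lambda>j. L2_inner \<Omega> (f j) g) \<longlonglongrightarrow> L2_inner \<Omega> F g"
  using integral_uniform_limit[OF assms(1,2) Lspace2_integrable[OF assms(3) \<Omega>_lmeasurable]]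
  by (simp add: L2_inner_def)

lemma L2_inner_uniform_limit2:
  fixes f :: "nat \<Rightarrow> 'a \<Rightarrow> real"
  assumes f: "uniform_limit (closure \<Omega>) f F sequentially" "\<And>j. continuous_on (closure \<Omega>) (f j)"
    and g: "uniform_limit (closure \<Omega>) g G sequentially" "\<And>j. continuous_on (closure \<Omega>) (g j)"
  shows "(\<lambda>j. L2_inner \<Omega> (f j) (g j)) \<longlonglongrightarrow> L2_inner \<Omega> F G"
proof -
  interpret finite_measure "lebesgue_on \<Omega>" by (rule finite_measure_\<Omega>)
  have cF: "continuous_on (closure \<Omega>) F" by (rule uniform_limit_theorem[OF _ f(1)]) (simp_all add: f(2))
  have cG: "continuous_on (closure \<Omega>) G" by (rule uniform_limit_theorem[OF _ g(1)]) (simp_all add: g(2))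
  have b: "bounded (h ` closure \<Omega>)" if "continuous_on (closure \<Omega>) h" for h :: "'a \<Rightarrow> real"
    using \<Omega>(2) by (intro compact_imp_bounded compact_continuous_image that) auto
  have "uniform_limit (closure \<Omega>) (\<lambda>j x. f j x * g j x) (\<lambda>x. F x * G x) sequentially"
    by (rule uniform_lim_mult[OF f(1) g(1) b[OF cF] b[OF cG]])
  moreover have "continuous_on (closure \<Omega>) (\<lambda>x. f j x * g j x)" for j by (intro continuous_intros f(2) g(2))
  ultimately have "(\<lambda>j. integral\<^sup>L (lebesgue_on \<Omega>) (\<lambda>x. f j x * g j x * 1)) \<longlonglongrightarrow> integral\<^sup>L (lebesgue_on \<Omega>) (\<lambda>x. F x * G x * 1)"
    by (rule integral_uniform_limit) simp
  then show ?thesis by (simp add: L2_inner_def)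
qed

subsubsection \<open>The divergence\<close>

abbreviation "u j \<equiv> divergence \<Omega> (vdens \<Omega> (q j))"

text \<open>The value that the limit balance forces on the divergence of Q;
  \<open>Q_divergence\<close> confirms it.\<close>

definition V :: "'a \<Rightarrow> real" where "V x = U x - (W x - W' x) / \<tau>"

lemma u_divergence: "is_divergence \<Omega> (vdens \<Omega> (q j)) (u j)"
proof -
  obtain v where "is_divergence \<Omega> (vdens \<Omega> (q j)) v" using q_Vr[of j] by (auto simp: Vr_def)
  then show ?thesis by (rule divergence_eq(1)[OF \<Omega>])
qed

text \<open>Spelled out as nested combinations of two terms to match \<open>Lspace2_linear\<close>
  and \<open>L2_inner_linear\<close>.\<close>

lemma V_eq: "V = (\<lambda>x. 1 * U x + (- 1) * ((1 / \<tau>) * W x + (- (1 / \<tau>)) * W' x))"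
  by (rule ext) (simp add: V_def diff_divide_distrib)

lemma V_L2: "V \<in> Lspace \<Omega> 2"
  unfolding V_eq by (intro Lspace2_linear U Lspace_closure W_cont)

lemma V_inner:
  assumes "\<eta> \<in> Lspace \<Omega> 2"
  shows "L2_inner \<Omega> V \<eta> = L2_inner \<Omega> U \<eta> - (L2_inner \<Omega> W \<eta> - L2_inner \<Omega> W' \<eta>) / \<tau>"
proof -
  have "L2_inner \<Omega> V \<eta> = 1 * L2_inner \<Omega> U \<eta> + (- 1) * L2_inner \<Omega> (\<lambda>x. (1 / \<tau>) * W x + (- (1 / \<tau>)) * W' x) \<eta>"
    unfolding V_eq by (intro L2_inner_linear Lspace2_linear U Lspace_closure W_cont assms)
  also have "L2_inner \<Omega> (\<lambda>x. (1 / \<tau>) * W x + (- (1 / \<tau>)) * W' x) \<eta> = (1 / \<tau>) * L2_inner \<Omega> W \<eta> + (- (1 / \<tau>)) * L2_inner \<Omega> W' \<eta>"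
    by (intro L2_inner_linear Lspace_closure W_cont assms)
  finally show ?thesis by (simp add: diff_divide_distrib)
qed

lemma u_inner:
  assumes "\<eta> \<in> Lspace \<Omega> 2"
  shows "L2_inner \<Omega> (u j) \<eta> = L2_inner \<Omega> U \<eta> - (L2_inner \<Omega> (w j) \<eta> - L2_inner \<Omega> (w' j) \<eta>) / \<tau>"
proof -
  have "L2_inner \<Omega> (\<lambda>x. (w j x - w' j x) / \<tau>) \<eta> + L2_inner \<Omega> (u j) \<eta> = L2_inner \<Omega> U \<eta>"
    using sol[of j] assms by (simp add: step_solution_def)
  moreover have "L2_inner \<Omega> (\<lambda>x. (1 / \<tau>) * w j x + (- (1 / \<tau>)) * w' j x) \<eta> 
      = (1 / \<tau>) * L2_inner \<Omega> (w j) \<eta> + (- (1 / \<tau>)) * L2_inner \<Omega> (w' j) \<eta>"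
    by (intro L2_inner_linear Lspace_closure w_cont assms)
  moreover have "(\<lambda>x. (w j x - w' j x) / \<tau>) = (\<lambda>x. (1 / \<tau>) * w j x + (- (1 / \<tau>)) * w' j x)"
    by (rule ext) (simp add: diff_divide_distrib)
  ultimately show ?thesis by (simp add: diff_divide_distrib)
qed

lemma u_weak_limit:
  assumes "\<eta> \<in> Lspace \<Omega> 2"
  shows "(\<lambda>j. L2_inner \<Omega> (u j) \<eta>) \<longlonglongrightarrow> L2_inner \<Omega> V \<eta>"
  unfolding u_inner[OF assms] V_inner[OF assms]
  using \<tau> by (intro tendsto_intros L2_inner_uniform_limit w_lim w'_lim w_cont assms) simp

text \<open>Both factors vary with j. The balance trades the divergences for w and w', which
  converge uniformly, so every product can be passed to the limit.\<close>

lemma u_w_limit: "(\<lambda>j. L2_inner \<Omega> (u j) (w j)) \<longlonglongrightarrow> L2_inner \<Omega> V W"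
proof -
  have "(\<lambda>j. L2_inner \<Omega> (w j) U) \<longlonglongrightarrow> L2_inner \<Omega> W U"
    by (intro L2_inner_uniform_limit w_lim w_cont U)
  then have UW: "(\<lambda>j. L2_inner \<Omega> U (w j)) \<longlonglongrightarrow> L2_inner \<Omega> U W"
    by (simp add: L2_inner_commute[of \<Omega> U])
  have ww: "(\<lambda>j. L2_inner \<Omega> (w j) (w j)) \<longlonglongrightarrow> L2_inner \<Omega> W W"
    and w'w: "(\<lambda>j. L2_inner \<Omega> (w' j) (w j)) \<longlonglongrightarrow> L2_inner \<Omega> W' W"
    by (intro L2_inner_uniform_limit2 w_lim w'_lim w_cont)+
  show ?thesis
    unfolding u_inner[OF Lspace_closure[OF w_cont(1)]] V_inner[OF Lspace_closure[OF W_cont(1)]]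
    by (rule tendsto_diff[OF UW tendsto_divide[OF tendsto_diff[OF ww w'w] tendsto_const]]) (use \<tau> in simp)
qed

text \<open>The gradient of a test function is continuous on the closure, so vague convergence
  handles one side of the identity and weak convergence of the divergences the other.\<close>

lemma Q_divergence: "is_divergence \<Omega> Q V"
proof -
  have "vpair Q D = - L2_inner \<Omega> V \<phi>" if t: "C1_test \<Omega> \<phi> D" for \<phi> D
  proof -
    have cD: "continuous_on (closure \<Omega>) D"
      by (rule continuous_on_subset[OF _ subset_UNIV]) (use t in \<open>simp add: C1_test_def\<close>)
    have "(\<lambda>j. vpair (vdens \<Omega> (q j)) D) \<longlonglongrightarrow> vpair Q D"
      unfolding vpair_def using q_lim cD
      by (intro tendsto_sum) (simp add: vaguely_tendsto_def continuous_on_inner)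
    moreover have "vpair (vdens \<Omega> (q j)) D = - L2_inner \<Omega> (u j) \<phi>" for j
      using u_divergence[of j] t unfolding is_divergence_def by blast
    moreover have "(\<lambda>j. - L2_inner \<Omega> (u j) \<phi>) \<longlonglongrightarrow> - L2_inner \<Omega> V \<phi>"
      by (intro tendsto_minus u_weak_limit C1_test_Lspace[OF t \<Omega>_lmeasurable])
    ultimately show ?thesis by (simp add: LIMSEQ_unique)
  qed
  then show ?thesis using V_L2 by (simp add: is_divergence_def)
qed

lemma q_L1:
  shows "integrable (lebesgue_on \<Omega>) (q j)"
    "integral\<^sup>L (lebesgue_on \<Omega>) (\<lambda>x. norm (q j x)) \<le> C + measure (lebesgue_on \<Omega>) \<Omega>"
  by (rule Vr_integrable(3)[OF q_Vr r(1)]) (rule Vr_L1_bound[OF q_Vr r(1) C])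

lemma Q_vradon: "Q \<in> vradon (closure \<Omega>)"
  by (rule vague_limit_vradon[OF \<Omega> nonempty q_L1 q_lim])

lemma Q_VM: "Q \<in> VM \<Omega>"
  using Q_vradon Q_divergence by (auto simp: VM_def)

subsubsection \<open>The total variation of the limit flux\<close>

text \<open>To reach the energy of step j, the limit weight is replaced by that of
  \<open>w j\<close> at cost L \<delta>, and |q| by |q|^r + \<theta>. The remainders vanish when j
  tends to infinity and then \<delta> to 0.\<close>

lemma flux_pairing_bound:
  assumes \<psi>: "continuous_on (closure \<Omega>) \<psi>" "\<And>x. x \<in> closure \<Omega> \<Longrightarrow> norm (\<psi> x) \<le> M W x"
    and \<delta>: "\<delta> > 0" and close: "\<forall>x\<in>closure \<Omega>. \<bar>w j x - W x\<bar> \<le> \<delta>"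
  shows "vpair (vdens \<Omega> (q j)) \<psi>
    \<le> L2_inner \<Omega> (u j) (w j) + L * \<delta> * C + (K + L * \<delta>) * \<theta> j * measure (lebesgue_on \<Omega>) \<Omega>"
proof -
  interpret finite_measure "lebesgue_on \<Omega>" by (rule finite_measure_\<Omega>)
  let ?I = "integral\<^sup>L (lebesgue_on \<Omega>)"
  note i = Vr_integrable[OF q_Vr r(1), of j]
  have i1: "integrable (lebesgue_on \<Omega>) (\<lambda>x. (\<psi> x \<bullet> b) * (q j x \<bullet> b))" for b
  proof -
    have c: "continuous_on (closure \<Omega>) (\<lambda>x. \<psi> x \<bullet> b)" by (intro continuous_intros \<psi>)
    obtain B where B: "\<And>x. x \<in> closure \<Omega> \<Longrightarrow> norm (\<psi> x \<bullet> b) \<le> B" by (rule bounded_closure[OF c]) blast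
    have "\<bar>\<psi> x \<bullet> b\<bar> \<le> B" if "x \<in> space (lebesgue_on \<Omega>)" for x using B in_closure that by simp
    from integrable_bounded_mult[OF integrable_inner_left[OF i(3)] measurable_closure[OF c] this]
    show ?thesis by simp
  qed
  have iE: "integrable (lebesgue_on \<Omega>) (\<lambda>x. M (w j) x * norm (q j x) powr r j)" by (rule step_energy(1)[OF sol r(1)])
  have "vpair (vdens \<Omega> (q j)) \<psi> = ?I (\<lambda>x. \<Sum>b\<in>Basis. (\<psi> x \<bullet> b) * (q j x \<bullet> b))"
    unfolding vpair_def vdens_def by (rule Bochner_Integration.integral_sum[symmetric]) (rule i1)
  also have "\<dots> \<le> ?I (\<lambda>x. M (w j) x * norm (q j x) powr r j + L * \<delta> * norm (q j x) powr r j + (K + L * \<delta>) * \<theta> j)"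
  proof (rule integral_mono)
    show "integrable (lebesgue_on \<Omega>) (\<lambda>x. \<Sum>b\<in>Basis. (\<psi> x \<bullet> b) * (q j x \<bullet> b))" using i1 by auto
    show "integrable (lebesgue_on \<Omega>) (\<lambda>x. M (w j) x * norm (q j x) powr r j + L * \<delta> * norm (q j x) powr r j + (K + L * \<delta>) * \<theta> j)"
      using iE i(2) by auto
    fix x assume "x \<in> space (lebesgue_on \<Omega>)"
    then have x: "x \<in> closure \<Omega>" using in_closure by simp
    let ?n = "norm (q j x)"
    have "(\<Sum>b\<in>Basis. (\<psi> x \<bullet> b) * (q j x \<bullet> b)) = \<psi> x \<bullet> q j x" by (rule euclidean_inner[symmetric])
    also have "\<dots> \<le> norm (\<psi> x) * ?n" by (rule norm_cauchy_schwarz)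
    also have "\<dots> \<le> (M (w j) x + L * \<delta>) * (?n powr r j + \<theta> j)"
    proof (rule mult_mono)
      have "\<bar>M W x - M (w j) x\<bar> \<le> L * \<bar>W x - w j x\<bar>" by (rule M_lip[OF x])
      also have "\<dots> \<le> L * \<delta>" using close x L by (intro mult_left_mono) (auto simp: abs_minus_commute)
      finally show "norm (\<psi> x) \<le> M (w j) x + L * \<delta>" using \<psi>(2)[OF x] by linarith
      show "?n \<le> ?n powr r j + \<theta> j"
      proof (cases "?n = 0")
        case False
        have rj: "r j > 1" by (rule r)
        \<comment> \<open>Young's inequality for |q|^r and 1 with the weights 1 / r and \<theta>,
          whose sum is 1.\<close>
        have "(?n powr r j) powr (1 / r j) * 1 powr (\<theta> j) \<le> (1 / r j) * (?n powr r j) + \<theta> j * 1"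
          using False rj \<theta>_bounds by (intro Youngs_inequality_0) (auto simp: diff_divide_distrib)
        also have "(1 / r j) * (?n powr r j) \<le> 1 * (?n powr r j)"
          using rj by (intro mult_right_mono) auto
        finally show ?thesis using rj by (simp add: powr_powr)
      qed (use \<theta>_bounds in simp)
      show "0 \<le> M (w j) x + L * \<delta>" using M_ge[OF x, of "w j"] k0 L \<delta> by simp
    qed simp
    also have "\<dots> = M (w j) x * ?n powr r j + L * \<delta> * ?n powr r j + (M (w j) x + L * \<delta>) * \<theta> j"
      by (simp add: algebra_simps)
    also have "\<dots> \<le> M (w j) x * ?n powr r j + L * \<delta> * ?n powr r j + (K + L * \<delta>) * \<theta> j"
      using M_le[OF x] \<theta>_bounds by (intro add_left_mono mult_right_mono add_right_mono) auto
    finally show "(\<Sum>b\<in>Basis. (\<psi> x \<bullet> b) * (q j x \<bullet> b)) \<le> M (w j) x * ?n powr r j + L * \<delta> * ?n powr r j + (K + L * \<delta>) * \<theta> j" .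
  qed
  also have "\<dots> = ?I (\<lambda>x. M (w j) x * norm (q j x) powr r j) + L * \<delta> * ?I (\<lambda>x. norm (q j x) powr r j) 
      + (K + L * \<delta>) * \<theta> j * measure (lebesgue_on \<Omega>) \<Omega>"
    using iE i(2) by (simp add: mult.commute)
  also have "\<dots> \<le> L2_inner \<Omega> (u j) (w j) + L * \<delta> * C + (K + L * \<delta>) * \<theta> j * measure (lebesgue_on \<Omega>) \<Omega>"
    unfolding step_energy(2)[OF sol r(1)] using mult_left_mono[OF C[of j], of "L * \<delta>"] L \<delta> by simp
  finally show ?thesis .
qed

text \<open>Lower semicontinuity of a supremum: each pairing with a fixed admissible field \<psi>
  converges, so a bound in the limit for every \<psi> bounds the total variation.\<close>

lemma total_variation_Q_le: "total_variation (closure \<Omega>) Q (M W) \<le> L2_inner \<Omega> V W"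
proof (rule total_variation_le[OF Q_vradon])
  show "0 \<le> M W x" if "x \<in> closure \<Omega>" for x using M_ge[OF that, of W] k0 by simp
  fix \<psi> :: "'a \<Rightarrow> 'a" assume \<psi>: "continuous_on (closure \<Omega>) \<psi>" "\<And>x. x \<in> closure \<Omega> \<Longrightarrow> norm (\<psi> x) \<le> M W x"
  let ?\<mu> = "measure (lebesgue_on \<Omega>) \<Omega>"
  have lim: "(\<lambda>j. vpair (vdens \<Omega> (q j)) \<psi>) \<longlonglongrightarrow> vpair Q \<psi>"
    unfolding vpair_def using q_lim \<psi>(1)
    by (intro tendsto_sum) (simp add: vaguely_tendsto_def continuous_on_inner)
  have *: "vpair Q \<psi> \<le> L2_inner \<Omega> V W + L * \<delta> * C" if "\<delta> > 0" for \<delta>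
  proof (rule tendsto_le[OF _ _ lim])
    have "(\<lambda>j. L2_inner \<Omega> (u j) (w j) + L * \<delta> * C + (K + L * \<delta>) * \<theta> j * ?\<mu>)
      \<longlonglongrightarrow> L2_inner \<Omega> V W + L * \<delta> * C + (K + L * \<delta>) * 0 * ?\<mu>"
      by (intro tendsto_intros u_w_limit \<theta>_lim)
    then show "(\<lambda>j. L2_inner \<Omega> (u j) (w j) + L * \<delta> * C + (K + L * \<delta>) * \<theta> j * ?\<mu>)
      \<longlonglongrightarrow> L2_inner \<Omega> V W + L * \<delta> * C" by simp
    show "\<forall>\<^sub>F j in sequentially. vpair (vdens \<Omega> (q j)) \<psi> \<le> L2_inner \<Omega> (u j) (w j) + L * \<delta> * C + (K + L * \<delta>) * \<theta> j * ?\<mu>"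
      using w_close[OF that] by eventually_elim (rule flux_pairing_bound[OF \<psi> that])
  qed simp
  show "vpair Q \<psi> \<le> L2_inner \<Omega> V W"
  proof (rule field_le_epsilon)
    fix e :: real assume e: "e > 0"
    \<comment> \<open>The tolerance is taken as e / (L C + 1), the summand 1 because L C may be
      0.\<close>
    have p: "L * C + 1 > 0" using L C_nonneg by (simp add: add_nonneg_pos)
    have "vpair Q \<psi> \<le> L2_inner \<Omega> V W + L * (e / (L * C + 1)) * C" using e p by (intro *) simp
    also have "L * (e / (L * C + 1)) * C = e * ((L * C) / (L * C + 1))" by simp
    also have "\<dots> \<le> e * 1" using e p by (intro mult_left_mono) auto
    finally show "vpair Q \<psi> \<le> L2_inner \<Omega> V W + e" by simp
  qed
qed

subsubsection \<open>The gradient constraint for the limit\<close>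

abbreviation "Z \<equiv> zext \<Omega> W"

lemma Z_cont: "continuous_on UNIV Z"
  by (rule continuous_on_zext[OF \<Omega>(1) W_cont(1) W_frontier])

lemma Z_outside: "x \<notin> \<Omega> \<Longrightarrow> Z x = 0"
  by (simp add: zext_def)

text \<open>Three limits in a fixed order. First j tends to infinity with h and \<delta> fixed, so
  that \<theta> times the constant c vanishes although c blows up for small h; then \<delta> tends
  to 0, which removes the uniform error in w; finally h tends to 0, which removes the
  mollification.\<close>

lemma Z_local_lipschitz:
  assumes h0: "h0 > 0" and m: "m \<ge> 0"
    and le: "\<And>u z. u \<in> \<Omega> \<Longrightarrow> z \<in> closed_segment x y \<Longrightarrow> norm (u - z) < h0 \<Longrightarrow> M W u \<le> m"
  shows "\<bar>Z x - Z y\<bar> \<le> m * norm (x - y)"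
proof -
  have conv_le: "\<bar>conv h Z x - conv h Z y\<bar> \<le> m * norm (x - y)" if h: "0 < h" "h < h0" for h
  proof -
    \<comment> \<open>The bound of \<open>flux_potential_bound\<close> is used with a = 1: then a
      powr \<theta> = 1, and the whole dependence on h sits in c.\<close>
    define c where "c = C / (1 * (h ^ DIM('a) * bump_mass TYPE('a)))"
    have *: "\<bar>conv h Z x - conv h Z y\<bar> \<le> (m + L * \<delta>) * norm (x - y) + 2 * \<delta>" if \<delta>: "\<delta> > 0" for \<delta>
    proof -
      have m\<delta>: "m + L * \<delta> \<ge> 0" using m L \<delta> by simp
      have "\<forall>\<^sub>F j in sequentially. \<bar>conv h Z x - conv h Z y\<bar> \<le> (m + L * \<delta>) * (1 + \<theta> j * c) * norm (x - y) + 2 * \<delta>"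
        using w_close[OF \<delta>]
      proof eventually_elim
        case (elim j)
        let ?z = "zext \<Omega> (w j)"
        let ?G = "\<lambda>u. (- (M (w j) u * norm (q j u) powr (r j - 2))) *\<^sub>R q j u"
        note z = step_zero_ext_gradient[OF sol r(1), of j]
        have cz: "continuous_on UNIV ?z" by (rule continuous_on_zext[OF \<Omega>(1) w_cont(1) w_frontier])
        have "\<bar>conv h ?z x - conv h ?z y\<bar> \<le> (m + L * \<delta>) * (1 + \<theta> j * c) * norm (x - y)"
        proof (rule conv_lipschitz[OF z \<Omega>_sets \<Omega>(2) h(1)])
          fix p assume p: "p \<in> closed_segment x y"
          have "integral\<^sup>L (lebesgue_on \<Omega>) (\<lambda>u. moll h (u - p) * norm (?G u))
            = integral\<^sup>L (lebesgue_on \<Omega>) (\<lambda>u. moll h (u - p) * (M (w j) u * norm (q j u) powr (r j - 1)))"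
            unfolding norm_flux using M_ge[OF in_closure] k0
            by (intro Bochner_Integration.integral_cong refl) (simp add: order_trans[OF less_imp_le])
          also have "\<dots> \<le> (m + L * \<delta>) * 1 powr \<theta> j * (1 + \<theta> j * C / (1 * (h ^ DIM('a) * bump_mass TYPE('a))))"
          proof (rule flux_potential_bound[OF r(1) \<Omega>_sets h(1) _ Vr_integrable(1,2)[OF q_Vr r(1)] C measurable_closure[OF M_cont[OF w_cont(1)]]])
            fix u assume u: "u \<in> \<Omega>"
            show "0 \<le> M (w j) u" using M_ge[OF in_closure[OF u], of "w j"] k0 by simp
            assume "norm (u - p) < h"
            then have "M W u \<le> m" using le[OF u p] h by simp
            moreover have "\<bar>M (w j) u - M W u\<bar> \<le> L * \<bar>w j u - W u\<bar>" by (rule M_lip[OF in_closure[OF u]])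
            moreover have "L * \<bar>w j u - W u\<bar> \<le> L * \<delta>" using elim in_closure[OF u] L by (intro mult_left_mono) auto
            ultimately show "M (w j) u \<le> m + L * \<delta>" by linarith
          qed (use m\<delta> in auto)
          also have "\<dots> = (m + L * \<delta>) * (1 + \<theta> j * c)" by (simp add: c_def)
          finally show "integral\<^sup>L (lebesgue_on \<Omega>) (\<lambda>u. moll h (u - p) * norm (?G u)) \<le> (m + L * \<delta>) * (1 + \<theta> j * c)" .
        qed
        moreover have "\<bar>conv h Z p - conv h ?z p\<bar> \<le> \<delta>" for p
        proof (rule conv_diff_bound[OF Z_cont cz h(1)])
          fix v
          show "\<bar>Z (p + v) - ?z (p + v)\<bar> \<le> \<delta>"
            using elim in_closure[of "p + v"] \<delta> by (auto simp: zext_def abs_minus_commute)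
        qed
        note this[of x] this[of y]
        moreover have "\<bar>a - b\<bar> \<le> B + 2 * \<delta>" if "\<bar>a' - b'\<bar> \<le> B" "\<bar>a - a'\<bar> \<le> \<delta>" "\<bar>b - b'\<bar> \<le> \<delta>" for a b a' b' B :: real
          using that by linarith
        ultimately show ?case by blast
      qed
      moreover have "(\<lambda>j. (m + L * \<delta>) * (1 + \<theta> j * c) * norm (x - y) + 2 * \<delta>) \<longlonglongrightarrow> (m + L * \<delta>) * (1 + 0 * c) * norm (x - y) + 2 * \<delta>"
        by (intro tendsto_intros \<theta>_lim)
      ultimately have "\<bar>conv h Z x - conv h Z y\<bar> \<le> (m + L * \<delta>) * (1 + 0 * c) * norm (x - y) + 2 * \<delta>"
        by (intro tendsto_lowerbound) auto
      then show ?thesis by simp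
    qed
    have "((\<lambda>\<delta>. (m + L * \<delta>) * norm (x - y) + 2 * \<delta>) \<longlongrightarrow> (m + L * 0) * norm (x - y) + 2 * 0) (at_right 0)"
      by (intro tendsto_intros)
    moreover have "\<forall>\<^sub>F \<delta> in at_right 0. \<bar>conv h Z x - conv h Z y\<bar> \<le> (m + L * \<delta>) * norm (x - y) + 2 * \<delta>"
      unfolding eventually_at_right_field using * by (intro exI[of _ 1]) auto
    ultimately have "\<bar>conv h Z x - conv h Z y\<bar> \<le> (m + L * 0) * norm (x - y) + 2 * 0"
      by (intro tendsto_lowerbound) auto
    then show ?thesis by simp
  qed
  have "((\<lambda>h. \<bar>conv h Z x - conv h Z y\<bar>) \<longlongrightarrow> \<bar>Z x - Z y\<bar>) (at_right 0)"
    by (intro tendsto_intros conv_tendsto Z_cont)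
  moreover have "\<forall>\<^sub>F h in at_right 0. \<bar>conv h Z x - conv h Z y\<bar> \<le> m * norm (x - y)"
    unfolding eventually_at_right_field using conv_le h0 by (intro exI[of _ h0]) auto
  ultimately show ?thesis by (intro tendsto_upperbound) auto
qed

text \<open>With the global bound M \<le> K the local estimate holds between any two points, so the
  zero extension is Lipschitz on the whole space and has a bounded weak gradient.\<close>

lemma W_W10: "W \<in> W10 \<Omega> \<infinity>"
proof -
  have "\<bar>Z x - Z y\<bar> \<le> K * norm (x - y)" for x y
    by (rule Z_local_lipschitz[of 1]) (use K M_le in_closure in auto)
  then have Z: "Z \<in> W10 \<Omega> \<infinity>" by (intro lipschitz_W10_infinity[OF \<Omega> Z_outside _ Z_cont])
  have WZ: "W x = Z x" if "x \<in> \<Omega>" for x using that by (simp add: zext_def)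
  have "W \<in> Lspace \<Omega> \<infinity>" by (rule Lspace_closure[OF W_cont(1)])
  moreover have "weak_gradient \<Omega> W g" if "weak_gradient \<Omega> Z g" for g
  proof -
    have "integral\<^sup>L (lebesgue_on \<Omega>) (\<lambda>x. W x *\<^sub>R D x) = integral\<^sup>L (lebesgue_on \<Omega>) (\<lambda>x. Z x *\<^sub>R D x)" for D :: "'a \<Rightarrow> 'a"
      by (intro Bochner_Integration.integral_cong refl) (simp add: WZ)
    then show ?thesis using that by (simp add: weak_gradient_def)
  qed
  ultimately show ?thesis using Z W_cont(1) W_frontier by (auto simp: W10_def W1_def)
qed

text \<open>The gradient of the mollified function at x depends only on values near x, and there the
  weight exceeds its value at x by less than e by uniform continuity. Thresholding preserves the
  local Lipschitz bound of Z, and averaging does as well.\<close>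

lemma constrained_test_function:
  assumes e: "e > 0"
  obtains \<phi> D where "C1_test \<Omega> \<phi> D" "\<And>x. \<bar>\<phi> x - Z x\<bar> \<le> e" "\<And>x. x \<in> closure \<Omega> \<Longrightarrow> norm (D x) \<le> M W x + e"
proof -
  obtain v h0 where v: "h0 > 0" "continuous_on UNIV v" "\<And>x y. \<bar>v x - v y\<bar> \<le> \<bar>Z x - Z y\<bar>"
    "\<And>h. 0 < h \<Longrightarrow> h < h0 \<Longrightarrow> \<exists>D. C1_test \<Omega> (conv h v) D"
    "\<And>h x. 0 < h \<Longrightarrow> h < h0 \<Longrightarrow> \<bar>conv h v x - Z x\<bar> \<le> e"
    by (rule test_function_approx[OF \<Omega> Z_cont Z_outside e]) blast+
  have "uniformly_continuous_on (closure \<Omega>) (M W)"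
    using \<Omega>(2) by (intro compact_uniformly_continuous M_cont W_cont) auto
  from this[unfolded uniformly_continuous_on_def, rule_format, OF e]
  obtain d where d: "d > 0" "\<And>x y. x \<in> closure \<Omega> \<Longrightarrow> y \<in> closure \<Omega> \<Longrightarrow> dist y x < d \<Longrightarrow> dist (M W y) (M W x) < e" by blast
  \<comment> \<open>Segments between the shifted points y + p and x + p stay within 2 h of x, and
    the local Lipschitz estimate looks another h further; hence 3 h < d.\<close>
  define h where "h = min (h0 / 2) (d / 4)"
  have h: "0 < h" "h < h0" "3 * h < d" using v(1) d(1) unfolding h_def by auto
  obtain D where D: "C1_test \<Omega> (conv h v) D" using v(4)[OF h(1,2)] by blast
  show thesis
  proof (rule that[OF D v(5)[OF h(1,2)]])
    fix x assume x: "x \<in> closure \<Omega>"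
    let ?m = "M W x + e"
    have m: "?m \<ge> 0" using M_ge[OF x, of W] k0 e by simp
    show "norm (D x) \<le> ?m"
    proof (rule GDERIV_bound[OF _ h(1) m])
      show "GDERIV (conv h v) x :> D x" using D by (simp add: C1_test_def)
      fix y assume y: "dist y x < h"
      show "\<bar>conv h v y - conv h v x\<bar> \<le> ?m * dist y x"
      proof (rule conv_diff_bound[OF v(2) v(2) h(1)])
        fix p :: 'a assume p: "norm p < h"
        have "\<bar>Z (y + p) - Z (x + p)\<bar> \<le> ?m * norm ((y + p) - (x + p))"
        proof (rule Z_local_lipschitz[OF h(1) m])
          fix u z assume u: "u \<in> \<Omega>" and z: "z \<in> closed_segment (y + p) (x + p)" and uz: "norm (u - z) < h"
          have "norm (y - x + p) < 2 * h"
            using y p norm_triangle_ineq[of "y - x" p] by (simp add: dist_norm)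
          then have "dist (y + p) x < 2 * h" by (simp add: dist_norm algebra_simps)
          moreover have "dist (x + p) x < 2 * h" using p h(1) by (simp add: dist_norm)
          ultimately have "y + p \<in> ball x (2 * h)" "x + p \<in> ball x (2 * h)" by (simp_all add: dist_commute)
          then have "z \<in> ball x (2 * h)" using z closed_segment_subset[OF _ _ convex_ball] by blast
          then have "dist u x < d" using uz h(3) dist_triangle[of u x z] by (simp add: dist_norm norm_minus_commute)
          then show "M W u \<le> ?m" using d(2)[OF x in_closure[OF u]] by (simp add: dist_real_def)
        qed
        then show "\<bar>v (y + p) - v (x + p)\<bar> \<le> ?m * dist y x" using v(3)[of "y + p" "x + p"] by (simp add: dist_norm)
      qed
    qed
  qed
qed

text \<open>For a test function \<phi> in place of W this is the definition of the weak divergence,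
  once the gradient of \<phi> is scaled down to an admissible field in the total variation. Uniform
  closeness of \<phi> to W and integrability of the divergence do the rest.\<close>

lemma divergence_pairing_le:
  assumes v: "v \<in> vradon (closure \<Omega>)" and u: "is_divergence \<Omega> v u'"
  shows "L2_inner \<Omega> u' W \<le> total_variation (closure \<Omega>) v (M W)"
proof -
  let ?T = "total_variation (closure \<Omega>) v (M W)"
  have uL: "u' \<in> Lspace \<Omega> 2" using u by (simp add: is_divergence_def)
  define A where "A = integral\<^sup>L (lebesgue_on \<Omega>) (\<lambda>x. \<bar>u' x\<bar>)"
  have iu: "integrable (lebesgue_on \<Omega>) u'" by (rule Lspace2_integrable[OF uL \<Omega>_lmeasurable])
  have *: "L2_inner \<Omega> u' W \<le> (1 + e / k0) * ?T + e * A" if e: "e > 0" for e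
  proof -
    obtain \<phi> D where t: "C1_test \<Omega> \<phi> D" and \<phi>: "\<And>x. \<bar>\<phi> x - Z x\<bar> \<le> e"
      and D: "\<And>x. x \<in> closure \<Omega> \<Longrightarrow> norm (D x) \<le> M W x + e"
      by (rule constrained_test_function[OF e]) blast
    have cD: "continuous_on (closure \<Omega>) D"
      by (rule continuous_on_subset[OF _ subset_UNIV]) (use t in \<open>simp add: C1_test_def\<close>)
    \<comment> \<open>Since the weight is at least k0, M W + e \<le> s M W; dividing the gradient by
      s makes the field admissible.\<close>
    define s where "s = 1 + e / k0"
    have s: "s > 0" using e k0 by (simp add: s_def add_pos_pos)
    have "vpair v (\<lambda>x. (- (1 / s)) *\<^sub>R D x) \<le> ?T"
    proof (rule vpair_le_total_variation[OF v])
      fix x assume x: "x \<in> closure \<Omega>"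
      show "0 \<le> M W x" using M_ge[OF x, of W] k0 by simp
      show "M W x \<le> K" by (rule M_le[OF x])
      have "e = k0 * (e / k0)" using k0 by simp
      also have "\<dots> \<le> M W x * (e / k0)" using M_ge[OF x] e k0 by (intro mult_right_mono) auto
      finally have "norm (D x) \<le> M W x * s" using D[OF x] by (simp add: s_def algebra_simps)
      then show "norm ((- (1 / s)) *\<^sub>R D x) \<le> M W x" using s by (simp add: field_simps)
    next
      show "continuous_on (closure \<Omega>) (\<lambda>x. (- (1 / s)) *\<^sub>R D x)" by (intro continuous_intros cD)
    qed
    then have "- (1 / s) * vpair v D \<le> ?T" by (simp only: vpair_scale[OF v cD])
    then have "- vpair v D \<le> s * ?T" using s by (simp add: field_simps)
    moreover have "vpair v D = - L2_inner \<Omega> u' \<phi>" using u t unfolding is_divergence_def by blast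
    ultimately have 1: "L2_inner \<Omega> u' \<phi> \<le> s * ?T" by simp
    have WL: "W \<in> Lspace \<Omega> 2" "\<phi> \<in> Lspace \<Omega> 2" by (intro Lspace_closure W_cont C1_test_Lspace[OF t \<Omega>_lmeasurable])+
    have "L2_inner \<Omega> u' W - L2_inner \<Omega> u' \<phi> = integral\<^sup>L (lebesgue_on \<Omega>) (\<lambda>x. u' x * W x - u' x * \<phi> x)"
      using Lspace2_integrable_mult[OF uL WL(1)] Lspace2_integrable_mult[OF uL WL(2)] by (simp add: L2_inner_def)
    also have "\<dots> \<le> integral\<^sup>L (lebesgue_on \<Omega>) (\<lambda>x. e * \<bar>u' x\<bar>)"
    proof (rule integral_mono)
      show "integrable (lebesgue_on \<Omega>) (\<lambda>x. u' x * W x - u' x * \<phi> x)"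
        using Lspace2_integrable_mult[OF uL WL(1)] Lspace2_integrable_mult[OF uL WL(2)] by simp
      show "integrable (lebesgue_on \<Omega>) (\<lambda>x. e * \<bar>u' x\<bar>)" using iu by simp
      fix x assume "x \<in> space (lebesgue_on \<Omega>)"
      then have "W x = Z x" by (simp add: zext_def)
      then have le: "\<bar>W x - \<phi> x\<bar> \<le> e" using \<phi>[of x] by (simp add: abs_minus_commute)
      have "u' x * W x - u' x * \<phi> x \<le> \<bar>u' x\<bar> * \<bar>W x - \<phi> x\<bar>"
        by (simp add: abs_mult[symmetric] right_diff_distrib[symmetric])
      also have "\<dots> \<le> \<bar>u' x\<bar> * e" using le by (intro mult_left_mono) auto
      finally show "u' x * W x - u' x * \<phi> x \<le> e * \<bar>u' x\<bar>" by (simp add: mult.commute)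
    qed
    also have "\<dots> = e * A" by (simp add: A_def)
    finally show ?thesis using 1 by (simp add: s_def)
  qed
  have "((\<lambda>e. (1 + e / k0) * ?T + e * A) \<longlongrightarrow> (1 + 0 / k0) * ?T + 0 * A) (at_right 0)"
    using k0 by (intro tendsto_intros) auto
  moreover have "\<forall>\<^sub>F e in at_right 0. L2_inner \<Omega> u' W \<le> (1 + e / k0) * ?T + e * A"
    unfolding eventually_at_right_field using * by (intro exI[of _ 1]) auto
  ultimately have "L2_inner \<Omega> u' W \<le> (1 + 0 / k0) * ?T + 0 * A" by (intro tendsto_lowerbound) auto
  then show ?thesis by simp
qed

lemma limit_variational_inequality:
  assumes "v \<in> VM \<Omega>"
  shows "total_variation (closure \<Omega>) v (M W) - total_variation (closure \<Omega>) Q (M W)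
     - L2_inner \<Omega> (divergence \<Omega> (v - Q)) W \<ge> 0"
proof -
  obtain u' where u': "is_divergence \<Omega> v u'" and v: "v \<in> vradon (closure \<Omega>)" using assms by (auto simp: VM_def)
  have uL: "u' \<in> Lspace \<Omega> 2" using u' by (simp add: is_divergence_def)
  have WL: "W \<in> Lspace \<Omega> 2" by (rule Lspace_closure[OF W_cont(1)])
  have "L2_inner \<Omega> (divergence \<Omega> (v - Q)) W = L2_inner \<Omega> (\<lambda>x. u' x - V x) W"
    by (rule divergence_eq(2)[OF \<Omega> is_divergence_diff[OF \<Omega>_lmeasurable u' Q_divergence] WL])
  also have "\<dots> = L2_inner \<Omega> u' W - L2_inner \<Omega> V W" by (rule L2_inner_diff_left[OF uL V_L2 WL])
  finally show ?thesis using divergence_pairing_le[OF v u'] total_variation_Q_le by linarith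
qed

lemma divergence_Q_inner:
  assumes "\<eta> \<in> Lspace \<Omega> 2"
  shows "L2_inner \<Omega> (divergence \<Omega> Q) \<eta> = L2_inner \<Omega> V \<eta>"
  by (rule divergence_eq(2)[OF \<Omega> Q_divergence assms])

end

subsection \<open>Extraction of subsequences\<close>

lemma uniform_limit_subseq:
  fixes k :: "nat \<Rightarrow> nat"
  assumes "uniform_limit S f l sequentially" "strict_mono k"
  shows "uniform_limit S (\<lambda>j. f (k j)) l sequentially"
  by (rule filterlim_compose[OF assms(1) filterlim_subseq[OF assms(2)]])

lemma vaguely_tendsto_subseq:
  assumes "vaguely_tendsto S v u" "strict_mono k"
  shows "vaguely_tendsto S (\<lambda>j. v (k j)) u"
  unfolding vaguely_tendsto_def
proof (intro ballI allI impI)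
  fix b :: 'a and \<eta> :: "'a \<Rightarrow> real" assume "b \<in> Basis" "continuous_on S \<eta>"
  then have "(\<lambda>j. v j b \<eta>) \<longlonglongrightarrow> u b \<eta>" using assms(1) by (simp add: vaguely_tendsto_def)
  from LIMSEQ_subseq_LIMSEQ[OF this assms(2)] show "(\<lambda>j. v (k j) b \<eta>) \<longlonglongrightarrow> u b \<eta>" by (simp add: o_def)
qed

context nonlinearity
begin

text \<open>The Hoelder bound for the zero extension gives equicontinuity up to the boundary; the
  flux subsequence is taken inside the one for w.\<close>

lemma step_subsequence:
  fixes w :: "nat \<Rightarrow> 'a \<Rightarrow> real" and q :: "nat \<Rightarrow> 'a \<Rightarrow> 'a"
  assumes q: "\<And>j. q j \<in> Vr \<Omega> (r j)" "\<And>j. r j > 1"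
      "\<And>j. integral\<^sup>L (lebesgue_on \<Omega>) (\<lambda>x. norm (q j x) powr r j) \<le> C"
    and w: "\<And>j x. x \<in> frontier \<Omega> \<Longrightarrow> w j x = 0" "\<And>j x. x \<in> closure \<Omega> \<Longrightarrow> \<bar>w j x\<bar> \<le> C"
      "\<And>j x y. norm (x - y) \<le> 1 \<Longrightarrow> \<bar>zext \<Omega> (w j) x - zext \<Omega> (w j) y\<bar> \<le> C * sqrt (norm (x - y))"
  shows "\<exists>k W Q. strict_mono (k :: nat \<Rightarrow> nat) \<and> uniform_limit (closure \<Omega>) (\<lambda>j. w (k j)) W sequentially \<and>
    vaguely_tendsto (closure \<Omega>) (\<lambda>j. vdens \<Omega> (q (k j))) Q"
proof -
  have wz: "zext \<Omega> (w j) x = w j x" if "x \<in> closure \<Omega>" for j x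
    by (rule zext_closure[OF \<Omega>(1) w(1) that])
  have comp: "compact (closure \<Omega>)" using \<Omega>(2) by simp
  have bd: "norm (w j x) \<le> C" if "x \<in> closure \<Omega>" for j x using w(2)[OF that] by simp
  have equi: "\<exists>d>0. \<forall>n y. y \<in> closure \<Omega> \<and> norm (x - y) < d \<longrightarrow> norm (w n x - w n y) < e"
    if x: "x \<in> closure \<Omega>" and e: "0 < e" for x e
  proof -
    have C1: "\<bar>C\<bar> + 1 > 0" by simp
    define a where "a = e / (\<bar>C\<bar> + 1)"
    have a: "a > 0" unfolding a_def by (rule divide_pos_pos[OF e C1])
    show ?thesis
    \<comment> \<open>The modulus is a multiple of the square root, hence the square of a; the
      Hoelder bound is available for distances up to 1 only.\<close>
    proof (intro exI[of _ "min 1 (a\<^sup>2)"] conjI allI impI)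
      show "0 < min 1 (a\<^sup>2)" using a by simp
      fix n y assume y: "y \<in> closure \<Omega> \<and> norm (x - y) < min 1 (a\<^sup>2)"
      then have "sqrt (norm (x - y)) < sqrt (a\<^sup>2)" by (intro real_sqrt_less_mono) simp
      then have s: "sqrt (norm (x - y)) < a" using a by simp
      have "norm (w n x - w n y) \<le> C * sqrt (norm (x - y))"
        using w(3)[of x y n] y x by (simp add: wz)
      also have "\<dots> \<le> (\<bar>C\<bar> + 1) * sqrt (norm (x - y))" by (intro mult_right_mono) auto
      also have "\<dots> < (\<bar>C\<bar> + 1) * a" by (rule mult_strict_left_mono[OF s C1])
      also have "\<dots> = e" unfolding a_def using C1 by (simp add: field_simps)
      finally show "norm (w n x - w n y) < e" .
    qed
  qed
  obtain W k1 where k1: "strict_mono (k1 :: nat \<Rightarrow> nat)"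
      "\<And>e. 0 < e \<Longrightarrow> \<exists>N. \<forall>n x. n \<ge> N \<and> x \<in> closure \<Omega> \<longrightarrow> norm (w (k1 n) x - W x) < e"
    by (rule Arzela_Ascoli[OF comp bd equi]) blast+
  have ul: "uniform_limit (closure \<Omega>) (\<lambda>j. w (k1 j)) W sequentially"
  proof (rule uniform_limitI)
    fix e :: real assume "e > 0"
    from k1(2)[OF this] show "\<forall>\<^sub>F j in sequentially. \<forall>x\<in>closure \<Omega>. dist (w (k1 j) x) (W x) < e"
      unfolding eventually_sequentially dist_norm by blast
  qed
  obtain k2 :: "nat \<Rightarrow> nat" where k2: "strict_mono k2"
    "\<And>b \<eta>. b \<in> Basis \<Longrightarrow> continuous_on (closure \<Omega>) \<eta> \<Longrightarrow> convergent (\<lambda>j. vdens \<Omega> (q (k1 (k2 j))) b \<eta>)"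
  proof (rule vague_compactness[OF \<Omega>, of "\<lambda>j. q (k1 j)"])
    show "integrable (lebesgue_on \<Omega>) (q (k1 j))" for j by (rule Vr_integrable(3)[OF q(1,2)])
    show "integral\<^sup>L (lebesgue_on \<Omega>) (\<lambda>x. norm (q (k1 j) x)) \<le> C + measure (lebesgue_on \<Omega>) \<Omega>" for j
      by (rule Vr_L1_bound[OF q])
  qed blast
  define Q where "Q b \<eta> = lim (\<lambda>j. vdens \<Omega> (q (k1 (k2 j))) b \<eta>)" for b \<eta>
  have "vaguely_tendsto (closure \<Omega>) (\<lambda>j. vdens \<Omega> (q (k1 (k2 j)))) Q"
    unfolding vaguely_tendsto_def Q_def using k2(2) by (simp add: convergent_LIMSEQ_iff)
  moreover have "uniform_limit (closure \<Omega>) (\<lambda>j. w (k1 (k2 j))) W sequentially"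
    by (rule uniform_limit_subseq[OF ul k2(1)])
  moreover have "strict_mono (\<lambda>j. k1 (k2 j))"
    using strict_mono_o[OF k1(1) k2(1)] by (simp add: o_def)
  ultimately show ?thesis by blast
qed

end

section \<open>The time steps in succession, along one common subsequence\<close>

theorem theorem3p3:
  fixes \<Omega> :: "'a::euclidean_space set"
    and T k0 \<epsilon> :: real
    and f :: "real \<Rightarrow> 'a \<Rightarrow> real"
    and w0 :: "'a \<Rightarrow> real"
    and t :: "nat \<Rightarrow> real"
    and N :: nat
    and r :: "nat \<Rightarrow> real"
    and w :: "nat \<Rightarrow> nat \<Rightarrow> 'a \<Rightarrow> real"
    and q :: "nat \<Rightarrow> nat \<Rightarrow> 'a \<Rightarrow> 'a"
  assumes "DIM('a) \<in> {1, 2}"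
    and "convex_polygonal_domain \<Omega>"
    and "T > 0" and "k0 > 0" and "\<epsilon> > 0"
    and "(\<lambda>(s, x). f s x) \<in> Lspace ({0<..<T} \<times> \<Omega>) 2"
    and "AE (s, x) in lebesgue_on ({0<..<T} \<times> \<Omega>). f s x \<ge> 0"
    and "w0 \<in> W10 \<Omega> \<infinity>" and "w0 \<in> C1_closure \<Omega>"
    and "\<And>x \<nu>. outward_unit_normal \<Omega> x \<nu> \<Longrightarrow> grad \<Omega> w0 x \<bullet> \<nu> < k0"
    and "t 0 = 0" and "t N = T" and "\<And>n. n < N \<Longrightarrow> t n < t (Suc n)"
    and "Max ((\<lambda>n. t n - t (n - 1)) ` {1..N}) \<in> {0<..1/2}"
    and "\<And>j. r j > 1" and "r \<longlonglongrightarrow> 1"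
    and "\<And>j. solves_Qr \<Omega> k0 \<epsilon> w0 f t N (r j) (w j) (q j)"
  shows "\<exists>\<sigma> :: nat \<Rightarrow> nat. strict_mono \<sigma> \<and>
    (\<exists>w' :: nat \<Rightarrow> 'a \<Rightarrow> real. \<exists>q' :: nat \<Rightarrow> 'a vmeas.
       solves_Q \<Omega> k0 \<epsilon> w0 f t N w' q' \<and>
       (\<forall>n\<in>{0..N}.
          uniform_limit (closure \<Omega>) (\<lambda>j. w (\<sigma> j) n) (w' n) sequentially \<and>
          uniform_limit (closure \<Omega>) (\<lambda>j. M_op \<Omega> k0 \<epsilon> w0 (w (\<sigma> j) n))
            (M_op \<Omega> k0 \<epsilon> w0 (w' n)) sequentially) \<and>
       (\<forall>n\<in>{1..N}.
          vaguely_tendsto (closure \<Omega>) (\<lambda>j. vdens \<Omega> (q (\<sigma> j) n)) (q' n) \<and>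
          (\<forall>\<eta>. \<eta> \<in> Lspace \<Omega> 2 \<longrightarrow>
             (\<lambda>j. L2_inner \<Omega> (divergence \<Omega> (vdens \<Omega> (q (\<sigma> j) n))) \<eta>)
               \<longlonglongrightarrow> L2_inner \<Omega> (divergence \<Omega> (q' n)) \<eta>)))"
proof -
  define M where "M = M_op \<Omega> k0 \<epsilon> w0"
  have dom: "open \<Omega>" "bounded \<Omega>" "\<Omega> \<noteq> {}"
    using assms(2) by (auto simp: convex_polygonal_domain_def)
  obtain K where K: "K > 0"
    "\<And>\<eta> x. x \<in> closure \<Omega> \<Longrightarrow> k0 \<le> M_op \<Omega> k0 \<epsilon> w0 \<eta> x"
    "\<And>\<eta> x. x \<in> closure \<Omega> \<Longrightarrow> M_op \<Omega> k0 \<epsilon> w0 \<eta> x \<le> K"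
    "\<And>\<eta> \<zeta> x. x \<in> closure \<Omega> \<Longrightarrow>
       \<bar>M_op \<Omega> k0 \<epsilon> w0 \<eta> x - M_op \<Omega> k0 \<epsilon> w0 \<zeta> x\<bar> \<le> K / \<epsilon> * \<bar>\<eta> x - \<zeta> x\<bar>"
    "\<And>\<eta>. continuous_on (closure \<Omega>) \<eta> \<Longrightarrow> continuous_on (closure \<Omega>) (M_op \<Omega> k0 \<epsilon> w0 \<eta>)"
    by (rule M_op_props[OF dom(2) assms(9,4,5)]) blast
  interpret nonlinearity \<Omega> M k0 K "K / \<epsilon>"
    by unfold_locales (use dom K assms(4,5) in \<open>auto simp: M_def\<close>)
  define \<tau> where "\<tau> n = t n - t (n - 1)" for n
  have \<tau>: "\<tau> n > 0" if "n \<in> {1..N}" for n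
    using assms(13)[of "n - 1"] that by (cases n) (auto simp: \<tau>_def)
  note sol = assms(17)[unfolded solves_Qr_def]
  have cw0: "continuous_on (closure \<Omega>) w0" using assms(8) by (simp add: W10_def)
  have w_0: "w j 0 x = w0 x" if "x \<in> closure \<Omega>" for j x using sol[of j] that by blast
  have w_n: "w j n \<in> W10 \<Omega> (ennreal (r j / (r j - 1)))" "q j n \<in> Vr \<Omega> (r j)"
      "balance \<Omega> t f (w j) (vdens \<Omega> (q j n)) n"
      "\<And>v. v \<in> Vr \<Omega> (r j) \<Longrightarrow>
           L2_inner \<Omega> (\<lambda>x. (M (w j n) x * norm (q j n x) powr (r j - 2)) *\<^sub>R q j n x) v
             - L2_inner \<Omega> (w j n) (divergence \<Omega> (vdens \<Omega> v)) = 0" if "n \<in> {1..N}" for j n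
    using sol[of j] that unfolding M_def by blast+
  have wc: "continuous_on (closure \<Omega>) (w j n)" if "n \<le> N" for j n
  proof (cases "n = 0")
    case True
    have "continuous_on (closure \<Omega>) (w j 0)"
      by (rule continuous_on_eq[OF cw0]) (simp add: w_0)
    then show ?thesis using True by simp
  next
    case False
    then show ?thesis using w_n(1)[of n j] that by (simp add: W10_def)
  qed
  \<comment> \<open>An L^2 representative of the functional (f^n, .), read off the balance for j =
    0. The balance for any other j yields the same functional, so U serves all r. The factors 1
    match \<open>L2_inner_linear\<close>.\<close>
  define U where "U n x = 1 * ((1 / \<tau> n) * w 0 n x + (- (1 / \<tau> n)) * w 0 (n - 1) x)
      + 1 * divergence \<Omega> (vdens \<Omega> (q 0 n)) x" for n x
  have divL: "divergence \<Omega> (vdens \<Omega> (q j n)) \<in> Lspace \<Omega> 2" if n: "n \<in> {1..N}" for j n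
  proof -
    obtain v where "is_divergence \<Omega> (vdens \<Omega> (q j n)) v" using w_n(2)[OF n, of j] by (auto simp: Vr_def)
    from divergence_eq(1)[OF dom(1,2) this] show ?thesis by (simp add: is_divergence_def)
  qed
  have quot: "(\<lambda>x. (w j n x - w j (n - 1) x) / \<tau> n) = (\<lambda>x. (1 / \<tau> n) * w j n x + (- (1 / \<tau> n)) * w j (n - 1) x)" for j n
    by (rule ext) (simp add: diff_divide_distrib)
  have quotL: "(\<lambda>x. (1 / \<tau> n) * w j n x + (- (1 / \<tau> n)) * w j (n - 1) x) \<in> Lspace \<Omega> 2" if "n \<in> {1..N}" for j n
    using that by (intro Lspace2_linear Lspace_closure wc) auto
  have UL: "U n \<in> Lspace \<Omega> 2" if n: "n \<in> {1..N}" for n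
    unfolding U_def[abs_def] by (intro Lspace2_linear quotL[OF n] divL[OF n])
  have bal: "L2_inner \<Omega> (\<lambda>x. (w j n x - w j (n - 1) x) / \<tau> n) \<eta> + L2_inner \<Omega> (divergence \<Omega> (vdens \<Omega> (q j n))) \<eta>
      = L2_inner \<Omega> (time_mean t f n) \<eta>" if "n \<in> {1..N}" "\<eta> \<in> Lspace \<Omega> 2" for j n \<eta>
    using w_n(3)[OF that(1), of j] that(2) by (simp add: balance_def \<tau>_def)
  have U_inner: "L2_inner \<Omega> (U n) \<eta> = L2_inner \<Omega> (time_mean t f n) \<eta>" if n: "n \<in> {1..N}" and \<eta>: "\<eta> \<in> Lspace \<Omega> 2" for n \<eta>
  proof -
    have "L2_inner \<Omega> (U n) \<eta> = 1 * L2_inner \<Omega> (\<lambda>x. (1 / \<tau> n) * w 0 n x + (- (1 / \<tau> n)) * w 0 (n - 1) x) \<eta>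
        + 1 * L2_inner \<Omega> (divergence \<Omega> (vdens \<Omega> (q 0 n))) \<eta>"
      unfolding U_def[abs_def] by (intro L2_inner_linear quotL[OF n] divL[OF n] \<eta>)
    then show ?thesis using bal[OF n \<eta>, of 0] unfolding quot by simp
  qed
  have step: "step_solution \<Omega> M (\<tau> n) (U n) (r j) (w j (n - 1)) (w j n) (q j n)" if n: "n \<in> {1..N}" for j n
    unfolding step_solution_def
  proof (intro conjI ballI allI impI)
    show "continuous_on (closure \<Omega>) (w j (n - 1))" "continuous_on (closure \<Omega>) (w j n)" using n by (intro wc; auto)+
    show "w j n x = 0" if "x \<in> frontier \<Omega>" for x using w_n(1)[OF n, of j] that by (simp add: W10_def)
    show "L2_inner \<Omega> (\<lambda>x. (w j n x - w j (n - 1) x) / \<tau> n) \<eta> + L2_inner \<Omega> (divergence \<Omega> (vdens \<Omega> (q j n))) \<eta>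
        = L2_inner \<Omega> (U n) \<eta>" if "\<eta> \<in> Lspace \<Omega> 2" for \<eta>
      using bal[OF n that] U_inner[OF n that] by simp
  qed (use w_n[OF n] in auto)
  have "(\<lambda>j. DIM('a) * ((r j - 1) / r j)) \<longlonglongrightarrow> DIM('a) * ((1 - 1) / 1)"
    by (intro tendsto_intros assms(16)) auto
  then have "\<forall>\<^sub>F j in sequentially. DIM('a) * ((r j - 1) / r j) < 1 / 2"
    by (rule order_tendstoD) simp
  \<comment> \<open>From J on the exponents are close enough to 1 for
    \<open>step_uniform_bounds\<close>; dropping finitely many indices does not affect the
    limit.\<close>
  then obtain J where J: "\<And>j. j \<ge> J \<Longrightarrow> DIM('a) * ((r j - 1) / r j) \<le> 1 / 2"
    unfolding eventually_sequentially by (meson less_imp_le)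
  \<comment> \<open>The induction hypothesis over the steps: a sup bound for step n - 1, uniform in
    j, is what the constants of step n depend on.\<close>
  define bounded_by where "bounded_by n B \<longleftrightarrow> (\<forall>j\<ge>J. \<forall>x\<in>closure \<Omega>. \<bar>w j n x\<bar> \<le> B)" for n B
  have stepB: "\<exists>C. \<forall>j\<ge>J. integral\<^sup>L (lebesgue_on \<Omega>) (\<lambda>x. norm (q j n x) powr r j) \<le> C \<and>
      (\<forall>x\<in>closure \<Omega>. \<bar>w j n x\<bar> \<le> C) \<and>
      (\<forall>x y. norm (x - y) \<le> 1 \<longrightarrow> \<bar>zext \<Omega> (w j n) x - zext \<Omega> (w j n) y\<bar> \<le> C * sqrt (norm (x - y)))"
    if n: "n \<in> {1..N}" and B: "bounded_by (n - 1) B" for n B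
  proof -
    obtain C where C: "\<And>r w' w q. step_solution \<Omega> M (\<tau> n) (U n) r w' w q \<Longrightarrow> r > 1 \<Longrightarrow>
      DIM('a) * ((r - 1) / r) \<le> 1 / 2 \<Longrightarrow> \<forall>x\<in>closure \<Omega>. \<bar>w' x\<bar> \<le> B \<Longrightarrow>
      integral\<^sup>L (lebesgue_on \<Omega>) (\<lambda>x. norm (q x) powr r) \<le> C \<and> (\<forall>x\<in>closure \<Omega>. \<bar>w x\<bar> \<le> C) \<and>
      (\<forall>x y. norm (x - y) \<le> 1 \<longrightarrow> \<bar>zext \<Omega> w x - zext \<Omega> w y\<bar> \<le> C * sqrt (norm (x - y)))"
      using step_uniform_bounds[OF UL[OF n] \<tau>[OF n], of B] by blast
    show ?thesis
    proof (intro exI allI impI)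
      fix j assume j: "J \<le> j"
      show "integral\<^sup>L (lebesgue_on \<Omega>) (\<lambda>x. norm (q j n x) powr r j) \<le> C \<and> (\<forall>x\<in>closure \<Omega>. \<bar>w j n x\<bar> \<le> C) \<and>
        (\<forall>x y. norm (x - y) \<le> 1 \<longrightarrow> \<bar>zext \<Omega> (w j n) x - zext \<Omega> (w j n) y\<bar> \<le> C * sqrt (norm (x - y)))"
        by (rule C[OF step[OF n] assms(15) J[OF j]]) (use B j in \<open>simp add: bounded_by_def\<close>)
    qed
  qed
  have "\<exists>B. bounded_by n B" if "n \<le> N" for n
    using that
  proof (induction n)
    case 0
    obtain B where "\<And>x. x \<in> closure \<Omega> \<Longrightarrow> norm (w0 x) \<le> B" by (rule bounded_closure[OF cw0]) blast
    then show ?case by (auto simp: bounded_by_def w_0 intro!: exI[of _ B])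
  next
    case (Suc n)
    then obtain B where "bounded_by n B" by auto
    then show ?case using stepB[of "Suc n" B] Suc.prems unfolding bounded_by_def by fastforce
  qed
  then have bB: "\<And>n. n \<le> N \<Longrightarrow> \<exists>B. bounded_by n B" .
  have "\<exists>C. \<forall>n\<in>{1..N}. \<forall>j\<ge>J. integral\<^sup>L (lebesgue_on \<Omega>) (\<lambda>x. norm (q j n x) powr r j) \<le> C n \<and>
      (\<forall>x\<in>closure \<Omega>. \<bar>w j n x\<bar> \<le> C n) \<and>
      (\<forall>x y. norm (x - y) \<le> 1 \<longrightarrow> \<bar>zext \<Omega> (w j n) x - zext \<Omega> (w j n) y\<bar> \<le> C n * sqrt (norm (x - y)))"
  proof (rule bchoice, rule ballI)
    fix n assume n: "n \<in> {1..N}"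
    then have "n - 1 \<le> N" by auto
    from bB[OF this] obtain B where "bounded_by (n - 1) B" ..
    from stepB[OF n this]
    show "\<exists>C. \<forall>j\<ge>J. integral\<^sup>L (lebesgue_on \<Omega>) (\<lambda>x. norm (q j n x) powr r j) \<le> C \<and>
      (\<forall>x\<in>closure \<Omega>. \<bar>w j n x\<bar> \<le> C) \<and>
      (\<forall>x y. norm (x - y) \<le> 1 \<longrightarrow> \<bar>zext \<Omega> (w j n) x - zext \<Omega> (w j n) y\<bar> \<le> C * sqrt (norm (x - y)))" .
  qed
  then obtain C where C: "\<And>n j. n \<in> {1..N} \<Longrightarrow> j \<ge> J \<Longrightarrow> integral\<^sup>L (lebesgue_on \<Omega>) (\<lambda>x. norm (q j n x) powr r j) \<le> C n"
    "\<And>n j x. n \<in> {1..N} \<Longrightarrow> j \<ge> J \<Longrightarrow> x \<in> closure \<Omega> \<Longrightarrow> \<bar>w j n x\<bar> \<le> C n"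
    "\<And>n j x y. n \<in> {1..N} \<Longrightarrow> j \<ge> J \<Longrightarrow> norm (x - y) \<le> 1 \<Longrightarrow>
       \<bar>zext \<Omega> (w j n) x - zext \<Omega> (w j n) y\<bar> \<le> C n * sqrt (norm (x - y))"
    by blast
  \<comment> \<open>Step 0 has a value but no flux, hence the restriction to n \<ge> 1. Goodness is
    inherited by subsequences, so later extractions keep earlier limits.\<close>
  define good where "good \<sigma> n \<longleftrightarrow> (\<exists>W. uniform_limit (closure \<Omega>) (\<lambda>j. w (\<sigma> j) n) W sequentially) \<and>
     (n \<ge> 1 \<longrightarrow> (\<exists>Q. vaguely_tendsto (closure \<Omega>) (\<lambda>j. vdens \<Omega> (q (\<sigma> j) n)) Q))" for \<sigma> :: "nat \<Rightarrow> nat" and n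
  have good_subseq: "good (\<lambda>j. \<sigma> (k j)) n" if "good \<sigma> n" "strict_mono k" for \<sigma> k n
    using that uniform_limit_subseq[OF _ that(2)] vaguely_tendsto_subseq[OF _ that(2)] unfolding good_def by blast
  \<comment> \<open>There are finitely many steps, so repeated thinning suffices and no diagonal
    sequence is taken. Staying above J keeps the uniform bounds available.\<close>
  have "\<exists>\<sigma>. strict_mono \<sigma> \<and> (\<forall>j. \<sigma> j \<ge> J) \<and> (\<forall>n\<le>m. good \<sigma> n)" if "m \<le> N" for m
    using that
  proof (induction m)
    case 0
    have "uniform_limit (closure \<Omega>) (\<lambda>j. w (j + J) 0) w0 sequentially"
      by (rule uniform_limitI) (simp add: w_0)
    then show ?case by (intro exI[of _ "\<lambda>j. j + J"]) (auto simp: good_def strict_mono_def)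
  next
    case (Suc m)
    then obtain \<sigma> where \<sigma>: "strict_mono \<sigma>" "\<And>j. \<sigma> j \<ge> J" "\<And>n. n \<le> m \<Longrightarrow> good \<sigma> n" by auto
    have n: "Suc m \<in> {1..N}" using Suc.prems by simp
    have "\<exists>k W Q. strict_mono (k :: nat \<Rightarrow> nat) \<and> uniform_limit (closure \<Omega>) (\<lambda>j. w (\<sigma> (k j)) (Suc m)) W sequentially \<and>
      vaguely_tendsto (closure \<Omega>) (\<lambda>j. vdens \<Omega> (q (\<sigma> (k j)) (Suc m))) Q"
    proof (rule step_subsequence[where r="\<lambda>j. r (\<sigma> j)" and C="C (Suc m)"])
      show "w (\<sigma> j) (Suc m) x = 0" if "x \<in> frontier \<Omega>" for j x
        using step[OF n, of "\<sigma> j"] that by (simp add: step_solution_def)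
    qed (use w_n(2)[OF n] assms(15) C[OF n \<sigma>(2)] in auto)
    then obtain k W Q where k: "strict_mono (k :: nat \<Rightarrow> nat)"
      and WQ: "uniform_limit (closure \<Omega>) (\<lambda>j. w (\<sigma> (k j)) (Suc m)) W sequentially"
       "vaguely_tendsto (closure \<Omega>) (\<lambda>j. vdens \<Omega> (q (\<sigma> (k j)) (Suc m))) Q" by blast
    have "good (\<lambda>j. \<sigma> (k j)) n" if "n \<le> Suc m" for n
    proof (cases "n = Suc m")
      case True
      then show ?thesis using WQ unfolding good_def by blast
    next
      case False
      then show ?thesis using that good_subseq[OF \<sigma>(3) k] by simp
    qed
    moreover have "strict_mono (\<lambda>j. \<sigma> (k j))" using strict_mono_o[OF \<sigma>(1) k] by (simp add: o_def)
    ultimately show ?case using \<sigma>(2) by (intro exI[of _ "\<lambda>j. \<sigma> (k j)"]) simp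
  qed
  then obtain \<sigma> where \<sigma>: "strict_mono \<sigma>" "\<And>j. \<sigma> j \<ge> J" "\<And>n. n \<le> N \<Longrightarrow> good \<sigma> n" by blast
  have "\<exists>W. \<forall>n\<in>{0..N}. uniform_limit (closure \<Omega>) (\<lambda>j. w (\<sigma> j) n) (W n) sequentially"
    by (rule bchoice) (use \<sigma>(3) in \<open>auto simp: good_def\<close>)
  then obtain W where "\<forall>n\<in>{0..N}. uniform_limit (closure \<Omega>) (\<lambda>j. w (\<sigma> j) n) (W n) sequentially" ..
  then have W: "uniform_limit (closure \<Omega>) (\<lambda>j. w (\<sigma> j) n) (W n) sequentially" if "n \<le> N" for n
    using that by simp
  have "\<exists>Q. \<forall>n\<in>{1..N}. vaguely_tendsto (closure \<Omega>) (\<lambda>j. vdens \<Omega> (q (\<sigma> j) n)) (Q n)"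
    by (rule bchoice) (use \<sigma>(3) in \<open>auto simp: good_def\<close>)
  then obtain Q where Q: "\<And>n. n \<in> {1..N} \<Longrightarrow> vaguely_tendsto (closure \<Omega>) (\<lambda>j. vdens \<Omega> (q (\<sigma> j) n)) (Q n)" by blast
  have lim: "limit_step \<Omega> M k0 K (K / \<epsilon>) (\<tau> n) (U n) (\<lambda>j. r (\<sigma> j)) (\<lambda>j. w (\<sigma> j) (n - 1)) (\<lambda>j. w (\<sigma> j) n)
      (\<lambda>j. q (\<sigma> j) n) (W (n - 1)) (W n) (Q n) (C n)" if n: "n \<in> {1..N}" for n
  proof unfold_locales
    show "(\<lambda>j. r (\<sigma> j)) \<longlonglongrightarrow> 1" using LIMSEQ_subseq_LIMSEQ[OF assms(16) \<sigma>(1)] by (simp add: o_def)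
    show "uniform_limit (closure \<Omega>) (\<lambda>j. w (\<sigma> j) (n - 1)) (W (n - 1)) sequentially"
      "uniform_limit (closure \<Omega>) (\<lambda>j. w (\<sigma> j) n) (W n) sequentially" using n by (intro W; auto)+
  qed (use dom(3) \<tau>[OF n] UL[OF n] assms(15) step[OF n] C(1)[OF n \<sigma>(2)] Q[OF n] in auto)
  have W0: "W 0 x = w0 x" if x: "x \<in> closure \<Omega>" for x
    using tendsto_uniform_limitI[OF W[of 0] x] by (simp add: w_0[OF x] LIMSEQ_const_iff)
  have "solves_Q \<Omega> k0 \<epsilon> w0 f t N W Q"
    unfolding solves_Q_def
  proof (intro conjI ballI)
    fix n assume n: "n \<in> {1..N}"
    interpret limit_step \<Omega> M k0 K "K / \<epsilon>" "\<tau> n" "U n" "\<lambda>j. r (\<sigma> j)" "\<lambda>j. w (\<sigma> j) (n - 1)" "\<lambda>j. w (\<sigma> j) n"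
      "\<lambda>j. q (\<sigma> j) n" "W (n - 1)" "W n" "Q n" "C n" by (rule lim[OF n])
    show "W n \<in> W10 \<Omega> \<infinity>" by (rule W_W10)
    show "Q n \<in> VM \<Omega>" by (rule Q_VM)
    show "balance \<Omega> t f W (Q n) n"
      unfolding balance_def \<tau>_def[symmetric]
    proof (intro allI impI)
      fix \<eta> :: "'a \<Rightarrow> real" assume \<eta>: "\<eta> \<in> Lspace \<Omega> 2"
      have "(\<lambda>x. (W n x - W (n - 1) x) / \<tau> n) = (\<lambda>x. (1 / \<tau> n) * W n x + (- (1 / \<tau> n)) * W (n - 1) x)"
        by (rule ext) (simp add: diff_divide_distrib)
      then have "L2_inner \<Omega> (\<lambda>x. (W n x - W (n - 1) x) / \<tau> n) \<eta>
          = (1 / \<tau> n) * L2_inner \<Omega> (W n) \<eta> + (- (1 / \<tau> n)) * L2_inner \<Omega> (W (n - 1)) \<eta>"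
        by (simp only:) (rule L2_inner_linear[OF Lspace_closure[OF W_cont(1)] Lspace_closure[OF W_cont(2)] \<eta>])
      then show "L2_inner \<Omega> (\<lambda>x. (W n x - W (n - 1) x) / \<tau> n) \<eta> + L2_inner \<Omega> (divergence \<Omega> (Q n)) \<eta>
          = L2_inner \<Omega> (time_mean t f n) \<eta>"
        unfolding divergence_Q_inner[OF \<eta>] V_inner[OF \<eta>] U_inner[OF n \<eta>, symmetric]
        by (simp add: diff_divide_distrib)
    qed
    show "total_variation (closure \<Omega>) v (M_op \<Omega> k0 \<epsilon> w0 (W n)) - total_variation (closure \<Omega>) (Q n) (M_op \<Omega> k0 \<epsilon> w0 (W n))
       - L2_inner \<Omega> (divergence \<Omega> (v - Q n)) (W n) \<ge> 0" if "v \<in> VM \<Omega>" for v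
      using limit_variational_inequality[OF that] by (simp add: M_def)
  qed (rule W0)
  moreover have "(\<lambda>j. L2_inner \<Omega> (divergence \<Omega> (vdens \<Omega> (q (\<sigma> j) n))) \<eta>) \<longlonglongrightarrow> L2_inner \<Omega> (divergence \<Omega> (Q n)) \<eta>"
    if n: "n \<in> {1..N}" and \<eta>: "\<eta> \<in> Lspace \<Omega> 2" for n and \<eta> :: "'a \<Rightarrow> real"
  proof -
    interpret limit_step \<Omega> M k0 K "K / \<epsilon>" "\<tau> n" "U n" "\<lambda>j. r (\<sigma> j)" "\<lambda>j. w (\<sigma> j) (n - 1)" "\<lambda>j. w (\<sigma> j) n"
      "\<lambda>j. q (\<sigma> j) n" "W (n - 1)" "W n" "Q n" "C n" by (rule lim[OF n])
    show ?thesis unfolding divergence_Q_inner[OF \<eta>] by (rule u_weak_limit[OF \<eta>])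
  qed
  moreover have "uniform_limit (closure \<Omega>) (\<lambda>j. M_op \<Omega> k0 \<epsilon> w0 (w (\<sigma> j) n)) (M_op \<Omega> k0 \<epsilon> w0 (W n)) sequentially"
    if "n \<le> N" for n
    using M_uniform_limit[OF W[OF that]] by (simp add: M_def)
  ultimately show ?thesis using \<sigma>(1) W Q
    by (intro exI[of _ \<sigma>] exI[of _ W] exI[of _ Q] conjI ballI allI impI) auto
qed

end
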